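(* Let $N\ge 3$ and let $\mathbf{u}\in\mathcal{D}(\mathbb{R}^N)$ be a toroidal field. Then \[ \int_{\mathbb{R}^N}|\nabla \mathbf{u}|^2dx\int_{\mathbb{R}^N}|\mathbf{u}|^2|\mathbf{x}|^2dx\ge C_{T,N}\left(\int_{\mathbb{R}^N}|\mathbf{u}|^2dx\right)^2 \] holds with the best constant $C_{T,N}=\frac{(N+2)^2}{4}$. Moreover, $C_{T,N}$ is attained by every field of the form \[ \mathbf{u}_0(\mathbf{x})=\left(\mathbf{c}_1\cdot\mathbf{x},\ \dots,\ \mathbf{c}_N\cdot\mathbf{x}\right)e^{-c|\mathbf{x}|^2}, \] where $c>0$ and $\mathbf{c}_1,\dots,\mathbf{c}_N\in\mathbb{R}^N$ are constant vectors such that the matrix $(\mathbf{c}_1,\dots,\mathbf{c}_N)$ is antisymmetric (and not all zero). Conversely, under the additional condition $\lim_{R\to\infty}R^N\int_{\mathbb{S}^{N-1}}|\mathbf{u}(R\boldsymbol{\sigma})|^2\,d\sigma=0$, every nonzero toroidal field attaining equality is of this form.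
   Context: Vector fields are real: $\mathbf{u}:\mathbb{R}^N\to\mathbb{R}^N$, $|\nabla\mathbf{u}|^2=\sum_{j,k}(\partial u_j/\partial x_k)^2$. The space $\mathcal{D}(\mathbb{R}^N)$ is the Hilbert space completion of $C_c^\infty(\mathbb{R}^N)^N$ with respect to the norm $\|\mathbf{u}\|_{\mathcal{D}}=\left(\int|\mathbf{u}|^2dx+\int|\mathbf{u}|^2|\mathbf{x}|^2dx+\int|\nabla\mathbf{u}|^2dx\right)^{1/2}$. Writing $\mathbf{x}=r\boldsymbol{\sigma}$ with $r=|\mathbf{x}|>0$, $\boldsymbol{\sigma}\in\mathbb{S}^{N-1}$, a vector field $\mathbf{u}$ on $\mathbb{R}^N\setminus\{0\}$ is called toroidal if its radial component $u_R=\boldsymbol{\sigma}\cdot\mathbf{u}$ vanishes and $\operatorname{div}\mathbf{u}=0$ on $\mathbb{R}^N\setminus\{0\}$. "Best constant" means the infimum of the ratio $\int|\nabla\mathbf{u}|^2\int|\mathbf{u}|^2|\mathbf{x}|^2/(\int|\mathbf{u}|^2)^2$ over nonzero toroidal $\mathbf{u}\in\mathcal{D}(\mathbb{R}^N)$; $d\sigma$ is the surface measure on $\mathbb{S}^{N-1}$. *)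

theory Defs
  imports "HOL-Analysis.Analysis"
begin

fun Ck_field :: "nat \<Rightarrow> (real^'n \<Rightarrow> real^'m) \<Rightarrow> bool" where
  "Ck_field 0 f = continuous_on UNIV f"
| "Ck_field (Suc k) f = (f differentiable_on UNIV \<and>
      (\<forall>i\<in>(Basis :: (real^'n) set). Ck_field k (\<lambda>x. frechet_derivative f (at x) i)))"

definition smooth_field :: "(real^'n \<Rightarrow> real^'m) \<Rightarrow> bool" where
  "smooth_field f \<longleftrightarrow> (\<forall>k. Ck_field k f)"

definition Cc_inf_field :: "(real^'n \<Rightarrow> real^'n) \<Rightarrow> bool" where
  "Cc_inf_field f \<longleftrightarrow> smooth_field f \<and> (\<exists>B. \<forall>x. norm x > B \<longrightarrow> f x = 0)"

definition jac :: "(real^'n \<Rightarrow> real^'n) \<Rightarrow> real^'n \<Rightarrow> real^'n^'n" where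
  "jac f x = matrix (frechet_derivative f (at x))"

(* u belongs to D(R^N) (the completion of C_c^infinity in the D-norm, realised as the
   set of limits in that norm), and G is its (weak) gradient:
   G x $ j $ k plays the role of d u_j / d x_k *)
definition D_field :: "(real^'n \<Rightarrow> real^'n) \<Rightarrow> (real^'n \<Rightarrow> real^'n^'n) \<Rightarrow> bool" where
  "D_field u G \<longleftrightarrow> u \<in> borel_measurable lborel \<and> G \<in> borel_measurable lborel \<and>
     (\<exists>\<phi>. (\<forall>k. Cc_inf_field (\<phi> k)) \<and>
        ((\<lambda>k. \<integral>\<^sup>+ x. ennreal ((norm (\<phi> k x - u x))\<^sup>2) \<partial>lborel) \<longlonglongrightarrow> 0) \<and>
        ((\<lambda>k. \<integral>\<^sup>+ x. ennreal ((norm (\<phi> k x - u x))\<^sup>2 * (norm x)\<^sup>2) \<partial>lborel) \<longlonglongrightarrow> 0) \<and>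
        ((\<lambda>k. \<integral>\<^sup>+ x. ennreal ((norm (jac (\<phi> k) x - G x))\<^sup>2) \<partial>lborel) \<longlonglongrightarrow> 0))"

(* toroidal: radial component u_R = sigma . u vanishes and div u = trace of gradient = 0
   on R^N \ {0} (a.e., as u is an element of D) *)
definition toroidal :: "(real^'n \<Rightarrow> real^'n) \<Rightarrow> (real^'n \<Rightarrow> real^'n^'n) \<Rightarrow> bool" where
  "toroidal u G \<longleftrightarrow> (AE x in lborel. x \<noteq> 0 \<longrightarrow> x \<bullet> u x = 0) \<and>
                   (AE x in lborel. x \<noteq> 0 \<longrightarrow> (\<Sum>j\<in>UNIV. G x $ j $ j) = 0)"

definition grad_sq :: "(real^'n \<Rightarrow> real^'n^'n) \<Rightarrow> real" where
  "grad_sq G = (\<integral>x. (norm (G x))\<^sup>2 \<partial>lborel)"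

definition L2_sq :: "(real^'n \<Rightarrow> real^'n) \<Rightarrow> real" where
  "L2_sq u = (\<integral>x. (norm (u x))\<^sup>2 \<partial>lborel)"

definition weighted_sq :: "(real^'n \<Rightarrow> real^'n) \<Rightarrow> real" where
  "weighted_sq u = (\<integral>x. (norm (u x))\<^sup>2 * (norm x)\<^sup>2 \<partial>lborel)"

(* integral over S^{N-1} w.r.t. surface measure, via the cone-measure identity
   int_{S^{N-1}} g dsigma = N * int_{B(0,1)} g(x/|x|) dx *)
definition sphere_integral :: "(real^'n \<Rightarrow> real) \<Rightarrow> real" where
  "sphere_integral g = real CARD('n) * (\<integral>x. indicator (ball 0 1) x * g (x /\<^sub>R norm x) \<partial>lborel)"

definition extremal_field :: "real^'n^'n \<Rightarrow> real \<Rightarrow> real^'n \<Rightarrow> real^'n" where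
  "extremal_field C c x = exp (- c * (norm x)\<^sup>2) *\<^sub>R (C *v x)"

end

theory Submission
  imports Defs "HOL-Probability.Distributions"
begin

text \<open>
  Write \<open>S = G + G\<^sup>T\<close> and \<open>T = x \<otimes> u + u \<otimes> x\<close>. For toroidal \<open>u\<close>, integration by parts gives
  \<open>\<integral>tr(G\<^sup>2) = \<integral>(div u)\<^sup>2 = 0\<close>, hence \<open>\<integral>|S|\<^sup>2 = 2\<integral>|G|\<^sup>2\<close>, and
  \<open>\<integral>S \<bullet> T = -(N + 2)\<integral>|u|\<^sup>2\<close>, while \<open>|T|\<^sup>2 = 2|x|\<^sup>2|u|\<^sup>2\<close>. The inequality is therefore
  Cauchy-Schwarz for \<open>S\<close> and \<open>T\<close>, with equality iff \<open>S = -\<mu>T\<close>. In that case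
  \<open>w = exp(\<mu>|x|\<^sup>2/2) u\<close> has vanishing symmetric gradient. Integrating along segments, this yields
  \<open>(w(x) - w(y)) \<bullet> (x - y) = 0\<close> for almost all pairs, which together with \<open>x \<bullet> w(x) = 0\<close> forces
  \<open>w(x) = Cx\<close> with \<open>C\<close> antisymmetric.
\<close>

section \<open>The divergence theorem for compactly supported functions\<close>

text \<open>Pairing G with u \<otimes> x alone yields -N/2 times the integral of |u|^2, hence only
  the constant N^2/4. Adding the pairing with x \<otimes> u contributes one more -1, and N/2 + 1
  squared is the sharp constant; the symmetrization costs nothing because the integral of tr(G^2)
  and the function x \<bullet> u both vanish. The obstacle is that members of the space are limits
  of test fields which need not be toroidal, and that u itself has only an L2 gradient. Every
  identity is therefore proved for arbitrary test fields with its divergence terms kept, and these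
  disappear only in the limit. For the same reason w is never differentiated: the bound on (w(x) -
  w(y)) \<bullet> (x - y) is proved for weighted test fields, where it is controlled by the L2 norm
  of the symmetric gradient, and then carried to the limit. The weight exp(\<mu>|x|^2/2) is the
  integrating factor that absorbs the term \<mu>T. No Gaussian integral is evaluated for the
  extremals: equality follows from S = -2cT and the same quadratic identity that proves the
  inequality.\<close>

lemma integrable_continuous_bounded_support:
  fixes f :: "'a::euclidean_space \<Rightarrow> 'b::euclidean_space"
  assumes cont: "continuous_on UNIV f" and B: "\<And>x. norm x > B \<Longrightarrow> f x = 0"
  shows "integrable lborel f"
proof -
  have "integrable lborel (\<lambda>x. indicator (cball 0 B) x *\<^sub>R f x)"
    by (rule borel_integrable_compact) (auto intro: continuous_on_subset[OF cont])
  moreover have "(\<lambda>x. indicator (cball 0 B) x *\<^sub>R f x) = f"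
    using B by (auto simp: indicator_def fun_eq_iff)
  ultimately show ?thesis by simp
qed

lemma bounded_continuous_bounded_support:
  fixes f :: "'a::euclidean_space \<Rightarrow> 'b::euclidean_space"
  assumes cont: "continuous_on UNIV f" and B: "\<And>x. norm x > B \<Longrightarrow> f x = 0"
  obtains K where "K \<ge> 0" "\<And>x. norm (f x) \<le> K"
proof -
  have "compact (f ` cball 0 B)"
    by (rule compact_continuous_image) (auto intro: continuous_on_subset[OF cont])
  then obtain K where K: "\<And>y. y \<in> f ` cball 0 B \<Longrightarrow> norm y \<le> K"
    using compact_imp_bounded bounded_iff by metis
  have "norm (f x) \<le> max K 0" for x
    using K[of "f x"] B[of x] by (cases "norm x > B") auto
  then show ?thesis by (intro that[of "max K 0"]) auto
qed

lemma difference_quotient_tendsto: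
  fixes f :: "'a::euclidean_space \<Rightarrow> real"
  assumes D: "(f has_derivative F) (at x)"
  shows "(\<lambda>n. (f (x + (1 / real (Suc n)) *\<^sub>R b) - f x) * real (Suc n)) \<longlonglongrightarrow> F b"
proof -
  interpret bounded_linear F using D by (rule has_derivative_bounded_linear)
  have "((\<lambda>t. x + t *\<^sub>R b) has_derivative (\<lambda>t. t *\<^sub>R b)) (at 0)"
    by (auto intro!: derivative_eq_intros)
  moreover have "(f has_derivative F) (at (x + 0 *\<^sub>R b))" using D by simp
  ultimately have "((\<lambda>t. f (x + t *\<^sub>R b)) has_derivative (\<lambda>t. F (t *\<^sub>R b))) (at 0)"
    by (rule has_derivative_compose)
  moreover have "(\<lambda>t. F (t *\<^sub>R b)) = (*) (F b)" by (auto simp: scaleR mult.commute)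
  ultimately have "((\<lambda>t. f (x + t *\<^sub>R b)) has_field_derivative F b) (at 0)"
    by (simp add: has_field_derivative_def)
  then have "((\<lambda>h. (f (x + h *\<^sub>R b) - f x) / h) \<longlongrightarrow> F b) (at 0)"
    by (simp add: DERIV_def)
  moreover have "filterlim (\<lambda>n. 1 / real (Suc n)) (at 0) sequentially"
    unfolding filterlim_at using LIMSEQ_inverse_real_of_nat by (auto simp: field_simps inverse_eq_divide)
  ultimately have "(\<lambda>n. (f (x + (1 / real (Suc n)) *\<^sub>R b) - f x) / (1 / real (Suc n))) \<longlonglongrightarrow> F b"
    by (rule filterlim_compose)
  then show ?thesis by simp
qed

lemma difference_quotient_bound:
  fixes f :: "'a::euclidean_space \<Rightarrow> real"
  assumes D: "\<And>x. (f has_derivative F x) (at x)" and K: "\<And>x. \<bar>F x b\<bar> \<le> K"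
  shows "\<bar>f (x + t *\<^sub>R b) - f x\<bar> \<le> K * \<bar>t\<bar>"
proof -
  have d: "((\<lambda>s. f (x + s *\<^sub>R b)) has_derivative (\<lambda>h. h * F (x + s *\<^sub>R b) b)) (at s)" for s
  proof -
    interpret bounded_linear "F (x + s *\<^sub>R b)" using D by (rule has_derivative_bounded_linear)
    have "((\<lambda>s. x + s *\<^sub>R b) has_derivative (\<lambda>h. h *\<^sub>R b)) (at s)"
      by (auto intro!: derivative_eq_intros)
    from has_derivative_compose[OF this D[of "x + s *\<^sub>R b"]]
    have "((\<lambda>s. f (x + s *\<^sub>R b)) has_derivative (\<lambda>h. F (x + s *\<^sub>R b) (h *\<^sub>R b))) (at s)" .
    moreover have "(\<lambda>h. F (x + s *\<^sub>R b) (h *\<^sub>R b)) = (\<lambda>h. h * F (x + s *\<^sub>R b) b)" by (auto simp: scaleR)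
    ultimately show ?thesis by simp
  qed
  have "norm ((\<lambda>s. f (x + s *\<^sub>R b)) t - (\<lambda>s. f (x + s *\<^sub>R b)) 0) \<le> K * norm (t - 0)"
  proof (rule differentiable_bound[of UNIV])
    show "((\<lambda>s. f (x + s *\<^sub>R b)) has_derivative (\<lambda>h. h * F (x + s *\<^sub>R b) b)) (at s within UNIV)" for s
      using d by simp
    show "onorm (\<lambda>h. h * F (x + s *\<^sub>R b) b) \<le> K" for s
    proof (rule onorm_le)
      show "norm (h * F (x + s *\<^sub>R b) b) \<le> K * norm h" for h
        using mult_right_mono[OF K[of "x + s *\<^sub>R b"], of "\<bar>h\<bar>"] by (simp add: abs_mult mult.commute)
    qed
  qed auto
  then show ?thesis by simp
qed

text \<open>The mean value bound makes K |w| a majorant of all quotients at once. The weight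
  \<open>w\<close> is left general because two weights are needed later: the indicator of a ball for
  the divergence theorem, and a derivative of another function for the exchange of
  derivatives.\<close>

lemma integral_difference_quotient_tendsto:
  fixes f :: "'a::euclidean_space \<Rightarrow> real"
  assumes D: "\<And>x. (f has_derivative F x) (at x)" and K: "\<And>x. \<bar>F x b\<bar> \<le> K"
    and w: "integrable lborel w"
  shows "(\<lambda>n. \<integral>x. w x * ((f (x + (1 / real (Suc n)) *\<^sub>R b) - f x) * real (Suc n)) \<partial>lborel)
            \<longlonglongrightarrow> (\<integral>x. w x * F x b \<partial>lborel)"
proof (rule integral_dominated_convergence[where w="\<lambda>x. \<bar>w x\<bar> * K"])
  have cf: "continuous_on UNIV f"
    using D by (metis continuous_at_imp_continuous_on has_derivative_continuous)
  then have [measurable]: "f \<in> borel_measurable borel" by (rule borel_measurable_continuous_onI)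
  have [measurable]: "w \<in> borel_measurable lborel" using w by auto
  have lim: "(\<lambda>n. (f (x + (1 / real (Suc n)) *\<^sub>R b) - f x) * real (Suc n)) \<longlonglongrightarrow> F x b" for x
    by (rule difference_quotient_tendsto[OF D])
  show "(\<lambda>x. w x * ((f (x + (1 / real (Suc n)) *\<^sub>R b) - f x) * real (Suc n))) \<in> borel_measurable lborel" for n
    by measurable
  have [measurable]: "(\<lambda>x. F x b) \<in> borel_measurable lborel"
    by (rule borel_measurable_LIMSEQ_real[OF lim]) measurable
  show "(\<lambda>x. w x * F x b) \<in> borel_measurable lborel" by measurable
  show "integrable lborel (\<lambda>x. \<bar>w x\<bar> * K)" using w by auto
  show "AE x in lborel. (\<lambda>n. w x * ((f (x + (1 / real (Suc n)) *\<^sub>R b) - f x) * real (Suc n))) \<longlonglongrightarrow> w x * F x b"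
    by (intro AE_I2 tendsto_intros lim)
  show "AE x in lborel. norm (w x * ((f (x + (1 / real (Suc n)) *\<^sub>R b) - f x) * real (Suc n))) \<le> \<bar>w x\<bar> * K" for n
  proof (rule AE_I2)
    fix x
    have "\<bar>f (x + (1 / real (Suc n)) *\<^sub>R b) - f x\<bar> * real (Suc n) \<le> (K * \<bar>1 / real (Suc n)\<bar>) * real (Suc n)"
      by (intro mult_right_mono difference_quotient_bound[OF D K]) auto
    then show "norm (w x * ((f (x + (1 / real (Suc n)) *\<^sub>R b) - f x) * real (Suc n))) \<le> \<bar>w x\<bar> * K"
      by (auto simp: abs_mult intro!: mult_left_mono)
  qed
qed

lemma lborel_integral_translate:
  fixes f :: "'a::euclidean_space \<Rightarrow> real"
  assumes [measurable]: "f \<in> borel_measurable borel"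
  shows "(\<integral>x. f (c + x) \<partial>lborel) = (\<integral>x. f x \<partial>lborel)"
  by (subst (2) lborel_distr_plus[of c, symmetric], subst integral_distr) auto

lemma lborel_integrable_translate:
  fixes f :: "'a::euclidean_space \<Rightarrow> real"
  assumes "integrable lborel f"
  shows "integrable lborel (\<lambda>x. f (c + x))"
proof -
  have [measurable]: "f \<in> borel_measurable borel" using assms by auto
  have "integrable (distr lborel borel ((+) c)) f" using assms by (simp add: lborel_distr_plus)
  then show ?thesis by (subst (asm) integrable_distr_eq) auto
qed

section \<open>Integration by parts for scalar functions with a continuous gradient\<close>

definition C1_grad :: "('a::euclidean_space \<Rightarrow> real) \<Rightarrow> ('a \<Rightarrow> 'a) \<Rightarrow> bool" where
  "C1_grad f F \<longleftrightarrow> (\<forall>x. (f has_derivative (\<lambda>h. F x \<bullet> h)) (at x)) \<and> continuous_on UNIV F"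

definition Cc1_grad :: "('a::euclidean_space \<Rightarrow> real) \<Rightarrow> ('a \<Rightarrow> 'a) \<Rightarrow> bool" where
  "Cc1_grad f F \<longleftrightarrow> C1_grad f F \<and> (\<exists>B. \<forall>x. norm x > B \<longrightarrow> f x = 0 \<and> F x = 0)"

lemma C1_grad_continuous: "C1_grad f F \<Longrightarrow> continuous_on UNIV f"
  unfolding C1_grad_def by (metis continuous_at_imp_continuous_on has_derivative_continuous)

lemma Cc1_grad_mult:
  assumes g: "C1_grad g G" and f: "Cc1_grad f F"
  shows "Cc1_grad (\<lambda>x. g x * f x) (\<lambda>x. g x *\<^sub>R F x + f x *\<^sub>R G x)"
proof -
  from f have f': "C1_grad f F" by (simp add: Cc1_grad_def)
  have "((\<lambda>x. g x * f x) has_derivative (\<lambda>h. (g x *\<^sub>R F x + f x *\<^sub>R G x) \<bullet> h)) (at x)" for x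
    using g f' unfolding C1_grad_def
    by (auto intro!: derivative_eq_intros simp: inner_add_left algebra_simps)
  moreover have "continuous_on UNIV (\<lambda>x. g x *\<^sub>R F x + f x *\<^sub>R G x)"
    using C1_grad_continuous[OF g] C1_grad_continuous[OF f'] g f' unfolding C1_grad_def
    by (auto intro!: continuous_intros)
  moreover have "\<exists>B. \<forall>x. norm x > B \<longrightarrow> g x * f x = 0 \<and> g x *\<^sub>R F x + f x *\<^sub>R G x = 0"
    using f unfolding Cc1_grad_def by fastforce
  ultimately show ?thesis unfolding Cc1_grad_def C1_grad_def by blast
qed

lemma Cc1_grad_integrable:
  assumes "Cc1_grad f F"
  shows "integrable lborel f" "integrable lborel F" "integrable lborel (\<lambda>x. F x \<bullet> b)"
proof -
  from assms obtain B where B: "\<And>x. norm x > B \<Longrightarrow> f x = 0 \<and> F x = 0" by (auto simp: Cc1_grad_def)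
  have c: "continuous_on UNIV f" "continuous_on UNIV F"
    using assms C1_grad_continuous[of f F] by (auto simp: Cc1_grad_def C1_grad_def)
  show "integrable lborel f" using c B by (intro integrable_continuous_bounded_support[of _ B]) auto
  show F: "integrable lborel F" using c B by (intro integrable_continuous_bounded_support[of _ B]) auto
  then show "integrable lborel (\<lambda>x. F x \<bullet> b)" by simp
qed

lemma Cc1_grad_bounded:
  assumes "Cc1_grad f F"
  obtains K where "K \<ge> 0" "\<And>x. \<bar>f x\<bar> \<le> K" "\<And>x. \<bar>F x \<bullet> b\<bar> \<le> K"
proof -
  from assms obtain B where B: "\<And>x. norm x > B \<Longrightarrow> f x = 0 \<and> F x = 0" by (auto simp: Cc1_grad_def)
  have c: "continuous_on UNIV f" "continuous_on UNIV (\<lambda>x. F x \<bullet> b)"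
    using assms C1_grad_continuous[of f F] by (auto simp: Cc1_grad_def C1_grad_def intro!: continuous_intros)
  obtain K1 where K1: "K1 \<ge> 0" "\<And>x. norm (f x) \<le> K1"
    using bounded_continuous_bounded_support[OF c(1), of B] B by auto
  obtain K2 where K2: "K2 \<ge> 0" "\<And>x. norm (F x \<bullet> b) \<le> K2"
    using bounded_continuous_bounded_support[OF c(2), of B] B by auto
  show ?thesis
  proof (rule that[of "max K1 K2"])
    show "max K1 K2 \<ge> 0" using K1(1) by auto
    show "\<bar>f x\<bar> \<le> max K1 K2" for x using K1(2)[of x] by simp
    show "\<bar>F x \<bullet> b\<bar> \<le> max K1 K2" for x using K2(2)[of x] by simp
  qed
qed

text \<open>By translation invariance of Lebesgue measure every difference quotient of
  \<open>f\<close> has integral zero, and these integrals converge to the integral of the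
  directional derivative. No iterated integration is involved.\<close>

lemma Cc1_grad_integral_zero:
  assumes f: "Cc1_grad f F"
  shows "(\<integral>x. F x \<bullet> b \<partial>lborel) = 0"
proof -
  obtain B where B: "\<And>x. norm x > B \<Longrightarrow> f x = 0 \<and> F x = 0" using f by (auto simp: Cc1_grad_def)
  obtain K where K: "\<And>x. \<bar>F x \<bullet> b\<bar> \<le> K" using Cc1_grad_bounded[OF f] by metis
  have D: "(f has_derivative (\<lambda>h. F x \<bullet> h)) (at x)" for x using f by (auto simp: Cc1_grad_def C1_grad_def)
  \<comment> \<open>The steps are at most \<open>b\<close> in length, so the support moves by at
    most \<open>norm b\<close>. The indicator is 1 wherever a quotient is nonzero and only provides
    an integrable weight.\<close>
  define w :: "'a \<Rightarrow> real" where "w = indicator (cball 0 (B + norm b))"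
  have w: "integrable lborel w" unfolding w_def
    using emeasure_lborel_cball_finite by (intro integrable_real_indicator) auto
  have 1: "w x * ((f (x + (1 / real (Suc n)) *\<^sub>R b) - f x) * real (Suc n))
      = (f ((1 / real (Suc n)) *\<^sub>R b + x) - f x) * real (Suc n)" for x n
  proof (cases "norm x > B + norm b")
    case True
    have "norm ((1 / real (Suc n)) *\<^sub>R b) \<le> 1 * norm b"
      unfolding norm_scaleR by (intro mult_right_mono) auto
    then have "norm (x + (1 / real (Suc n)) *\<^sub>R b) > B"
      using True norm_triangle_ineq2[of x "- (1 / real (Suc n)) *\<^sub>R b"] by simp
    moreover have "norm x > B" using True norm_ge_zero[of b] by linarith
    ultimately show ?thesis using B by (simp add: add.commute)
  qed (auto simp: w_def indicator_def add.commute)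
  have 2: "w x * (F x \<bullet> b) = F x \<bullet> b" for x
  proof (cases "norm x > B + norm b")
    case True
    then have "norm x > B" using norm_ge_zero[of b] by linarith
    then show ?thesis using B by simp
  qed (auto simp: w_def indicator_def)
  have "(\<lambda>n. \<integral>x. (f ((1 / real (Suc n)) *\<^sub>R b + x) - f x) * real (Suc n) \<partial>lborel) \<longlonglongrightarrow> (\<integral>x. F x \<bullet> b \<partial>lborel)"
    using integral_difference_quotient_tendsto[OF D K w] by (simp only: 1 2)
  moreover have "(\<integral>x. (f ((1 / real (Suc n)) *\<^sub>R b + x) - f x) * real (Suc n) \<partial>lborel) = 0" for n
    using Cc1_grad_integrable(1)[OF f]
    by (simp add: lborel_integrable_translate lborel_integral_translate)
  ultimately show ?thesis by (simp add: LIMSEQ_const_iff)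
qed

lemma Cc1_grad_parts:
  assumes f: "Cc1_grad f F" and g: "C1_grad g G"
  shows "(\<integral>x. (F x \<bullet> b) * g x \<partial>lborel) = - (\<integral>x. f x * (G x \<bullet> b) \<partial>lborel)"
    and "integrable lborel (\<lambda>x. (F x \<bullet> b) * g x)" "integrable lborel (\<lambda>x. f x * (G x \<bullet> b))"
proof -
  note P = Cc1_grad_mult[OF g f]
  obtain B where B: "\<And>x. norm x > B \<Longrightarrow> f x = 0 \<and> F x = 0" using f by (auto simp: Cc1_grad_def)
  have c: "continuous_on UNIV f" "continuous_on UNIV F" "continuous_on UNIV g" "continuous_on UNIV G"
    using f g C1_grad_continuous[of f F] C1_grad_continuous[of g G] by (auto simp: Cc1_grad_def C1_grad_def)
  show i: "integrable lborel (\<lambda>x. (F x \<bullet> b) * g x)" "integrable lborel (\<lambda>x. f x * (G x \<bullet> b))"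
    using B c by (intro integrable_continuous_bounded_support[of _ B]; auto intro!: continuous_intros)+
  have "(\<integral>x. (F x \<bullet> b) * g x + f x * (G x \<bullet> b) \<partial>lborel) = 0"
    using Cc1_grad_integral_zero[OF P, of b] by (simp add: inner_add_left mult.commute)
  then show "(\<integral>x. (F x \<bullet> b) * g x \<partial>lborel) = - (\<integral>x. f x * (G x \<bullet> b) \<partial>lborel)"
    using i by simp
qed

text \<open>Difference quotients in direction \<open>c\<close> replace the symmetry of second derivatives,
  so \<open>C\<^sup>1\<close> regularity suffices.\<close>

lemma Cc1_grad_swap:
  assumes f: "Cc1_grad f F" and g: "Cc1_grad g G"
  shows "(\<integral>x. (F x \<bullet> b) * (G x \<bullet> c) \<partial>lborel) = (\<integral>x. (F x \<bullet> c) * (G x \<bullet> b) \<partial>lborel)"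
proof -
  have Df: "(f has_derivative (\<lambda>h. F x \<bullet> h)) (at x)" for x using f by (auto simp: Cc1_grad_def C1_grad_def)
  have Dg: "(g has_derivative (\<lambda>h. G x \<bullet> h)) (at x)" for x using g by (auto simp: Cc1_grad_def C1_grad_def)
  obtain Kf where Kf: "\<And>x. \<bar>F x \<bullet> c\<bar> \<le> Kf" using Cc1_grad_bounded[OF f] by metis
  have Kf': "\<bar>F x \<bullet> - c\<bar> \<le> Kf" for x using Kf[of x] by simp
  obtain Kg where Kg: "\<And>x. \<bar>G x \<bullet> c\<bar> \<le> Kg" using Cc1_grad_bounded[OF g] by metis
  have g1: "C1_grad g G" using g by (simp add: Cc1_grad_def)
  let ?h = "\<lambda>n. (1 / real (Suc n)) *\<^sub>R c"
  have 1: "(\<lambda>n. \<integral>x. (F x \<bullet> b) * ((g (x + ?h n) - g x) * real (Suc n)) \<partial>lborel) \<longlonglongrightarrow> (\<integral>x. (F x \<bullet> b) * (G x \<bullet> c) \<partial>lborel)"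
    by (rule integral_difference_quotient_tendsto[OF Dg Kg Cc1_grad_integrable(3)[OF f]])
  have 2: "(\<lambda>n. \<integral>x. (G x \<bullet> b) * ((f (x + (1 / real (Suc n)) *\<^sub>R (- c)) - f x) * real (Suc n)) \<partial>lborel) \<longlonglongrightarrow> (\<integral>x. (G x \<bullet> b) * (F x \<bullet> - c) \<partial>lborel)"
    by (rule integral_difference_quotient_tendsto[OF Df Kf' Cc1_grad_integrable(3)[OF g]])
  \<comment> \<open>Discrete integration by parts: the derivative in direction \<open>b\<close>
    moves from \<open>f\<close> to \<open>g\<close>, and a translation then moves the shift by
    \<open>?h n\<close> from \<open>g\<close> to \<open>f\<close>, where its direction is reversed.
    The two signs cancel in the limit.\<close>
  have 3: "(\<integral>x. (F x \<bullet> b) * ((g (x + ?h n) - g x) * real (Suc n)) \<partial>lborel)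
     = - (\<integral>x. (G x \<bullet> b) * ((f (x + (1 / real (Suc n)) *\<^sub>R (- c)) - f x) * real (Suc n)) \<partial>lborel)" for n
  proof -
    have gs: "C1_grad (\<lambda>x. g (x + ?h n)) (\<lambda>x. G (x + ?h n))"
      unfolding C1_grad_def
    proof (intro conjI allI)
      fix x
      have "((\<lambda>x. x + ?h n) has_derivative (\<lambda>h. h)) (at x)"
        by (auto intro!: derivative_eq_intros)
      from has_derivative_compose[OF this Dg]
      show "((\<lambda>x. g (x + ?h n)) has_derivative (\<lambda>h. G (x + ?h n) \<bullet> h)) (at x)" .
      have "continuous_on UNIV G" using g1 by (simp add: C1_grad_def)
      then show "continuous_on UNIV (\<lambda>x. G (x + ?h n))"
        by (rule continuous_on_compose2) (simp_all add: continuous_on_add)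
    qed
    have c: "continuous_on UNIV f" "continuous_on UNIV G"
      using f g C1_grad_continuous[of f F] by (auto simp: Cc1_grad_def C1_grad_def)
    have cm: "(\<lambda>x. f (x - ?h n) * (G x \<bullet> b)) \<in> borel_measurable borel"
    proof (intro borel_measurable_continuous_onI continuous_on_mult continuous_on_inner continuous_on_const c(2))
      show "continuous_on UNIV (\<lambda>x. f (x - ?h n))"
        by (rule continuous_on_compose2[OF c(1)]) (simp_all add: continuous_on_diff)
    qed
    have fG: "(\<integral>x. f x * (G (x + ?h n) \<bullet> b) \<partial>lborel) = (\<integral>x. f (x - ?h n) * (G x \<bullet> b) \<partial>lborel)"
      using lborel_integral_translate[OF cm, of "?h n"] by (simp add: add.commute)
    have ifG: "integrable lborel (\<lambda>x. f (x - ?h n) * (G x \<bullet> b))"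
      using lborel_integrable_translate[OF Cc1_grad_parts(3)[OF f gs, of b], of "- ?h n"] by simp
    have "(\<integral>x. (F x \<bullet> b) * ((g (x + ?h n) - g x) * real (Suc n)) \<partial>lborel)
       = real (Suc n) * ((\<integral>x. (F x \<bullet> b) * g (x + ?h n) \<partial>lborel) - (\<integral>x. (F x \<bullet> b) * g x \<partial>lborel))"
      using Cc1_grad_parts(2)[OF f gs, of b] Cc1_grad_parts(2)[OF f g1, of b]
      by (subst Bochner_Integration.integral_diff[symmetric], simp, simp, subst integral_mult_right_zero[symmetric])
         (rule Bochner_Integration.integral_cong; simp add: algebra_simps)
    also have "\<dots> = - real (Suc n) * ((\<integral>x. f (x - ?h n) * (G x \<bullet> b) \<partial>lborel) - (\<integral>x. f x * (G x \<bullet> b) \<partial>lborel))"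
      unfolding Cc1_grad_parts(1)[OF f gs] Cc1_grad_parts(1)[OF f g1] fG by (simp add: algebra_simps)
    also have "\<dots> = - (\<integral>x. (G x \<bullet> b) * ((f (x + (1 / real (Suc n)) *\<^sub>R (- c)) - f x) * real (Suc n)) \<partial>lborel)"
      using ifG Cc1_grad_parts(3)[OF f g1, of b]
      by (subst Bochner_Integration.integral_diff[symmetric], simp, simp, subst integral_mult_right_zero[symmetric],
          subst integral_minus[symmetric])
         (rule Bochner_Integration.integral_cong; simp add: algebra_simps)
    finally show ?thesis .
  qed
  have "(\<lambda>n. \<integral>x. (F x \<bullet> b) * ((g (x + ?h n) - g x) * real (Suc n)) \<partial>lborel) \<longlonglongrightarrow> - (\<integral>x. (G x \<bullet> b) * (F x \<bullet> - c) \<partial>lborel)"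
    unfolding 3 by (intro tendsto_minus 2)
  with 1 have "(\<integral>x. (F x \<bullet> b) * (G x \<bullet> c) \<partial>lborel) = - (\<integral>x. (G x \<bullet> b) * (F x \<bullet> - c) \<partial>lborel)"
    by (rule LIMSEQ_unique)
  then show ?thesis by (simp add: mult.commute)
qed

section \<open>Convergence in \<open>L\<^sup>2\<close>\<close>

definition square_integrable :: "('a::euclidean_space \<Rightarrow> 'b::euclidean_space) \<Rightarrow> bool" where
  "square_integrable f \<longleftrightarrow> f \<in> borel_measurable lborel \<and> integrable lborel (\<lambda>x. (norm (f x))\<^sup>2)"

lemma norm_add_squared_le:
  fixes p q :: "'a::real_inner"
  shows "(norm (p + q))\<^sup>2 \<le> 2 * (norm p)\<^sup>2 + 2 * (norm q)\<^sup>2"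
proof -
  have "0 \<le> (norm (p - q))\<^sup>2" by simp
  then show ?thesis by (simp add: power2_norm_eq_inner inner_add inner_diff inner_commute)
qed

text \<open>Young's inequality. The free parameter \<open>e\<close> stands in for the Cauchy-Schwarz
  inequality in L2, so that limits of inner products are handled with integrals of squares
  only.\<close>

lemma abs_inner_le_squares:
  fixes p q :: "'a::real_inner"
  assumes "e > 0"
  shows "\<bar>p \<bullet> q\<bar> \<le> (norm p)\<^sup>2 / (2 * e) + e * (norm q)\<^sup>2 / 2"
proof -
  have "0 \<le> (norm p - e * norm q)\<^sup>2" by simp
  then have "2 * e * (norm p * norm q) \<le> (norm p)\<^sup>2 + e\<^sup>2 * (norm q)\<^sup>2"
    by (simp add: power2_eq_square algebra_simps)
  then have "norm p * norm q \<le> (norm p)\<^sup>2 / (2 * e) + e * (norm q)\<^sup>2 / 2"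
    using assms by (simp add: field_simps power2_eq_square)
  with Cauchy_Schwarz_ineq2[of p q] show ?thesis by linarith
qed

lemma square_integrableD: "square_integrable f \<Longrightarrow> integrable lborel (\<lambda>x. (norm (f x))\<^sup>2)"
  by (simp add: square_integrable_def)

lemma square_integrable_inner:
  assumes f: "square_integrable f" and g: "square_integrable g"
  shows "integrable lborel (\<lambda>x. f x \<bullet> g x)"
proof (rule Bochner_Integration.integrable_bound)
  show "integrable lborel (\<lambda>x. (norm (f x))\<^sup>2 + (norm (g x))\<^sup>2)"
    using f g by (auto simp: square_integrable_def)
  show "(\<lambda>x. f x \<bullet> g x) \<in> borel_measurable lborel"
    using f g by (intro borel_measurable_inner) (auto simp: square_integrable_def)
  show "AE x in lborel. norm (f x \<bullet> g x) \<le> norm ((norm (f x))\<^sup>2 + (norm (g x))\<^sup>2)"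
  proof (rule AE_I2)
    fix x
    have "\<bar>f x \<bullet> g x\<bar> \<le> (norm (f x))\<^sup>2 / 2 + (norm (g x))\<^sup>2 / 2"
      using abs_inner_le_squares[of 1 "f x" "g x"] by simp
    moreover have "0 \<le> (norm (f x))\<^sup>2" "0 \<le> (norm (g x))\<^sup>2" by auto
    ultimately show "norm (f x \<bullet> g x) \<le> norm ((norm (f x))\<^sup>2 + (norm (g x))\<^sup>2)"
      unfolding real_norm_def by linarith
  qed
qed

lemma square_integrable_add:
  assumes f: "square_integrable f" and g: "square_integrable g"
  shows "square_integrable (\<lambda>x. f x + g x)"
  unfolding square_integrable_def
proof
  have [measurable]: "f \<in> borel_measurable lborel" "g \<in> borel_measurable lborel"
    using f g by (auto simp: square_integrable_def)
  show "(\<lambda>x. f x + g x) \<in> borel_measurable lborel" by measurable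
  show "integrable lborel (\<lambda>x. (norm (f x + g x))\<^sup>2)"
  proof (rule Bochner_Integration.integrable_bound)
    show "integrable lborel (\<lambda>x. 2 * (norm (f x))\<^sup>2 + 2 * (norm (g x))\<^sup>2)"
      using f g by (auto simp: square_integrable_def)
    show "(\<lambda>x. (norm (f x + g x))\<^sup>2) \<in> borel_measurable lborel" by measurable
    show "AE x in lborel. norm ((norm (f x + g x))\<^sup>2) \<le> norm (2 * (norm (f x))\<^sup>2 + 2 * (norm (g x))\<^sup>2)"
      using norm_add_squared_le by (intro AE_I2) fastforce
  qed
qed

lemma square_integrable_bounded_linear:
  assumes f: "square_integrable f" and T: "bounded_linear T"
  shows "square_integrable (\<lambda>x. T (f x))"
  unfolding square_integrable_def
proof
  have [measurable]: "f \<in> borel_measurable lborel" using f by (auto simp: square_integrable_def)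
  have [measurable]: "T \<in> borel_measurable borel"
    using T by (intro borel_measurable_continuous_onI linear_continuous_on)
  show "(\<lambda>x. T (f x)) \<in> borel_measurable lborel" by measurable
  obtain K where K: "\<And>x. norm (T x) \<le> norm x * K" using bounded_linear.bounded[OF T] by auto
  show "integrable lborel (\<lambda>x. (norm (T (f x)))\<^sup>2)"
  proof (rule Bochner_Integration.integrable_bound)
    show "integrable lborel (\<lambda>x. (norm (f x))\<^sup>2 * K\<^sup>2)"
      using f by (auto simp: square_integrable_def)
    show "(\<lambda>x. (norm (T (f x)))\<^sup>2) \<in> borel_measurable lborel" by measurable
    show "AE x in lborel. norm ((norm (T (f x)))\<^sup>2) \<le> norm ((norm (f x))\<^sup>2 * K\<^sup>2)"
      using power_mono[OF K norm_ge_zero, where n=2] by (intro AE_I2) (simp add: power_mult_distrib)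
  qed
qed

lemma square_integrable_scaleR: "square_integrable f \<Longrightarrow> square_integrable (\<lambda>x. c *\<^sub>R f x)"
  by (rule square_integrable_bounded_linear[OF _ bounded_linear_scaleR_right])

lemma square_integrable_diff:
  "square_integrable f \<Longrightarrow> square_integrable g \<Longrightarrow> square_integrable (\<lambda>x. f x - g x)"
  using square_integrable_add[OF _ square_integrable_scaleR[of g "-1"], of f] by simp

lemma square_integrable_continuous:
  assumes "continuous_on UNIV f" "\<And>x. norm x > B \<Longrightarrow> f x = 0"
  shows "square_integrable f"
  unfolding square_integrable_def
proof
  show "f \<in> borel_measurable lborel" using assms(1) borel_measurable_continuous_onI by simp
  show "integrable lborel (\<lambda>x. (norm (f x))\<^sup>2)"
    using assms by (intro integrable_continuous_bounded_support[of _ B]) (auto intro!: continuous_intros)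
qed

definition L2_tendsto :: "(nat \<Rightarrow> 'a::euclidean_space \<Rightarrow> 'b::euclidean_space) \<Rightarrow> ('a \<Rightarrow> 'b) \<Rightarrow> bool" where
  "L2_tendsto f g \<longleftrightarrow> (\<forall>k. square_integrable (f k)) \<and> square_integrable g \<and>
     (\<lambda>k. \<integral>x. (norm (f k x - g x))\<^sup>2 \<partial>lborel) \<longlonglongrightarrow> 0"

text \<open>The limit is only assumed measurable: a single index at finite distance from
  \<open>g\<close> already makes \<open>g\<close> square integrable, being the difference of
  \<open>f k\<close> and \<open>f k - g\<close>. After that the extended integrals are ordinary
  ones.\<close>

lemma L2_tendsto_nn_integralI:
  assumes f: "\<And>k. square_integrable (f k)" and g: "g \<in> borel_measurable lborel"
    and lim: "(\<lambda>k. \<integral>\<^sup>+ x. ennreal ((norm (f k x - g x))\<^sup>2) \<partial>lborel) \<longlonglongrightarrow> 0"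
  shows "L2_tendsto f g"
proof -
  have mf: "f k \<in> borel_measurable lborel" for k using f by (simp add: square_integrable_def)
  note [measurable] = g mf
  have "eventually (\<lambda>k. (\<integral>\<^sup>+ x. ennreal ((norm (f k x - g x))\<^sup>2) \<partial>lborel) < 1) sequentially"
    using lim by (rule order_tendstoD) simp
  then obtain k where k: "(\<integral>\<^sup>+ x. ennreal ((norm (f k x - g x))\<^sup>2) \<partial>lborel) < 1"
    by (auto simp: eventually_sequentially)
  have "square_integrable (\<lambda>x. f k x - g x)"
    unfolding square_integrable_def
  proof
    show "integrable lborel (\<lambda>x. (norm (f k x - g x))\<^sup>2)"
      using k by (intro integrableI_bounded) (auto intro: order.strict_trans)
  qed measurable
  from square_integrable_diff[OF f[of k] this] have g': "square_integrable g" by simp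
  have "(\<integral>\<^sup>+ x. ennreal ((norm (f k x - g x))\<^sup>2) \<partial>lborel) = ennreal (\<integral>x. (norm (f k x - g x))\<^sup>2 \<partial>lborel)" for k
    using square_integrableD[OF square_integrable_diff[OF f g']] by (intro nn_integral_eq_integral) auto
  with lim have "(\<lambda>k. ennreal (\<integral>x. (norm (f k x - g x))\<^sup>2 \<partial>lborel)) \<longlonglongrightarrow> ennreal 0" by simp
  then have "(\<lambda>k. \<integral>x. (norm (f k x - g x))\<^sup>2 \<partial>lborel) \<longlonglongrightarrow> 0"
    by (subst (asm) tendsto_ennreal_iff) auto
  with f g' show ?thesis by (simp add: L2_tendsto_def)
qed

lemma L2_tendsto_bounded_linear:
  assumes f: "L2_tendsto f g" and T: "bounded_linear T"
  shows "L2_tendsto (\<lambda>k x. T (f k x)) (\<lambda>x. T (g x))"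
proof -
  interpret T: bounded_linear T by fact
  obtain K where K: "\<And>x. norm (T x) \<le> norm x * K" using T.bounded by auto
  have sf: "square_integrable (f k)" and sg: "square_integrable g" for k
    using f by (auto simp: L2_tendsto_def)
  have "(\<lambda>k. \<integral>x. (norm (T (f k x) - T (g x)))\<^sup>2 \<partial>lborel) \<longlonglongrightarrow> 0"
  proof (rule tendsto_sandwich)
    show "eventually (\<lambda>k. 0 \<le> (\<integral>x. (norm (T (f k x) - T (g x)))\<^sup>2 \<partial>lborel)) sequentially" by simp
    show "eventually (\<lambda>k. (\<integral>x. (norm (T (f k x) - T (g x)))\<^sup>2 \<partial>lborel) \<le> (\<integral>x. (norm (f k x - g x))\<^sup>2 \<partial>lborel) * K\<^sup>2) sequentially"
    proof (intro always_eventually allI)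
      fix k
      have d: "square_integrable (\<lambda>x. f k x - g x)" by (intro square_integrable_diff sf sg)
      have "(\<integral>x. (norm (T (f k x) - T (g x)))\<^sup>2 \<partial>lborel) \<le> (\<integral>x. (norm (f k x - g x))\<^sup>2 * K\<^sup>2 \<partial>lborel)"
      proof (rule integral_mono)
        show "integrable lborel (\<lambda>x. (norm (T (f k x) - T (g x)))\<^sup>2)"
          using square_integrableD[OF square_integrable_bounded_linear[OF d T]] by (simp add: T.diff)
        show "integrable lborel (\<lambda>x. (norm (f k x - g x))\<^sup>2 * K\<^sup>2)" using square_integrableD[OF d] by simp
        show "(norm (T (f k x) - T (g x)))\<^sup>2 \<le> (norm (f k x - g x))\<^sup>2 * K\<^sup>2" for x
          using power_mono[OF K[of "f k x - g x"] norm_ge_zero, where n=2] by (simp add: power_mult_distrib T.diff)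
      qed
      then show "(\<integral>x. (norm (T (f k x) - T (g x)))\<^sup>2 \<partial>lborel) \<le> (\<integral>x. (norm (f k x - g x))\<^sup>2 \<partial>lborel) * K\<^sup>2" by simp
    qed
    show "(\<lambda>k. (\<integral>x. (norm (f k x - g x))\<^sup>2 \<partial>lborel) * K\<^sup>2) \<longlonglongrightarrow> 0"
      using f by (auto simp: L2_tendsto_def intro!: tendsto_mult_left_zero)
  qed auto
  then show ?thesis
    using sf sg T by (auto simp: L2_tendsto_def intro: square_integrable_bounded_linear)
qed

lemma L2_tendsto_add:
  assumes f: "L2_tendsto f f'" and g: "L2_tendsto g g'"
  shows "L2_tendsto (\<lambda>k x. f k x + g k x) (\<lambda>x. f' x + g' x)"
proof -
  have s: "square_integrable (f k)" "square_integrable f'" "square_integrable (g k)" "square_integrable g'" for k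
    using f g by (auto simp: L2_tendsto_def)
  have "(\<lambda>k. \<integral>x. (norm (f k x + g k x - (f' x + g' x)))\<^sup>2 \<partial>lborel) \<longlonglongrightarrow> 0"
  proof (rule tendsto_sandwich)
    show "eventually (\<lambda>k. 0 \<le> (\<integral>x. (norm (f k x + g k x - (f' x + g' x)))\<^sup>2 \<partial>lborel)) sequentially" by simp
    show "eventually (\<lambda>k. (\<integral>x. (norm (f k x + g k x - (f' x + g' x)))\<^sup>2 \<partial>lborel)
       \<le> 2 * (\<integral>x. (norm (f k x - f' x))\<^sup>2 \<partial>lborel) + 2 * (\<integral>x. (norm (g k x - g' x))\<^sup>2 \<partial>lborel)) sequentially"
    proof (intro always_eventually allI)
      fix k
      have i: "integrable lborel (\<lambda>x. (norm (f k x - f' x))\<^sup>2)" "integrable lborel (\<lambda>x. (norm (g k x - g' x))\<^sup>2)"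
        by (intro square_integrableD square_integrable_diff s)+
      have "(\<integral>x. (norm (f k x + g k x - (f' x + g' x)))\<^sup>2 \<partial>lborel) \<le> (\<integral>x. 2 * (norm (f k x - f' x))\<^sup>2 + 2 * (norm (g k x - g' x))\<^sup>2 \<partial>lborel)"
      proof (rule integral_mono)
        show "integrable lborel (\<lambda>x. (norm (f k x + g k x - (f' x + g' x)))\<^sup>2)"
          by (intro square_integrableD square_integrable_diff square_integrable_add s)
        show "integrable lborel (\<lambda>x. 2 * (norm (f k x - f' x))\<^sup>2 + 2 * (norm (g k x - g' x))\<^sup>2)" using i by simp
        show "(norm (f k x + g k x - (f' x + g' x)))\<^sup>2 \<le> 2 * (norm (f k x - f' x))\<^sup>2 + 2 * (norm (g k x - g' x))\<^sup>2" for x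
          using norm_add_squared_le[of "f k x - f' x" "g k x - g' x"] by (simp add: algebra_simps)
      qed
      then show "(\<integral>x. (norm (f k x + g k x - (f' x + g' x)))\<^sup>2 \<partial>lborel)
       \<le> 2 * (\<integral>x. (norm (f k x - f' x))\<^sup>2 \<partial>lborel) + 2 * (\<integral>x. (norm (g k x - g' x))\<^sup>2 \<partial>lborel)" using i by simp
    qed
    show "(\<lambda>k. 2 * (\<integral>x. (norm (f k x - f' x))\<^sup>2 \<partial>lborel) + 2 * (\<integral>x. (norm (g k x - g' x))\<^sup>2 \<partial>lborel)) \<longlonglongrightarrow> 0"
      using f g by (auto simp: L2_tendsto_def intro!: tendsto_add_zero tendsto_mult_right_zero)
  qed auto
  then show ?thesis
    using s by (auto simp: L2_tendsto_def intro: square_integrable_add)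
qed

text \<open>The difference of the inner products splits into a term with two errors and two terms
  with one error each. Young's inequality is applied with weight 1 to the former and with a small
  weight \<open>r\<close> on the limit functions in the latter; for fixed \<open>r\<close>
  everything except the multiple of \<open>r\<close> tends to zero.\<close>

lemma L2_tendsto_inner:
  assumes f: "L2_tendsto f f'" and g: "L2_tendsto g g'"
  shows "(\<lambda>k. \<integral>x. f k x \<bullet> g k x \<partial>lborel) \<longlonglongrightarrow> (\<integral>x. f' x \<bullet> g' x \<partial>lborel)"
proof -
  have s: "square_integrable (f k)" "square_integrable f'" "square_integrable (g k)" "square_integrable g'" for k
    using f g by (auto simp: L2_tendsto_def)
  define d where "d = (\<lambda>k. \<integral>x. (norm (f k x - f' x))\<^sup>2 \<partial>lborel)"
  define e where "e = (\<lambda>k. \<integral>x. (norm (g k x - g' x))\<^sup>2 \<partial>lborel)"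
  define A where "A = (\<integral>x. (norm (f' x))\<^sup>2 \<partial>lborel)"
  define B where "B = (\<integral>x. (norm (g' x))\<^sup>2 \<partial>lborel)"
  have de: "d \<longlonglongrightarrow> 0" "e \<longlonglongrightarrow> 0" using f g by (auto simp: L2_tendsto_def d_def e_def)
  have AB: "A \<ge> 0" "B \<ge> 0" by (auto simp: A_def B_def)
  have bnd: "\<bar>(\<integral>x. f k x \<bullet> g k x \<partial>lborel) - (\<integral>x. f' x \<bullet> g' x \<partial>lborel)\<bar>
      \<le> (1 / 2 + 1 / (2 * r)) * (d k + e k) + r / 2 * (A + B)" if r: "r > 0" for r k
  proof -
    have i: "integrable lborel (\<lambda>x. (norm (f k x - f' x))\<^sup>2)" "integrable lborel (\<lambda>x. (norm (g k x - g' x))\<^sup>2)"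
        "integrable lborel (\<lambda>x. (norm (f' x))\<^sup>2)" "integrable lborel (\<lambda>x. (norm (g' x))\<^sup>2)"
      by (intro square_integrableD square_integrable_diff s)+
    have "\<bar>(\<integral>x. f k x \<bullet> g k x \<partial>lborel) - (\<integral>x. f' x \<bullet> g' x \<partial>lborel)\<bar> = \<bar>\<integral>x. f k x \<bullet> g k x - f' x \<bullet> g' x \<partial>lborel\<bar>"
      by (simp add: square_integrable_inner s)
    also have "\<dots> \<le> (\<integral>x. (1 / 2 + 1 / (2 * r)) * ((norm (f k x - f' x))\<^sup>2 + (norm (g k x - g' x))\<^sup>2) + r / 2 * ((norm (f' x))\<^sup>2 + (norm (g' x))\<^sup>2) \<partial>lborel)"
    proof (rule order_trans[OF integral_abs_bound integral_mono])
      show "integrable lborel (\<lambda>x. \<bar>f k x \<bullet> g k x - f' x \<bullet> g' x\<bar>)" by (simp add: square_integrable_inner s)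
      show "integrable lborel (\<lambda>x. (1 / 2 + 1 / (2 * r)) * ((norm (f k x - f' x))\<^sup>2 + (norm (g k x - g' x))\<^sup>2) + r / 2 * ((norm (f' x))\<^sup>2 + (norm (g' x))\<^sup>2))"
        using i by simp
      fix x
      have "f k x \<bullet> g k x - f' x \<bullet> g' x = (f k x - f' x) \<bullet> (g k x - g' x) + (f k x - f' x) \<bullet> g' x + (g k x - g' x) \<bullet> f' x"
        by (simp add: inner_diff_left inner_diff_right inner_commute)
      moreover have "\<bar>(f k x - f' x) \<bullet> (g k x - g' x)\<bar> \<le> (norm (f k x - f' x))\<^sup>2 / 2 + (norm (g k x - g' x))\<^sup>2 / 2"
        using abs_inner_le_squares[of 1 "f k x - f' x" "g k x - g' x"] by simp
      moreover have "\<bar>(f k x - f' x) \<bullet> g' x\<bar> \<le> (norm (f k x - f' x))\<^sup>2 / (2 * r) + r * (norm (g' x))\<^sup>2 / 2"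
        by (rule abs_inner_le_squares[OF r])
      moreover have "\<bar>(g k x - g' x) \<bullet> f' x\<bar> \<le> (norm (g k x - g' x))\<^sup>2 / (2 * r) + r * (norm (f' x))\<^sup>2 / 2"
        by (rule abs_inner_le_squares[OF r])
      ultimately have "\<bar>f k x \<bullet> g k x - f' x \<bullet> g' x\<bar> \<le> (norm (f k x - f' x))\<^sup>2 / 2 + (norm (g k x - g' x))\<^sup>2 / 2
          + ((norm (f k x - f' x))\<^sup>2 / (2 * r) + r * (norm (g' x))\<^sup>2 / 2) + ((norm (g k x - g' x))\<^sup>2 / (2 * r) + r * (norm (f' x))\<^sup>2 / 2)"
        by linarith
      then show "\<bar>f k x \<bullet> g k x - f' x \<bullet> g' x\<bar> \<le> (1 / 2 + 1 / (2 * r)) * ((norm (f k x - f' x))\<^sup>2 + (norm (g k x - g' x))\<^sup>2) + r / 2 * ((norm (f' x))\<^sup>2 + (norm (g' x))\<^sup>2)"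
        by (simp add: algebra_simps add_divide_distrib)
    qed
    also have "\<dots> = (1 / 2 + 1 / (2 * r)) * (d k + e k) + r / 2 * (A + B)"
      using i by (simp add: d_def e_def A_def B_def)
    finally show ?thesis .
  qed
  show ?thesis
  proof (rule LIMSEQ_I)
    fix r :: real assume r: "r > 0"
    \<comment> \<open>Makes the part that does not depend on the index at most \<open>r / 2\<close>;
      the added 1 keeps the denominator positive when both limits vanish.\<close>
    define t where "t = r / (A + B + 1)"
    have t: "t > 0" "t / 2 * (A + B) \<le> r / 2" using r AB by (auto simp: t_def field_simps)
    have "(\<lambda>k. (1 / 2 + 1 / (2 * t)) * (d k + e k)) \<longlonglongrightarrow> 0"
      using de by (intro tendsto_mult_right_zero tendsto_add_zero)
    then have "eventually (\<lambda>k. (1 / 2 + 1 / (2 * t)) * (d k + e k) < r / 2) sequentially"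
      using r by (intro order_tendstoD) auto
    then obtain k0 where k0: "\<And>k. k \<ge> k0 \<Longrightarrow> (1 / 2 + 1 / (2 * t)) * (d k + e k) < r / 2"
      by (auto simp: eventually_sequentially)
    show "\<exists>no. \<forall>n\<ge>no. norm ((\<integral>x. f n x \<bullet> g n x \<partial>lborel) - (\<integral>x. f' x \<bullet> g' x \<partial>lborel)) < r"
    proof (intro exI[of _ k0] allI impI)
      fix n assume "n \<ge> k0"
      then show "norm ((\<integral>x. f n x \<bullet> g n x \<partial>lborel) - (\<integral>x. f' x \<bullet> g' x \<partial>lborel)) < r"
        using bnd[OF t(1), of n] t(2) k0[of n] unfolding real_norm_def by linarith
    qed
  qed
qed

section \<open>Integral identities and the inequality\<close>

definition outer :: "real^'n \<Rightarrow> real^'n \<Rightarrow> real^'n^'n" where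
  "outer p q = (\<chi> j k. p $ j * q $ k)"

lemma outer_nth [simp]: "outer p q $ j $ k = p $ j * q $ k"
  by (simp add: outer_def)

lemma inner_outer_outer: "outer p q \<bullet> outer r s = (p \<bullet> r) * (q \<bullet> s)"
  by (simp add: inner_vec_def sum_product ac_simps)

lemma norm_outer: "norm (outer p q) = norm p * norm q"
  by (simp add: norm_eq_sqrt_inner inner_outer_outer real_sqrt_mult)

lemma outer_diff_left: "outer (p - q) r = outer p r - outer q r"
  by (simp add: vec_eq_iff algebra_simps)

text \<open>In a Jacobian the row is the component and the column is the direction, so pairing it
  with \<open>outer p q\<close> extracts the derivative in direction \<open>q\<close> of the
  component along \<open>p\<close>.\<close>

lemma inner_outer: "M \<bullet> outer p q = p \<bullet> (M *v q)"
  by (simp add: inner_vec_def matrix_vector_mult_def sum_distrib_left ac_simps)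

lemma transpose_outer: "transpose (outer p q) = outer q p"
  by (simp add: transpose_def vec_eq_iff mult.commute)

lemma transpose_nth [simp]: "transpose M $ i $ j = M $ j $ i"
  by (simp add: transpose_def)

lemma inner_transpose_transpose: "transpose A \<bullet> transpose B = A \<bullet> (B :: real^'n^'n)"
  by (simp add: inner_vec_def) (rule sum.swap)

lemma bounded_linear_transpose: "bounded_linear (transpose :: real^'n^'m \<Rightarrow> real^'m^'n)"
  unfolding linear_conv_bounded_linear[symmetric]
  by (rule linearI) (simp_all add: vec_eq_iff)

lemma bounded_linear_trace: "bounded_linear (\<lambda>M :: real^'n^'n. \<Sum>j\<in>UNIV. M $ j $ j)"
  unfolding linear_conv_bounded_linear[symmetric]
  by (rule linearI) (simp_all add: sum.distrib sum_distrib_left)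

lemma continuous_on_outer:
  "continuous_on UNIV f \<Longrightarrow> continuous_on UNIV g \<Longrightarrow> continuous_on UNIV (\<lambda>x. outer (f x) (g x))"
  unfolding outer_def by (intro continuous_on_vec_lambda continuous_intros)

lemma borel_measurable_outer [measurable]:
  assumes "f \<in> borel_measurable M" "g \<in> borel_measurable M"
  shows "(\<lambda>x. outer (f x) (g x)) \<in> borel_measurable M"
proof -
  have "continuous_on UNIV (\<lambda>z :: (real^'n) \<times> (real^'n). outer (fst z) (snd z))"
    unfolding outer_def by (intro continuous_on_vec_lambda continuous_intros)
  then have "(\<lambda>z :: (real^'n) \<times> (real^'n). outer (fst z) (snd z)) \<in> borel_measurable borel"
    by (rule borel_measurable_continuous_onI)
  from measurable_compose[OF borel_measurable_Pair[OF assms] this] show ?thesis by simp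
qed

section \<open>Integral identities for test fields\<close>

lemma Cc_inf_field_has_derivative:
  assumes "Cc_inf_field \<phi>"
  shows "(\<phi> has_derivative (\<lambda>h. jac \<phi> x *v h)) (at x)"
proof -
  have "Ck_field (Suc 0) \<phi>" using assms by (auto simp: Cc_inf_field_def smooth_field_def)
  then have D: "(\<phi> has_derivative frechet_derivative \<phi> (at x)) (at x)"
    by (simp add: differentiable_on_def frechet_derivative_works)
  then have "linear (frechet_derivative \<phi> (at x))" by (rule has_derivative_linear)
  then have "frechet_derivative \<phi> (at x) = (\<lambda>h. jac \<phi> x *v h)"
    unfolding jac_def by (simp add: matrix_works fun_eq_iff)
  with D show ?thesis by simp
qed

lemma Cc_inf_field_component:
  assumes \<phi>: "Cc_inf_field \<phi>"
  shows "Cc1_grad (\<lambda>x. \<phi> x $ j) (\<lambda>x. jac \<phi> x $ j)"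
proof -
  have D: "((\<lambda>x. \<phi> x $ j) has_derivative (\<lambda>h. jac \<phi> x $ j \<bullet> h)) (at x)" for x
    using bounded_linear.has_derivative[OF bounded_linear_vec_nth Cc_inf_field_has_derivative[OF \<phi>]]
    by (simp add: matrix_vector_mul_component)
  have "Ck_field (Suc 0) \<phi>" using \<phi> by (auto simp: Cc_inf_field_def smooth_field_def)
  then have c: "continuous_on UNIV (\<lambda>x. frechet_derivative \<phi> (at x) (axis k 1))" for k
    by (simp add: axis_in_Basis_iff)
  have c': "continuous_on UNIV (\<lambda>x. jac \<phi> x $ j)"
    unfolding jac_def matrix_def by (simp, intro continuous_on_vec_lambda continuous_intros c)
  obtain B where B: "\<And>x. norm x > B \<Longrightarrow> \<phi> x = 0" using \<phi> by (auto simp: Cc_inf_field_def)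
  have "jac \<phi> x $ j = 0" if x: "norm x > B" for x
  proof -
    have "open {x :: real^'a. B < norm x}" by (intro open_Collect_less continuous_intros)
    then have "((\<lambda>x. \<phi> x $ j) has_derivative (\<lambda>h. 0)) (at x)"
      using x B by (intro has_derivative_transform_within_open[OF has_derivative_const]) auto
    from has_derivative_unique[OF this D] have "jac \<phi> x $ j \<bullet> (jac \<phi> x $ j) = 0" by metis
    then show ?thesis by simp
  qed
  with D c' B show ?thesis unfolding Cc1_grad_def C1_grad_def by (auto intro!: exI[of _ B])
qed

lemma C1_grad_nth: "C1_grad (\<lambda>x :: real^'n. x $ k) (\<lambda>x. axis k 1)"
proof -
  have "bounded_linear (\<lambda>x :: real^'n. x $ k)" by (rule bounded_linear_vec_nth)
  from bounded_linear_imp_has_derivative[OF this]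
  show ?thesis by (auto simp: C1_grad_def inner_axis' continuous_on_const)
qed

text \<open>Componentwise integration by parts. In the first identity the integrand is half of x
  \<bullet> grad |\<phi>|^2, and the divergence of x is N. In the second the derivative hits the
  coordinate only on the diagonal, which produces the extra integral of |\<phi>|^2, and otherwise
  falls on the second copy of \<phi>, producing its divergence. The third exchanges the two
  directions of differentiation. The divergence terms are kept because the approximants of a
  toroidal field need not be toroidal.\<close>

lemma test_field_identities:
  fixes \<phi> :: "real^'n \<Rightarrow> real^'n"
  assumes \<phi>: "Cc_inf_field \<phi>"
  shows "(\<integral>x. jac \<phi> x \<bullet> outer (\<phi> x) x \<partial>lborel) = - (real CARD('n) / 2) * (\<integral>x. \<phi> x \<bullet> \<phi> x \<partial>lborel)"
    and "(\<integral>x. jac \<phi> x \<bullet> outer x (\<phi> x) \<partial>lborel)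
      = - (\<integral>x. \<phi> x \<bullet> \<phi> x \<partial>lborel) - (\<integral>x. (x \<bullet> \<phi> x) * (\<Sum>j\<in>UNIV. jac \<phi> x $ j $ j) \<partial>lborel)"
    and "(\<integral>x. jac \<phi> x \<bullet> transpose (jac \<phi> x) \<partial>lborel) = (\<integral>x. (\<Sum>j\<in>UNIV. jac \<phi> x $ j $ j)\<^sup>2 \<partial>lborel)"
proof -
  note c = Cc_inf_field_component[OF \<phi>]
  have c1: "C1_grad (\<lambda>x. \<phi> x $ j) (\<lambda>x. jac \<phi> x $ j)" for j using c by (simp add: Cc1_grad_def)
  have cx: "Cc1_grad (\<lambda>x. x $ k * \<phi> x $ j) (\<lambda>x. x $ k *\<^sub>R jac \<phi> x $ j + \<phi> x $ j *\<^sub>R axis k 1)" for j k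
    by (rule Cc1_grad_mult[OF C1_grad_nth c])
  have cx1: "C1_grad (\<lambda>x. x $ k * \<phi> x $ j) (\<lambda>x. x $ k *\<^sub>R jac \<phi> x $ j + \<phi> x $ j *\<^sub>R axis k 1)" for j k
    using cx by (simp add: Cc1_grad_def)
  have i2: "integrable lborel (\<lambda>x. \<phi> x $ i * \<phi> x $ j)" for i j
    using Cc1_grad_integrable(1)[OF Cc1_grad_mult[OF c1 c]] .
  have ax: "(axis m 1 :: real^'n) $ k = (if k = m then 1 else 0 :: real)" for m k :: 'n by (simp add: axis_def)
  \<comment> \<open>The one integration by parts behind the first two identities; the conditional
    term is the derivative of the coordinate \<open>x $ m\<close> in direction
    \<open>k\<close>.\<close>
  have p: "(\<integral>x. jac \<phi> x $ j $ k * (x $ m * \<phi> x $ i) \<partial>lborel)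
      = - (\<integral>x. \<phi> x $ j * (x $ m * jac \<phi> x $ i $ k + (if k = m then \<phi> x $ i else 0)) \<partial>lborel)" for i j k m
    using Cc1_grad_parts(1)[OF c[of j] cx1[of m i], of "axis k 1"]
    by (cases "k = m") (simp_all add: inner_axis inner_add_left ax)
  have ip: "integrable lborel (\<lambda>x. jac \<phi> x $ j $ k * (x $ m * \<phi> x $ i))" for i j k m
    using Cc1_grad_parts(2)[OF c[of j] cx1[of m i], of "axis k 1"] by (simp add: inner_axis)
  have ip': "integrable lborel (\<lambda>x. \<phi> x $ j * (x $ m * jac \<phi> x $ i $ k))" for i j k m
    using ip[of i k m j] by (simp add: mult_ac)
  \<comment> \<open>For \<open>i = j\<close> and \<open>m = k\<close> the unknown integral appears
    on both sides with opposite signs, hence the factor 2.\<close>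
  have e0: "2 * (\<integral>x. jac \<phi> x $ j $ k * (x $ k * \<phi> x $ j) \<partial>lborel) = - (\<integral>x. \<phi> x $ j * \<phi> x $ j \<partial>lborel)" for j k
    using p[of j k k j] ip'[of j k j k] i2[of j j] by (simp add: distrib_left mult_ac)
  have e1: "(\<integral>x. jac \<phi> x $ j $ k * (\<phi> x $ j * x $ k) \<partial>lborel) = - (1/2) * (\<integral>x. \<phi> x $ j * \<phi> x $ j \<partial>lborel)" for j k
    using e0[of j k] by (simp add: mult_ac)
  have "(\<integral>x. jac \<phi> x \<bullet> outer (\<phi> x) x \<partial>lborel) = (\<Sum>j\<in>UNIV. \<Sum>k\<in>UNIV. \<integral>x. jac \<phi> x $ j $ k * (\<phi> x $ j * x $ k) \<partial>lborel)"
    using ip by (simp add: inner_vec_def mult_ac)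
  also have "\<dots> = - (real CARD('n) / 2) * (\<integral>x. \<phi> x \<bullet> \<phi> x \<partial>lborel)"
    unfolding e1 using i2 by (simp add: inner_vec_def sum_distrib_left sum_negf)
  finally show "(\<integral>x. jac \<phi> x \<bullet> outer (\<phi> x) x \<partial>lborel) = - (real CARD('n) / 2) * (\<integral>x. \<phi> x \<bullet> \<phi> x \<partial>lborel)" .
  have e2: "(\<integral>x. jac \<phi> x $ j $ k * (x $ j * \<phi> x $ k) \<partial>lborel)
     = - (\<integral>x. \<phi> x $ j * (x $ j * jac \<phi> x $ k $ k) \<partial>lborel) - (if j = k then \<integral>x. \<phi> x $ j * \<phi> x $ j \<partial>lborel else 0)" for j k
    using p[of j k j k] ip'[of j j k k] i2[of j j] by (auto simp: distrib_left)
  have "(\<integral>x. jac \<phi> x \<bullet> outer x (\<phi> x) \<partial>lborel) = (\<Sum>j\<in>UNIV. \<Sum>k\<in>UNIV. \<integral>x. jac \<phi> x $ j $ k * (x $ j * \<phi> x $ k) \<partial>lborel)"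
    using ip by (simp add: inner_vec_def)
  also have "\<dots> = - (\<integral>x. \<phi> x \<bullet> \<phi> x \<partial>lborel) - (\<Sum>j\<in>UNIV. \<Sum>k\<in>UNIV. \<integral>x. \<phi> x $ j * (x $ j * jac \<phi> x $ k $ k) \<partial>lborel)"
    unfolding e2 using i2 by (simp add: inner_vec_def sum_subtractf sum_negf)
  also have "(\<Sum>j\<in>UNIV. \<Sum>k\<in>UNIV. \<integral>x. \<phi> x $ j * (x $ j * jac \<phi> x $ k $ k) \<partial>lborel)
      = (\<integral>x. (x \<bullet> \<phi> x) * (\<Sum>j\<in>UNIV. jac \<phi> x $ j $ j) \<partial>lborel)"
    using ip' by (subst sum.swap) (simp add: inner_vec_def sum_product mult_ac)
  finally show "(\<integral>x. jac \<phi> x \<bullet> outer x (\<phi> x) \<partial>lborel)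
      = - (\<integral>x. \<phi> x \<bullet> \<phi> x \<partial>lborel) - (\<integral>x. (x \<bullet> \<phi> x) * (\<Sum>j\<in>UNIV. jac \<phi> x $ j $ j) \<partial>lborel)" .
  have cJ: "continuous_on UNIV (\<lambda>x. jac \<phi> x $ j $ k)" for j k
  proof -
    have "continuous_on UNIV (\<lambda>x. jac \<phi> x $ j)" using c1[of j] by (simp add: C1_grad_def)
    then show ?thesis by (rule bounded_linear.continuous_on[OF bounded_linear_vec_nth])
  qed
  have iJ: "integrable lborel (\<lambda>x. jac \<phi> x $ i $ j * jac \<phi> x $ k $ m)" for i j k m
  proof -
    obtain B where "\<And>x. norm x > B \<Longrightarrow> jac \<phi> x $ i = 0" using c[of i] by (auto simp: Cc1_grad_def)
    then show ?thesis
      by (intro integrable_continuous_bounded_support[of _ B]) (auto intro!: continuous_on_mult cJ)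
  qed
  have sw: "(\<integral>x. jac \<phi> x $ j $ k * jac \<phi> x $ k $ j \<partial>lborel) = (\<integral>x. jac \<phi> x $ j $ j * jac \<phi> x $ k $ k \<partial>lborel)" for j k
    using Cc1_grad_swap[OF c[of j] c[of k], of "axis k 1" "axis j 1"] by (simp add: inner_axis)
  show "(\<integral>x. jac \<phi> x \<bullet> transpose (jac \<phi> x) \<partial>lborel) = (\<integral>x. (\<Sum>j\<in>UNIV. jac \<phi> x $ j $ j)\<^sup>2 \<partial>lborel)"
    using iJ by (simp add: inner_vec_def power2_eq_square sum_product sw)
qed

section \<open>Passage from test fields to the completion\<close>

lemma Cc_inf_field_continuous:
  assumes \<phi>: "Cc_inf_field \<phi>"
  obtains B where "continuous_on UNIV \<phi>" "continuous_on UNIV (jac \<phi>)"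
    "\<And>x. norm x > B \<Longrightarrow> \<phi> x = 0" "\<And>x. norm x > B \<Longrightarrow> jac \<phi> x = 0"
proof -
  note c = Cc_inf_field_component[OF \<phi>]
  have "\<forall>j. \<exists>B. \<forall>x. norm x > B \<longrightarrow> \<phi> x $ j = 0 \<and> jac \<phi> x $ j = 0"
    using c by (auto simp: Cc1_grad_def)
  then obtain b where b: "\<And>j x. norm x > b j \<Longrightarrow> \<phi> x $ j = 0 \<and> jac \<phi> x $ j = 0" by metis
  from c have c1: "C1_grad (\<lambda>x. \<phi> x $ j) (\<lambda>x. jac \<phi> x $ j)" for j by (simp add: Cc1_grad_def)
  have "continuous_on UNIV (\<lambda>x. \<chi> j. \<phi> x $ j)"
    by (rule continuous_on_vec_lambda) (rule C1_grad_continuous[OF c1])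
  moreover have "continuous_on UNIV (\<lambda>x. \<chi> j. jac \<phi> x $ j)"
    using c1 by (intro continuous_on_vec_lambda) (simp add: C1_grad_def)
  moreover have "norm x > Max (range b) \<Longrightarrow> \<phi> x = 0 \<and> jac \<phi> x = 0" for x
    using b by (auto simp: vec_eq_iff)
  ultimately show ?thesis by (intro that[of "Max (range b)"]) (auto simp: eta_contract_eq)
qed

text \<open>Since \<open>norm_outer\<close> is multiplicative, the weighted convergence in
  \<open>D_field\<close> is exactly unweighted L2 convergence of the dyads
  \<open>outer (\<phi> k x) x\<close>. The transposed dyads and the radial parts follow as bounded
  linear images, the latter because the trace of \<open>outer x (u x)\<close> is
  \<open>x \<bullet> u x\<close>.\<close>

lemma D_field_L2_tendsto:
  fixes u :: "real^'n \<Rightarrow> real^'n"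
  assumes "D_field u G"
  obtains \<phi> where "\<And>k. Cc_inf_field (\<phi> k)"
    "L2_tendsto \<phi> u" "L2_tendsto (\<lambda>k. jac (\<phi> k)) G"
    "L2_tendsto (\<lambda>k x. outer (\<phi> k x) x) (\<lambda>x. outer (u x) x)"
    "L2_tendsto (\<lambda>k x. outer x (\<phi> k x)) (\<lambda>x. outer x (u x))"
    "L2_tendsto (\<lambda>k x. x \<bullet> \<phi> k x) (\<lambda>x. x \<bullet> u x)"
proof -
  from assms obtain \<phi> where \<phi>: "\<And>k. Cc_inf_field (\<phi> k)"
    and [measurable]: "u \<in> borel_measurable lborel" "G \<in> borel_measurable lborel"
    and l: "(\<lambda>k. \<integral>\<^sup>+ x. ennreal ((norm (\<phi> k x - u x))\<^sup>2) \<partial>lborel) \<longlonglongrightarrow> 0"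
      "(\<lambda>k. \<integral>\<^sup>+ x. ennreal ((norm (\<phi> k x - u x))\<^sup>2 * (norm x)\<^sup>2) \<partial>lborel) \<longlonglongrightarrow> 0"
      "(\<lambda>k. \<integral>\<^sup>+ x. ennreal ((norm (jac (\<phi> k) x - G x))\<^sup>2) \<partial>lborel) \<longlonglongrightarrow> 0"
    unfolding D_field_def by blast
  have s: "square_integrable (\<phi> k)" "square_integrable (jac (\<phi> k))" "square_integrable (\<lambda>x. outer (\<phi> k x) x)" for k
  proof -
    obtain B where B: "continuous_on UNIV (\<phi> k)" "continuous_on UNIV (jac (\<phi> k))"
      "\<And>x. norm x > B \<Longrightarrow> \<phi> k x = 0" "\<And>x. norm x > B \<Longrightarrow> jac (\<phi> k) x = 0"
      using Cc_inf_field_continuous[OF \<phi>] by blast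
    show "square_integrable (\<phi> k)" by (rule square_integrable_continuous[OF B(1,3)])
    show "square_integrable (jac (\<phi> k))" by (rule square_integrable_continuous[OF B(2,4)])
    show "square_integrable (\<lambda>x. outer (\<phi> k x) x)"
      using B(3) by (intro square_integrable_continuous[of _ B] continuous_on_outer B(1) continuous_on_id)
         (simp add: vec_eq_iff)
  qed
  have L: "L2_tendsto \<phi> u" by (rule L2_tendsto_nn_integralI[OF s(1) _ l(1)]) measurable
  have LG: "L2_tendsto (\<lambda>k. jac (\<phi> k)) G" by (rule L2_tendsto_nn_integralI[OF s(2) _ l(3)]) measurable
  have LO: "L2_tendsto (\<lambda>k x. outer (\<phi> k x) x) (\<lambda>x. outer (u x) x)"
  proof (rule L2_tendsto_nn_integralI[OF s(3)])
    show "(\<lambda>x. outer (u x) x) \<in> borel_measurable lborel" by measurable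
    show "(\<lambda>k. \<integral>\<^sup>+ x. ennreal ((norm (outer (\<phi> k x) x - outer (u x) x))\<^sup>2) \<partial>lborel) \<longlonglongrightarrow> 0"
      using l(2) by (simp add: outer_diff_left[symmetric] norm_outer power_mult_distrib)
  qed
  have LO': "L2_tendsto (\<lambda>k x. outer x (\<phi> k x)) (\<lambda>x. outer x (u x))"
    using L2_tendsto_bounded_linear[OF LO bounded_linear_transpose] by (simp add: transpose_outer)
  have Lx: "L2_tendsto (\<lambda>k x. x \<bullet> \<phi> k x) (\<lambda>x. x \<bullet> u x)"
    using L2_tendsto_bounded_linear[OF LO' bounded_linear_trace] by (simp add: inner_vec_def)
  show ?thesis by (rule that[OF \<phi> L LG LO LO' Lx])
qed

text \<open>Every term of the test field identities is an integral of an inner product of two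
  L2-convergent factors, so the identities survive the limit. There
  \<open>x \<bullet> u x = 0\<close> removes the mixed term of the fourth claim, and the vanishing
  trace of \<open>G\<close> removes the right-hand side of the fifth.\<close>

lemma toroidal_identities:
  fixes u :: "real^'n \<Rightarrow> real^'n"
  assumes D: "D_field u G" and tor: "toroidal u G"
  shows "square_integrable u" "square_integrable G"
    "square_integrable (\<lambda>x. outer x (u x) + outer (u x) x)"
    "(\<integral>x. G x \<bullet> (outer x (u x) + outer (u x) x) \<partial>lborel) = - ((real CARD('n) + 2) / 2) * L2_sq u"
    "(\<integral>x. G x \<bullet> transpose (G x) \<partial>lborel) = 0"
    "(\<integral>x. (norm (outer x (u x) + outer (u x) x))\<^sup>2 \<partial>lborel) = 2 * weighted_sq u"
proof -
  obtain \<phi> where \<phi>: "\<And>k. Cc_inf_field (\<phi> k)"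
    and L: "L2_tendsto \<phi> u" "L2_tendsto (\<lambda>k. jac (\<phi> k)) G"
    "L2_tendsto (\<lambda>k x. outer (\<phi> k x) x) (\<lambda>x. outer (u x) x)"
    "L2_tendsto (\<lambda>k x. outer x (\<phi> k x)) (\<lambda>x. outer x (u x))"
    "L2_tendsto (\<lambda>k x. x \<bullet> \<phi> k x) (\<lambda>x. x \<bullet> u x)"
    using D_field_L2_tendsto[OF D] by blast
  have Lt: "L2_tendsto (\<lambda>k x. \<Sum>j\<in>UNIV. jac (\<phi> k) x $ j $ j) (\<lambda>x. \<Sum>j\<in>UNIV. G x $ j $ j)"
    by (rule L2_tendsto_bounded_linear[OF L(2) bounded_linear_trace])
  show su: "square_integrable u" "square_integrable G"
    using L by (auto simp: L2_tendsto_def)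
  have so: "square_integrable (\<lambda>x. outer x (u x))" "square_integrable (\<lambda>x. outer (u x) x)"
    using L by (auto simp: L2_tendsto_def)
  show "square_integrable (\<lambda>x. outer x (u x) + outer (u x) x)"
    by (rule square_integrable_add[OF so])
  have ne0: "AE x in lborel. (x :: real^'n) \<noteq> 0" by (rule AE_lborel_singleton)
  have xu: "AE x in lborel. x \<bullet> u x = 0"
    using conjunct1[OF tor[unfolded toroidal_def]] by eventually_elim auto
  have tr: "AE x in lborel. (\<Sum>j\<in>UNIV. G x $ j $ j) = 0"
    using conjunct2[OF tor[unfolded toroidal_def]] ne0 by eventually_elim auto
  have 1: "(\<integral>x. G x \<bullet> outer (u x) x \<partial>lborel) = - (real CARD('n) / 2) * (\<integral>x. u x \<bullet> u x \<partial>lborel)"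
    using L2_tendsto_inner[OF L(2,3)] tendsto_mult[OF tendsto_const L2_tendsto_inner[OF L(1,1)]]
    unfolding test_field_identities(1)[OF \<phi>] by (rule LIMSEQ_unique)
  have "(\<lambda>k. \<integral>x. (x \<bullet> \<phi> k x) * (\<Sum>j\<in>UNIV. jac (\<phi> k) x $ j $ j) \<partial>lborel)
      \<longlonglongrightarrow> (\<integral>x. (x \<bullet> u x) * (\<Sum>j\<in>UNIV. G x $ j $ j) \<partial>lborel)"
    using L2_tendsto_inner[OF L(5) Lt] by simp
  note lim2 = tendsto_diff[OF tendsto_minus[OF L2_tendsto_inner[OF L(1,1)]] this]
  have 2: "(\<integral>x. G x \<bullet> outer x (u x) \<partial>lborel) = - (\<integral>x. u x \<bullet> u x \<partial>lborel) - (\<integral>x. (x \<bullet> u x) * (\<Sum>j\<in>UNIV. G x $ j $ j) \<partial>lborel)"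
    by (rule LIMSEQ_unique[OF L2_tendsto_inner[OF L(2,4), unfolded test_field_identities(2)[OF \<phi>]] lim2])
  have "(\<integral>x. (x \<bullet> u x) * (\<Sum>j\<in>UNIV. G x $ j $ j) \<partial>lborel) = 0"
    using xu by (intro integral_eq_zero_AE) auto
  with 1 2 show "(\<integral>x. G x \<bullet> (outer x (u x) + outer (u x) x) \<partial>lborel) = - ((real CARD('n) + 2) / 2) * L2_sq u"
    using square_integrable_inner[OF su(2) so(1)] square_integrable_inner[OF su(2) so(2)]
    by (simp add: inner_add_right L2_sq_def power2_norm_eq_inner field_simps)
  have lim3: "(\<lambda>k. \<integral>x. (\<Sum>j\<in>UNIV. jac (\<phi> k) x $ j $ j)\<^sup>2 \<partial>lborel) \<longlonglongrightarrow> (\<integral>x. (\<Sum>j\<in>UNIV. G x $ j $ j)\<^sup>2 \<partial>lborel)"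
    using L2_tendsto_inner[OF Lt Lt] by (simp add: power2_eq_square)
  have "(\<integral>x. G x \<bullet> transpose (G x) \<partial>lborel) = (\<integral>x. (\<Sum>j\<in>UNIV. G x $ j $ j)\<^sup>2 \<partial>lborel)"
    using L2_tendsto_inner[OF L(2) L2_tendsto_bounded_linear[OF L(2) bounded_linear_transpose]] lim3
    unfolding test_field_identities(3)[OF \<phi>] by (rule LIMSEQ_unique)
  also have "\<dots> = 0"
    using tr by (intro integral_eq_zero_AE) auto
  finally show "(\<integral>x. G x \<bullet> transpose (G x) \<partial>lborel) = 0" .
  \<comment> \<open>In general the squared norm also contains
    \<open>2 * (x \<bullet> u x)\<^sup>2\<close>, which is zero almost everywhere for a tangential
    field.\<close>
  have "(\<integral>x. (norm (outer x (u x) + outer (u x) x))\<^sup>2 \<partial>lborel) = (\<integral>x. 2 * ((norm (u x))\<^sup>2 * (norm x)\<^sup>2) \<partial>lborel)"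
  proof (rule integral_cong_AE)
    have m: "u \<in> borel_measurable lborel" "(\<lambda>x. outer x (u x) + outer (u x) x) \<in> borel_measurable lborel"
      using su square_integrable_add[OF so] by (auto simp: square_integrable_def)
    show "(\<lambda>x. (norm (outer x (u x) + outer (u x) x))\<^sup>2) \<in> borel_measurable lborel" using m(2) by measurable
    show "(\<lambda>x. 2 * ((norm (u x))\<^sup>2 * (norm x)\<^sup>2)) \<in> borel_measurable lborel" using m(1) by measurable
    show "AE x in lborel. (norm (outer x (u x) + outer (u x) x))\<^sup>2 = 2 * ((norm (u x))\<^sup>2 * (norm x)\<^sup>2)"
      using xu by eventually_elim
        (simp add: power2_norm_eq_inner inner_add_left inner_add_right inner_outer_outer inner_commute)
  qed
  then show "(\<integral>x. (norm (outer x (u x) + outer (u x) x))\<^sup>2 \<partial>lborel) = 2 * weighted_sq u"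
    by (simp add: weighted_sq_def)
qed

text \<open>Expanding this square replaces the Cauchy-Schwarz inequality between the symmetric gradient
  and \<open>x \<otimes> u + u \<otimes> x\<close>, and exhibits the equality case.\<close>

lemma toroidal_square_identity:
  fixes u :: "real^'n \<Rightarrow> real^'n"
  assumes D: "D_field u G" and tor: "toroidal u G"
  shows "square_integrable (\<lambda>x. G x + transpose (G x) + t *\<^sub>R (outer x (u x) + outer (u x) x))"
    and "(\<integral>x. (norm (G x + transpose (G x) + t *\<^sub>R (outer x (u x) + outer (u x) x)))\<^sup>2 \<partial>lborel)
      = 2 * (grad_sq G - t * (real CARD('n) + 2) * L2_sq u + t\<^sup>2 * weighted_sq u)"
proof -
  note I = toroidal_identities[OF D tor]
  define T where "T = (\<lambda>x. outer x (u x) + outer (u x) x)"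
  note I' = I[folded T_def]
  have sT: "square_integrable (\<lambda>x. transpose (G x))"
    by (rule square_integrable_bounded_linear[OF I(2) bounded_linear_transpose])
  show "square_integrable (\<lambda>x. G x + transpose (G x) + t *\<^sub>R (outer x (u x) + outer (u x) x))"
    by (intro square_integrable_add square_integrable_scaleR I(2,3) sT)
  have TT: "transpose (T x) = T x" for x
    by (simp add: T_def vec_eq_iff)
  have GT: "transpose (G x) \<bullet> T x = G x \<bullet> T x" for x
    using inner_transpose_transpose[of "G x" "T x"] by (simp add: TT)
  have e: "(norm (G x + transpose (G x) + t *\<^sub>R T x))\<^sup>2
     = 2 * (norm (G x))\<^sup>2 + 2 * (G x \<bullet> transpose (G x)) + 4 * t * (G x \<bullet> T x) + t\<^sup>2 * (norm (T x))\<^sup>2" for x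
    using GT[of x] inner_transpose_transpose[of "G x" "G x"]
    unfolding power2_norm_eq_inner
    by (simp add: inner_add_left inner_add_right inner_commute algebra_simps power2_eq_square)
  have "(\<integral>x. (norm (G x + transpose (G x) + t *\<^sub>R T x))\<^sup>2 \<partial>lborel)
      = 2 * grad_sq G + 4 * t * (- ((real CARD('n) + 2) / 2) * L2_sq u) + t\<^sup>2 * (2 * weighted_sq u)"
    unfolding e using I'(4,5,6) square_integrable_inner[OF I(2) sT] square_integrable_inner[OF I'(2,3)]
      square_integrableD[OF I(2)] square_integrableD[OF I'(3)]
    by (simp add: grad_sq_def T_def)
  also have "\<dots> = 2 * (grad_sq G - t * (real CARD('n) + 2) * L2_sq u + t\<^sup>2 * weighted_sq u)"
    by (simp add: algebra_simps)
  finally show "(\<integral>x. (norm (G x + transpose (G x) + t *\<^sub>R (outer x (u x) + outer (u x) x)))\<^sup>2 \<partial>lborel)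
      = 2 * (grad_sq G - t * (real CARD('n) + 2) * L2_sq u + t\<^sup>2 * weighted_sq u)"
    unfolding T_def .
qed

text \<open>If the weighted integral vanished, so would the symmetric dyad, and the pairing identity
  would force the integral of |u|^2 to be zero. This legitimates dividing by
  \<open>weighted_sq u\<close> in the choice of the optimal parameter.\<close>

lemma weighted_sq_pos:
  fixes u :: "real^'n \<Rightarrow> real^'n"
  assumes D: "D_field u G" and tor: "toroidal u G" and L: "L2_sq u \<noteq> 0"
  shows "weighted_sq u > 0"
proof (rule ccontr)
  assume "\<not> weighted_sq u > 0"
  moreover have "weighted_sq u \<ge> 0" by (simp add: weighted_sq_def)
  ultimately have "weighted_sq u = 0" by simp
  then have "(\<integral>x. (norm (outer x (u x) + outer (u x) x))\<^sup>2 \<partial>lborel) = 0"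
    using toroidal_identities(6)[OF D tor] by simp
  then have T: "AE x in lborel. (norm (outer x (u x) + outer (u x) x))\<^sup>2 = 0"
    using square_integrableD[OF toroidal_identities(3)[OF D tor]]
    by (subst (asm) integral_nonneg_eq_0_iff_AE) auto
  have "AE x in lborel. G x \<bullet> (outer x (u x) + outer (u x) x) = 0"
    using T by eventually_elim simp
  then have "(\<integral>x. G x \<bullet> (outer x (u x) + outer (u x) x) \<partial>lborel) = 0"
    by (rule integral_eq_zero_AE)
  with toroidal_identities(4)[OF D tor] L show False by simp
qed

text \<open>The parameter m / (2W) is the vertex of the parabola A - m t + W t^2. With m equal to N
  + 2 times the integral of |u|^2, the term m^2 / 4 is the right-hand side of the claimed
  inequality.\<close>

lemma quadratic_at_vertex:
  fixes A W m :: real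
  assumes "W > 0"
  shows "A - m / (2 * W) * m + (m / (2 * W))\<^sup>2 * W = (A * W - m\<^sup>2 / 4) / W"
  using assms by (simp add: field_simps power2_eq_square)

text \<open>Here the deficit of the inequality is, up to a positive factor, the integral of a
  square. Nonnegativity of the integral gives the inequality, and equality forces the squared
  expression to vanish almost everywhere.\<close>

lemma toroidal_square_identity_at_vertex:
  fixes u :: "real^'n \<Rightarrow> real^'n"
  assumes D: "D_field u G" and tor: "toroidal u G" and L: "L2_sq u \<noteq> 0"
  defines "\<mu> \<equiv> (real CARD('n) + 2) * L2_sq u / (2 * weighted_sq u)"
  shows "(\<integral>x. (norm (G x + transpose (G x) + \<mu> *\<^sub>R (outer x (u x) + outer (u x) x)))\<^sup>2 \<partial>lborel)
     = 2 * ((grad_sq G * weighted_sq u - (real CARD('n) + 2)\<^sup>2 / 4 * (L2_sq u)\<^sup>2) / weighted_sq u)"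
proof -
  define m where "m = (real CARD('n) + 2) * L2_sq u"
  have \<mu>: "\<mu> = m / (2 * weighted_sq u)" by (simp add: \<mu>_def m_def)
  have "\<mu> * (real CARD('n) + 2) * L2_sq u = \<mu> * m" by (simp only: m_def mult.assoc)
  moreover have "(real CARD('n) + 2)\<^sup>2 / 4 * (L2_sq u)\<^sup>2 = m\<^sup>2 / 4"
    by (simp only: m_def power_mult_distrib times_divide_eq_left)
  ultimately show ?thesis
    unfolding toroidal_square_identity(2)[OF D tor]
    using quadratic_at_vertex[OF weighted_sq_pos[OF D tor L], of "grad_sq G" m]
    by (simp only: \<mu>)
qed

lemma toroidal_inequality:
  fixes u :: "real^'n \<Rightarrow> real^'n"
  assumes D: "D_field u G" and tor: "toroidal u G"
  shows "grad_sq G * weighted_sq u \<ge> (real CARD('n) + 2)\<^sup>2 / 4 * (L2_sq u)\<^sup>2"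
proof (cases "L2_sq u = 0")
  case True
  then show ?thesis by (simp add: grad_sq_def weighted_sq_def)
next
  case False
  have "0 \<le> 2 * ((grad_sq G * weighted_sq u - (real CARD('n) + 2)\<^sup>2 / 4 * (L2_sq u)\<^sup>2) / weighted_sq u)"
    unfolding toroidal_square_identity_at_vertex[OF D tor False, symmetric]
    by (intro Bochner_Integration.integral_nonneg) simp
  then have "0 \<le> (grad_sq G * weighted_sq u - (real CARD('n) + 2)\<^sup>2 / 4 * (L2_sq u)\<^sup>2) / weighted_sq u"
    by (simp only: zero_le_mult_iff) simp
  then have "0 \<le> grad_sq G * weighted_sq u - (real CARD('n) + 2)\<^sup>2 / 4 * (L2_sq u)\<^sup>2"
    using weighted_sq_pos[OF D tor False] by (simp only: zero_le_divide_iff) simp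
  then show ?thesis by (simp only: diff_ge_0_iff_ge)
qed

lemma toroidal_equality_AE:
  fixes u :: "real^'n \<Rightarrow> real^'n"
  assumes D: "D_field u G" and tor: "toroidal u G" and L: "L2_sq u \<noteq> 0"
    and eq: "grad_sq G * weighted_sq u = (real CARD('n) + 2)\<^sup>2 / 4 * (L2_sq u)\<^sup>2"
  obtains \<mu> where "\<mu> > 0" "AE x in lborel. G x + transpose (G x) + \<mu> *\<^sub>R (outer x (u x) + outer (u x) x) = 0"
proof -
  define \<mu> where "\<mu> = (real CARD('n) + 2) * L2_sq u / (2 * weighted_sq u)"
  define Z where "Z = (\<lambda>x. G x + transpose (G x) + \<mu> *\<^sub>R (outer x (u x) + outer (u x) x))"
  have "L2_sq u \<ge> 0" by (simp add: L2_sq_def)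
  with L weighted_sq_pos[OF D tor L] have \<mu>: "\<mu> > 0" by (simp add: \<mu>_def)
  have 0: "(\<integral>x. (norm (Z x))\<^sup>2 \<partial>lborel) = 0"
    unfolding Z_def \<mu>_def toroidal_square_identity_at_vertex[OF D tor L] eq by simp
  have "square_integrable Z"
    unfolding Z_def by (rule toroidal_square_identity(1)[OF D tor])
  then have i: "integrable lborel (\<lambda>x. (norm (Z x))\<^sup>2)" by (rule square_integrableD)
  have "AE x in lborel. (norm (Z x))\<^sup>2 = 0"
    using 0 by (rule iffD1[OF integral_nonneg_eq_0_iff_AE[OF i], rotated]) simp
  then have "AE x in lborel. Z x = 0" by eventually_elim simp
  then show ?thesis unfolding Z_def by (rule that[OF \<mu>])
qed

section \<open>Rigidity in the equality case\<close>

lemma nn_integral_lborel_affine: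
  fixes f :: "'a::euclidean_space \<Rightarrow> ennreal"
  assumes [measurable]: "f \<in> borel_measurable borel" and c: "c \<noteq> 0"
  shows "(\<integral>\<^sup>+x. f x \<partial>lborel) = ennreal (\<bar>c\<bar> ^ DIM('a)) * (\<integral>\<^sup>+x. f (t + c *\<^sub>R x) \<partial>lborel)"
  by (subst lborel_affine[OF c, of t])
     (simp add: nn_integral_density nn_integral_distr nn_integral_cmult)

lemma nn_integral_lborel_affine_le:
  fixes f :: "'a::euclidean_space \<Rightarrow> ennreal"
  assumes [measurable]: "f \<in> borel_measurable borel" and c: "c \<ge> 1 / 2"
  shows "(\<integral>\<^sup>+x. f (t + c *\<^sub>R x) \<partial>lborel) \<le> ennreal (2 ^ DIM('a)) * (\<integral>\<^sup>+x. f x \<partial>lborel)"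
proof -
  have "1 \<le> (2 * c) ^ DIM('a)" using c by (intro one_le_power) simp
  then have "1 \<le> 2 ^ DIM('a) * \<bar>c\<bar> ^ DIM('a)" using c by (simp add: power_mult_distrib)
  then have "ennreal 1 \<le> ennreal (2 ^ DIM('a)) * ennreal (\<bar>c\<bar> ^ DIM('a))"
    by (subst ennreal_mult[symmetric]) (auto intro!: ennreal_leI)
  then have "1 * (\<integral>\<^sup>+x. f (t + c *\<^sub>R x) \<partial>lborel)
      \<le> ennreal (2 ^ DIM('a)) * ennreal (\<bar>c\<bar> ^ DIM('a)) * (\<integral>\<^sup>+x. f (t + c *\<^sub>R x) \<partial>lborel)"
    by (intro mult_right_mono) auto
  also have "\<dots> = ennreal (2 ^ DIM('a)) * (\<integral>\<^sup>+x. f x \<partial>lborel)"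
    using c nn_integral_lborel_affine[of f c t] by (simp add: mult.assoc)
  finally show ?thesis by simp
qed

text \<open>For fixed \<open>y\<close> the point \<open>r *\<^sub>R y + s *\<^sub>R x\<close> is
  taken as the new variable; as \<open>s\<close> is at least 1/2, the inverse Jacobian is at most 2
  to the dimension, and convexity keeps the new variable in \<open>B\<close>. The outer integral
  then only contributes the measure of \<open>B\<close>.\<close>

lemma nn_integral_convex_combination_le:
  fixes H :: "'a::euclidean_space \<Rightarrow> ennreal"
  assumes [measurable]: "H \<in> borel_measurable borel" and B: "convex B" and [measurable]: "B \<in> sets borel"
    and rs: "r \<ge> 0" "s \<ge> 1 / 2" "r + s = 1"
  shows "(\<integral>\<^sup>+y. \<integral>\<^sup>+x. indicator B y * (indicator B x * H (r *\<^sub>R y + s *\<^sub>R x)) \<partial>lborel \<partial>lborel)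
     \<le> ennreal (2 ^ DIM('a)) * emeasure lborel B * (\<integral>\<^sup>+x. indicator B x * H x \<partial>lborel)"
proof -
  have "(\<integral>\<^sup>+x. indicator B y * (indicator B x * H (r *\<^sub>R y + s *\<^sub>R x)) \<partial>lborel)
      \<le> indicator B y * (ennreal (2 ^ DIM('a)) * (\<integral>\<^sup>+x. indicator B x * H x \<partial>lborel))" for y
  proof (cases "y \<in> B")
    case True
    have "(\<integral>\<^sup>+x. indicator B x * H (r *\<^sub>R y + s *\<^sub>R x) \<partial>lborel)
      \<le> (\<integral>\<^sup>+x. indicator B (r *\<^sub>R y + s *\<^sub>R x) * H (r *\<^sub>R y + s *\<^sub>R x) \<partial>lborel)"
      using True rs by (intro nn_integral_mono) (auto simp: indicator_def convexD[OF B])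
    also have "\<dots> \<le> ennreal (2 ^ DIM('a)) * (\<integral>\<^sup>+x. indicator B x * H x \<partial>lborel)"
      by (rule nn_integral_lborel_affine_le[of "\<lambda>x. indicator B x * H x" s "r *\<^sub>R y"]) (use rs in auto)
    finally show ?thesis using True by simp
  qed simp
  then have "(\<integral>\<^sup>+y. \<integral>\<^sup>+x. indicator B y * (indicator B x * H (r *\<^sub>R y + s *\<^sub>R x)) \<partial>lborel \<partial>lborel)
     \<le> (\<integral>\<^sup>+y. indicator B y * (ennreal (2 ^ DIM('a)) * (\<integral>\<^sup>+x. indicator B x * H x \<partial>lborel)) \<partial>lborel)"
    by (intro nn_integral_mono) auto
  also have "\<dots> = emeasure lborel B * (ennreal (2 ^ DIM('a)) * (\<integral>\<^sup>+x. indicator B x * H x \<partial>lborel))"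
    by (simp add: nn_integral_multc)
  finally show ?thesis by (simp add: mult_ac)
qed

text \<open>The averaging argument known from the Poincare inequality on convex sets. For each
  \<open>t\<close> one endpoint has weight at least 1/2; substituting for that endpoint avoids the
  degenerate Jacobian that the other one has near \<open>t = 0\<close> or
  \<open>t = 1\<close>.\<close>

lemma nn_integral_segments_le:
  fixes H :: "'a::euclidean_space \<Rightarrow> ennreal"
  assumes [measurable]: "H \<in> borel_measurable borel" and B: "convex B" and [measurable]: "B \<in> sets borel"
  shows "(\<integral>\<^sup>+x. \<integral>\<^sup>+y. indicator B x * (indicator B y * (\<integral>\<^sup>+t. indicator {0..1::real} t * H (y + t *\<^sub>R (x - y)) \<partial>lborel)) \<partial>lborel \<partial>lborel)
     \<le> ennreal (2 ^ DIM('a)) * emeasure lborel B * (\<integral>\<^sup>+x. indicator B x * H x \<partial>lborel)"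
    (is "?L \<le> ?C")
proof -
  let ?F = "\<lambda>x y (t::real). indicator {0..1::real} t * (indicator B x * (indicator B y * H (y + t *\<^sub>R (x - y))))"
  have "?L = (\<integral>\<^sup>+x. \<integral>\<^sup>+y. \<integral>\<^sup>+t. ?F x y t \<partial>lborel \<partial>lborel \<partial>lborel)"
    by (intro nn_integral_cong) (auto simp: nn_integral_cmult[symmetric] indicator_def intro!: nn_integral_cong)
  also have "\<dots> = (\<integral>\<^sup>+x. \<integral>\<^sup>+t. \<integral>\<^sup>+y. ?F x y t \<partial>lborel \<partial>lborel \<partial>lborel)"
    by (intro nn_integral_cong lborel_pair.Fubini') measurable
  also have "\<dots> = (\<integral>\<^sup>+t. \<integral>\<^sup>+x. \<integral>\<^sup>+y. ?F x y t \<partial>lborel \<partial>lborel \<partial>lborel)"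
    by (intro lborel_pair.Fubini') measurable
  also have "\<dots> \<le> (\<integral>\<^sup>+t. indicator {0..1::real} t * ?C \<partial>lborel)"
  proof (rule nn_integral_mono)
    fix t :: real
    show "(\<integral>\<^sup>+x. \<integral>\<^sup>+y. ?F x y t \<partial>lborel \<partial>lborel) \<le> indicator {0..1} t * ?C"
    proof (cases "t \<in> {0..1}")
      case t: True
      have e: "y + t *\<^sub>R (x - y) = (1 - t) *\<^sub>R y + t *\<^sub>R x" for x y :: 'a by (simp add: algebra_simps)
      have "(\<integral>\<^sup>+x. \<integral>\<^sup>+y. indicator B x * (indicator B y * H (t *\<^sub>R x + (1 - t) *\<^sub>R y)) \<partial>lborel \<partial>lborel) \<le> ?C"
      \<comment> \<open>The endpoint with the larger weight must be the inner variable. For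
        \<open>t \<ge> 1 / 2\<close> it is \<open>x\<close>, so the order of integration is
        exchanged; otherwise it is \<open>y\<close>, which is innermost already.\<close>
      proof (cases "t \<ge> 1 / 2")
        case True
        have "(\<integral>\<^sup>+x. \<integral>\<^sup>+y. indicator B x * (indicator B y * H (t *\<^sub>R x + (1 - t) *\<^sub>R y)) \<partial>lborel \<partial>lborel)
          = (\<integral>\<^sup>+y. \<integral>\<^sup>+x. indicator B y * (indicator B x * H ((1 - t) *\<^sub>R y + t *\<^sub>R x)) \<partial>lborel \<partial>lborel)"
          by (subst lborel_pair.Fubini'[symmetric], measurable)
             (auto intro!: nn_integral_cong simp: mult_ac add.commute)
        also have "\<dots> \<le> ?C"
          using True t by (intro nn_integral_convex_combination_le B) auto
        finally show ?thesis .
      next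
        case False
        then show ?thesis using t by (intro nn_integral_convex_combination_le B) auto
      qed
      with t show ?thesis by (simp add: e add.commute)
    qed simp
  qed
  also have "\<dots> = ?C" by (simp add: nn_integral_multc)
  finally show ?thesis .
qed

text \<open>The fundamental theorem of calculus followed by the Cauchy-Schwarz inequality on an
  interval of length 1. The extended integral on the right lets it be inserted into multiple
  integrals without integrability conditions.\<close>

lemma nn_integral_FTC_square_le:
  fixes g :: "real \<Rightarrow> real"
  assumes d: "\<And>t. (g has_real_derivative g' t) (at t)" and c: "continuous_on UNIV g'"
  shows "ennreal ((g 1 - g 0)\<^sup>2) \<le> (\<integral>\<^sup>+t. indicator {0..1} t * ennreal ((g' t)\<^sup>2) \<partial>lborel)"
proof -
  have [measurable]: "g' \<in> borel_measurable borel" using c by (rule borel_measurable_continuous_onI)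
  have i: "integrable lborel (\<lambda>t. indicator {0..1} t *\<^sub>R g' t)"
    by (rule borel_integrable_compact) (auto intro: continuous_on_subset[OF c])
  have F: "(\<integral>t. indicator {0..1} t *\<^sub>R g' t \<partial>lborel) = g 1 - g 0"
    using c d by (intro integral_FTC_atLeastAtMost)
      (auto simp: has_real_derivative_iff_has_vector_derivative[symmetric] intro: continuous_on_subset DERIV_subset)
  have "ennreal (norm (g 1 - g 0)) \<le> (\<integral>\<^sup>+t. ennreal (norm (indicator {0..1} t *\<^sub>R g' t)) \<partial>lborel)"
    unfolding F[symmetric] by (rule integral_norm_bound_ennreal[OF i])
  also have "\<dots> = (\<integral>\<^sup>+t. (indicator {0..1} t * ennreal \<bar>g' t\<bar>) * indicator {0..1} t \<partial>lborel)"
    by (intro nn_integral_cong) (auto simp: indicator_def)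
  finally have "(ennreal (norm (g 1 - g 0)))\<^sup>2 \<le> (\<integral>\<^sup>+t. (indicator {0..1} t * ennreal \<bar>g' t\<bar>) * indicator {0..1} t \<partial>lborel)\<^sup>2"
    by (intro power_mono) auto
  also have "\<dots> \<le> (\<integral>\<^sup>+t. (indicator {0..1} t * ennreal \<bar>g' t\<bar>)\<^sup>2 \<partial>lborel) * (\<integral>\<^sup>+t. (indicator {0..1::real} t)\<^sup>2 \<partial>lborel)"
    by (rule Cauchy_Schwarz_nn_integral) measurable
  also have "(\<integral>\<^sup>+t. (indicator {0..1::real} t)\<^sup>2 \<partial>lborel) = (\<integral>\<^sup>+t. indicator {0..1::real} t \<partial>lborel)"
    by (intro nn_integral_cong) (auto simp: indicator_def)
  also have "\<dots> = 1" by simp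
  also have "(\<integral>\<^sup>+t. (indicator {0..1} t * ennreal \<bar>g' t\<bar>)\<^sup>2 \<partial>lborel) = (\<integral>\<^sup>+t. indicator {0..1} t * ennreal ((g' t)\<^sup>2) \<partial>lborel)"
    by (intro nn_integral_cong) (auto simp: indicator_def ennreal_power)
  finally show ?thesis by (simp add: ennreal_power)
qed

lemma AE_lborel_not_False: "\<not> (AE x :: 'a::euclidean_space in lborel. False)"
proof
  assume "AE x :: 'a in lborel. False"
  then obtain N where "{x \<in> space (lborel :: 'a measure). \<not> False} \<subseteq> N" "emeasure lborel N = 0" "N \<in> sets (lborel :: 'a measure)"
    by (rule AE_E)
  then show False using emeasure_lborel_UNIV[where 'a='a] by (auto simp: top_unique)
qed

lemma continuous_AE_zero:
  fixes f :: "'a::euclidean_space \<Rightarrow> real"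
  assumes c: "continuous_on UNIV f" and ae: "AE x in lborel. f x = 0"
  shows "f x = 0"
proof (rule ccontr)
  assume "f x \<noteq> 0"
  have o: "open {x. f x \<noteq> 0}" by (intro open_Collect_neq c continuous_on_const)
  then obtain e where e: "e > 0" "ball x e \<subseteq> {x. f x \<noteq> 0}"
    using \<open>f x \<noteq> 0\<close> open_contains_ball by blast
  have "{x. f x \<noteq> 0} \<in> null_sets lborel"
    using ae o by (subst AE_iff_null_sets) auto
  then have "ball x e \<in> null_sets lborel" using e(2) by (intro null_sets_subset[of _ lborel "ball x e"]) auto
  then have "measure lborel (ball x e) = 0" by (simp add: measure_def null_setsD1)
  then show False using content_ball_pos[OF e(1), of x] by simp
qed

text \<open>A proper subspace is a null set and so cannot contain a set of full measure. This is
  what allows a basis to be chosen among points where an almost-everywhere statement holds.\<close>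

lemma AE_imp_span_UNIV:
  fixes Y :: "'a::euclidean_space set"
  assumes ae: "AE x in lborel. x \<in> Y"
  shows "span Y = UNIV"
proof (rule ccontr)
  assume "span Y \<noteq> UNIV"
  then have "dim (span Y) < DIM('a)"
    by (metis dim_eq_full dim_span dim_subset_UNIV le_neq_implies_less span_span)
  then have "span Y \<in> null_sets lebesgue" using negligible_lowdim negligible_iff_null_sets by blast
  moreover have "span Y \<in> sets borel" by (intro borel_closed closed_subspace subspace_span)
  ultimately have "span Y \<in> null_sets lborel" by (simp add: null_sets_completion_iff)
  then have "AE x in lborel. x \<notin> span Y" by (rule AE_not_in)
  with ae have "AE x :: 'a in lborel. False" by eventually_elim (use span_base in blast)
  then show False using AE_lborel_not_False by blast
qed

text \<open>Measures in \<open>L\<^sup>2(B \<times> B)\<close> the failure of \<open>f\<close> to be an infinitesimal isometry without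
  differentiating \<open>f\<close>, so that it passes to \<open>L\<^sup>2\<close> limits.\<close>

definition pair_defect :: "'a::euclidean_space set \<Rightarrow> ('a \<Rightarrow> 'a) \<Rightarrow> ennreal" where
  "pair_defect B f = (\<integral>\<^sup>+x. \<integral>\<^sup>+y. indicator B x * (indicator B y * ennreal (((f x - f y) \<bullet> (x - y))\<^sup>2)) \<partial>lborel \<partial>lborel)"

lemma pair_defect_eq_0D:
  assumes f: "f \<in> borel_measurable lborel" and B: "B \<in> sets borel" and 0: "pair_defect B f = 0"
  shows "AE x in lborel. AE y in lborel. x \<in> B \<longrightarrow> y \<in> B \<longrightarrow> (f x - f y) \<bullet> (x - y) = 0"
proof -
  note [measurable] = f B
  have "AE x in lborel. (\<integral>\<^sup>+y. indicator B x * (indicator B y * ennreal (((f x - f y) \<bullet> (x - y))\<^sup>2)) \<partial>lborel) = 0"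
    using 0 unfolding pair_defect_def by (subst (asm) nn_integral_0_iff_AE) auto
  then show ?thesis
  proof eventually_elim
    case (elim x)
    then have "AE y in lborel. indicator B x * (indicator B y * ennreal (((f x - f y) \<bullet> (x - y))\<^sup>2)) = 0"
      by (subst (asm) nn_integral_0_iff_AE) auto
    then show ?case by eventually_elim (auto simp: indicator_def split: if_splits)
  qed
qed

text \<open>L2 stability of the defect on a ball, where \<open>norm (x - y) \<le> 2 * R\<close>.
  Twice the inequality (p + q)^2 \<le> 2 p^2 + 2 q^2 and the factor (2R)^2 give 16 R^2 for each of
  the two points; integrating out the other point makes the two terms equal, hence 32 R^2.\<close>

lemma pair_defect_cball_le:
  fixes f g :: "'a::euclidean_space \<Rightarrow> 'a"
  assumes f: "f \<in> borel_measurable lborel" and g: "g \<in> borel_measurable lborel" and R: "R \<ge> 0"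
  shows "pair_defect (cball 0 R) f \<le> 2 * pair_defect (cball 0 R) g
    + ennreal (32 * R\<^sup>2) * emeasure lborel (cball (0 :: 'a) R) * (\<integral>\<^sup>+x. indicator (cball 0 R) x * ennreal ((norm (f x - g x))\<^sup>2) \<partial>lborel)"
proof -
  have [measurable]: "f \<in> borel_measurable borel" "g \<in> borel_measurable borel" using f g by auto
  let ?B = "cball (0 :: 'a) R"
  let ?i = "indicator ?B :: 'a \<Rightarrow> ennreal"
  let ?d = "\<lambda>x. ennreal ((norm (f x - g x))\<^sup>2)"
  let ?c = "ennreal (16 * R\<^sup>2)"
  have pw: "ennreal (((f x - f y) \<bullet> (x - y))\<^sup>2) \<le> 2 * ennreal (((g x - g y) \<bullet> (x - y))\<^sup>2) + ?c * ?d x + ?c * ?d y"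
    if "x \<in> ?B" "y \<in> ?B" for x y
  proof -
    have n: "norm (x - y) \<le> 2 * R" using norm_triangle_ineq4[of x y] that by simp
    define p where "p = f x - g x"
    define q where "q = f y - g y"
    have e: "(f x - f y) \<bullet> (x - y) = (g x - g y) \<bullet> (x - y) + (p - q) \<bullet> (x - y)"
      by (simp add: p_def q_def inner_diff_left)
    have "((f x - f y) \<bullet> (x - y))\<^sup>2 \<le> 2 * ((g x - g y) \<bullet> (x - y))\<^sup>2 + 2 * ((p - q) \<bullet> (x - y))\<^sup>2"
      using norm_add_squared_le[of "(g x - g y) \<bullet> (x - y)" "(p - q) \<bullet> (x - y)"] unfolding e by simp
    moreover have "((p - q) \<bullet> (x - y))\<^sup>2 \<le> (norm (p - q))\<^sup>2 * (2 * R)\<^sup>2"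
    proof -
      have "\<bar>(p - q) \<bullet> (x - y)\<bar> \<le> norm (p - q) * (2 * R)"
        using Cauchy_Schwarz_ineq2[of "p - q" "x - y"] mult_left_mono[OF n, of "norm (p - q)"] by simp
      from power_mono[OF this, of 2] show ?thesis by (simp add: power_mult_distrib)
    qed
    moreover have "(norm (p - q))\<^sup>2 * (2 * R)\<^sup>2 \<le> (2 * (norm p)\<^sup>2 + 2 * (norm q)\<^sup>2) * (2 * R)\<^sup>2"
      using norm_add_squared_le[of p "- q"] by (intro mult_right_mono) auto
    ultimately have "((f x - f y) \<bullet> (x - y))\<^sup>2 \<le> 2 * ((g x - g y) \<bullet> (x - y))\<^sup>2 + 16 * R\<^sup>2 * (norm p)\<^sup>2 + 16 * R\<^sup>2 * (norm q)\<^sup>2"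
      by (simp add: algebra_simps)
    then have "ennreal (((f x - f y) \<bullet> (x - y))\<^sup>2) \<le> ennreal (2 * ((g x - g y) \<bullet> (x - y))\<^sup>2 + 16 * R\<^sup>2 * (norm p)\<^sup>2 + 16 * R\<^sup>2 * (norm q)\<^sup>2)"
      by (rule ennreal_leI)
    also have "\<dots> = 2 * ennreal (((g x - g y) \<bullet> (x - y))\<^sup>2) + ?c * ennreal ((norm p)\<^sup>2) + ?c * ennreal ((norm q)\<^sup>2)"
      by (simp add: ennreal_mult)
    finally show ?thesis by (simp add: p_def q_def)
  qed
  have [measurable]: "?B \<in> sets borel" by simp
  have "pair_defect ?B f \<le> (\<integral>\<^sup>+x. \<integral>\<^sup>+y. 2 * (?i x * (?i y * ennreal (((g x - g y) \<bullet> (x - y))\<^sup>2)))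
       + (?c * (?i x * ?d x)) * ?i y + (?c * ?i x) * (?i y * ?d y) \<partial>lborel \<partial>lborel)"
    unfolding pair_defect_def using pw by (intro nn_integral_mono) (auto simp: indicator_def mult_ac)
  also have "\<dots> = (\<integral>\<^sup>+x. 2 * (\<integral>\<^sup>+y. ?i x * (?i y * ennreal (((g x - g y) \<bullet> (x - y))\<^sup>2)) \<partial>lborel)
       + (?c * (?i x * ?d x)) * emeasure lborel ?B + (?c * ?i x) * (\<integral>\<^sup>+y. ?i y * ?d y \<partial>lborel) \<partial>lborel)"
    by (intro nn_integral_cong) (simp add: nn_integral_add nn_integral_cmult)
  also have "\<dots> = 2 * pair_defect ?B g + ?c * (\<integral>\<^sup>+y. ?i y * ?d y \<partial>lborel) * emeasure lborel ?B
       + ?c * emeasure lborel ?B * (\<integral>\<^sup>+y. ?i y * ?d y \<partial>lborel)"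
    unfolding pair_defect_def by (simp add: nn_integral_add nn_integral_cmult nn_integral_multc)
  also have "\<dots> = 2 * pair_defect ?B g + (?c + ?c) * emeasure lborel ?B * (\<integral>\<^sup>+x. ?i x * ?d x \<partial>lborel)"
    by (simp only: distrib_left distrib_right mult_ac add_ac)
  also have "?c + ?c = ennreal (32 * R\<^sup>2)"
    by (subst ennreal_plus[symmetric]) auto
  finally show ?thesis .
qed

text \<open>Along the segment with direction h = x - y, the derivative of the weighted field paired
  with h is a quadratic form in h, so only the symmetric part of the gradient enters. As |h| \<le>
  2R, this derivative is at most 2 R^2 times the weight times the norm of the symmetric expression,
  which explains 4 R^4 after squaring; \<open>exp (\<mu> * R\<^sup>2)\<close> bounds the squared
  weight on the ball.\<close>

lemma pair_defect_weighted_le: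
  fixes \<phi> :: "real^'n \<Rightarrow> real^'n"
  assumes \<phi>: "Cc_inf_field \<phi>" and R: "R \<ge> 0" and \<mu>: "\<mu> \<ge> 0"
  shows "pair_defect (cball 0 R) (\<lambda>x. exp (\<mu> / 2 * (norm x)\<^sup>2) *\<^sub>R \<phi> x)
    \<le> ennreal (2 ^ DIM(real^'n)) * emeasure lborel (cball (0 :: real^'n) R) * (ennreal (4 * R ^ 4 * exp (\<mu> * R\<^sup>2)) *
      (\<integral>\<^sup>+x. ennreal ((norm (jac \<phi> x + transpose (jac \<phi> x) + \<mu> *\<^sub>R (outer x (\<phi> x) + outer (\<phi> x) x)))\<^sup>2) \<partial>lborel))"
proof -
  define \<rho> where "\<rho> = (\<lambda>x :: real^'n. exp (\<mu> / 2 * (norm x)\<^sup>2))"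
  define W where "W = (\<lambda>x. jac \<phi> x + transpose (jac \<phi> x) + \<mu> *\<^sub>R (outer x (\<phi> x) + outer (\<phi> x) x))"
  let ?B = "cball (0 :: real^'n) R"
  let ?i = "indicator ?B :: real^'n \<Rightarrow> ennreal"
  define H where "H = (\<lambda>x. ennreal (4 * R ^ 4 * (\<rho> x * norm (W x))\<^sup>2))"
  obtain c: "continuous_on UNIV \<phi>" "continuous_on UNIV (jac \<phi>)"
    by (rule Cc_inf_field_continuous[OF \<phi>])
  have cT: "continuous_on UNIV (\<lambda>x. transpose (jac \<phi> x))"
    by (rule bounded_linear.continuous_on[OF bounded_linear_transpose c(2)])
  have cW: "continuous_on UNIV W"
    unfolding W_def by (intro continuous_intros continuous_on_outer c cT)
  have c\<rho>: "continuous_on UNIV \<rho>" unfolding \<rho>_def by (intro continuous_intros)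
  have [measurable]: "W \<in> borel_measurable borel" "\<rho> \<in> borel_measurable borel"
    using cW c\<rho> by (auto intro: borel_measurable_continuous_onI)
  have [measurable]: "H \<in> borel_measurable borel" unfolding H_def by measurable
  have D\<rho>: "(\<rho> has_derivative (\<lambda>v. \<mu> * (x \<bullet> v) * \<rho> x)) (at x)" for x
    unfolding \<rho>_def power2_norm_eq_inner
    by (auto intro!: derivative_eq_intros simp: inner_commute)
  have D\<psi>: "((\<lambda>x. \<rho> x *\<^sub>R \<phi> x) has_derivative (\<lambda>v. \<rho> x *\<^sub>R (jac \<phi> x *v v) + (\<mu> * (x \<bullet> v) * \<rho> x) *\<^sub>R \<phi> x)) (at x)" for x
    using has_derivative_scaleR[OF D\<rho> Cc_inf_field_has_derivative[OF \<phi>]] .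
  \<comment> \<open>Differentiating the weight produces \<open>\<mu> * (x \<bullet> h)\<close>,
    which is precisely what turns the quadratic form of the Jacobian into half of that of
    \<open>W\<close>.\<close>
  have Wh: "W x \<bullet> outer h h = 2 * (h \<bullet> (jac \<phi> x *v h)) + 2 * \<mu> * (x \<bullet> h) * (\<phi> x \<bullet> h)" for x h
  proof -
    have "transpose (jac \<phi> x) \<bullet> outer h h = jac \<phi> x \<bullet> outer h h"
      using inner_transpose_transpose[of "jac \<phi> x" "outer h h"] by (simp add: transpose_outer)
    then show ?thesis
      unfolding W_def inner_outer[of "jac \<phi> x", symmetric]
      by (simp add: inner_add_left inner_outer_outer algebra_simps)
  qed
  have seg: "ennreal (((\<rho> x *\<^sub>R \<phi> x - \<rho> y *\<^sub>R \<phi> y) \<bullet> (x - y))\<^sup>2) \<le> (\<integral>\<^sup>+t. indicator {0..1::real} t * H (y + t *\<^sub>R (x - y)) \<partial>lborel)"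
    if "x \<in> ?B" "y \<in> ?B" for x y
  proof -
    define h where "h = x - y"
    have n: "norm h \<le> 2 * R" using norm_triangle_ineq4[of x y] that by (simp add: h_def)
    define p where "p = (\<lambda>t :: real. y + t *\<^sub>R h)"
    define g where "g = (\<lambda>t. (\<rho> (p t) *\<^sub>R \<phi> (p t)) \<bullet> h)"
    define g' where "g' = (\<lambda>t. \<rho> (p t) * (W (p t) \<bullet> outer h h) / 2)"
    have "(g has_real_derivative g' t) (at t)" for t
    proof -
      have "(p has_derivative (\<lambda>s. s *\<^sub>R h)) (at t)" unfolding p_def by (auto intro!: derivative_eq_intros)
      from has_derivative_inner_left[OF has_derivative_compose[OF this D\<psi>], of h]
      have "(g has_derivative (\<lambda>s. (\<rho> (p t) *\<^sub>R (jac \<phi> (p t) *v (s *\<^sub>R h)) + (\<mu> * (p t \<bullet> (s *\<^sub>R h)) * \<rho> (p t)) *\<^sub>R \<phi> (p t)) \<bullet> h)) (at t)"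
        unfolding g_def .
      moreover have "(\<lambda>s. (\<rho> (p t) *\<^sub>R (jac \<phi> (p t) *v (s *\<^sub>R h)) + (\<mu> * (p t \<bullet> (s *\<^sub>R h)) * \<rho> (p t)) *\<^sub>R \<phi> (p t)) \<bullet> h) = (*) (g' t)"
        unfolding g'_def Wh
        by (auto simp: fun_eq_iff inner_add_left matrix_vector_mult_scaleR inner_commute algebra_simps)
      ultimately show ?thesis by (simp add: has_field_derivative_def)
    qed
    moreover have "continuous_on UNIV g'"
    proof -
      have cp: "continuous_on UNIV p" unfolding p_def by (intro continuous_intros)
      have "continuous_on UNIV (\<lambda>t. \<rho> (p t))" "continuous_on UNIV (\<lambda>t. W (p t))"
        by (rule continuous_on_compose2[OF c\<rho> cp] continuous_on_compose2[OF cW cp]; simp)+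
      then show ?thesis unfolding g'_def by (intro continuous_intros) auto
    qed
    ultimately have "ennreal ((g 1 - g 0)\<^sup>2) \<le> (\<integral>\<^sup>+t. indicator {0..1} t * ennreal ((g' t)\<^sup>2) \<partial>lborel)"
      by (rule nn_integral_FTC_square_le)
    also have "\<dots> \<le> (\<integral>\<^sup>+t. indicator {0..1::real} t * H (y + t *\<^sub>R (x - y)) \<partial>lborel)"
    proof (intro nn_integral_mono mult_left_mono)
      fix t
      have "\<bar>W (p t) \<bullet> outer h h\<bar> \<le> norm (W (p t)) * (norm h * norm h)"
        using Cauchy_Schwarz_ineq2[of "W (p t)" "outer h h"] by (simp add: norm_outer)
      also have "\<dots> \<le> norm (W (p t)) * (2 * R * (2 * R))"
        using n by (intro mult_left_mono mult_mono) (use R in auto)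
      finally have "\<bar>W (p t) \<bullet> outer h h\<bar> \<le> norm (W (p t)) * (2 * R * (2 * R))" .
      then have "\<rho> (p t) * \<bar>W (p t) \<bullet> outer h h\<bar> \<le> \<rho> (p t) * (norm (W (p t)) * (2 * R * (2 * R)))"
        by (intro mult_left_mono) (auto simp: \<rho>_def)
      then have "\<bar>g' t\<bar> \<le> 2 * R\<^sup>2 * (\<rho> (p t) * norm (W (p t)))"
        by (simp add: g'_def abs_mult \<rho>_def power2_eq_square algebra_simps)
      from power_mono[OF this, of 2] have "(g' t)\<^sup>2 \<le> 4 * R ^ 4 * (\<rho> (p t) * norm (W (p t)))\<^sup>2"
        by (simp add: power_mult_distrib)
      then show "ennreal ((g' t)\<^sup>2) \<le> H (y + t *\<^sub>R (x - y))"
        unfolding H_def p_def h_def by (rule ennreal_leI)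
    qed simp
    finally show ?thesis by (simp add: g_def p_def h_def inner_diff_left)
  qed
  have "pair_defect ?B (\<lambda>x. \<rho> x *\<^sub>R \<phi> x)
     \<le> (\<integral>\<^sup>+x. \<integral>\<^sup>+y. ?i x * (?i y * (\<integral>\<^sup>+t. indicator {0..1::real} t * H (y + t *\<^sub>R (x - y)) \<partial>lborel)) \<partial>lborel \<partial>lborel)"
    unfolding pair_defect_def using seg by (intro nn_integral_mono) (auto simp: indicator_def)
  also have "\<dots> \<le> ennreal (2 ^ DIM(real^'n)) * emeasure lborel ?B * (\<integral>\<^sup>+x. ?i x * H x \<partial>lborel)"
    by (rule nn_integral_segments_le) auto
  also have "\<dots> \<le> ennreal (2 ^ DIM(real^'n)) * emeasure lborel ?B * (ennreal (4 * R ^ 4 * exp (\<mu> * R\<^sup>2)) * (\<integral>\<^sup>+x. ennreal ((norm (W x))\<^sup>2) \<partial>lborel))"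
  proof (rule mult_left_mono)
    have "(\<integral>\<^sup>+x. ?i x * H x \<partial>lborel) \<le> (\<integral>\<^sup>+x. ennreal (4 * R ^ 4 * exp (\<mu> * R\<^sup>2)) * ennreal ((norm (W x))\<^sup>2) \<partial>lborel)"
    proof (rule nn_integral_mono)
      fix x
      show "?i x * H x \<le> ennreal (4 * R ^ 4 * exp (\<mu> * R\<^sup>2)) * ennreal ((norm (W x))\<^sup>2)"
      proof (cases "x \<in> ?B")
        case True
        then have "(norm x)\<^sup>2 \<le> R\<^sup>2" by (intro power_mono) auto
        then have "\<mu> * (norm x)\<^sup>2 \<le> \<mu> * R\<^sup>2" using \<mu> by (rule mult_left_mono)
        moreover have "(\<rho> x)\<^sup>2 = exp (\<mu> * (norm x)\<^sup>2)" by (simp add: \<rho>_def exp_double[symmetric])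
        ultimately have "(\<rho> x)\<^sup>2 \<le> exp (\<mu> * R\<^sup>2)" by simp
        then have "4 * R ^ 4 * ((\<rho> x)\<^sup>2 * (norm (W x))\<^sup>2) \<le> 4 * R ^ 4 * (exp (\<mu> * R\<^sup>2) * (norm (W x))\<^sup>2)"
          using R by (intro mult_left_mono mult_right_mono) auto
        then show ?thesis
          using True R unfolding H_def
          by (subst ennreal_mult[symmetric]) (auto intro!: ennreal_leI simp: power_mult_distrib mult.assoc)
      qed simp
    qed
    then show "(\<integral>\<^sup>+x. ?i x * H x \<partial>lborel) \<le> ennreal (4 * R ^ 4 * exp (\<mu> * R\<^sup>2)) * (\<integral>\<^sup>+x. ennreal ((norm (W x))\<^sup>2) \<partial>lborel)"
      by (simp add: nn_integral_cmult)
  qed simp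
  finally show ?thesis unfolding \<rho>_def W_def .
qed

section \<open>Vanishing of the defect and linearity of the weighted field\<close>

lemma L2_tendsto_nn_integral:
  assumes f: "L2_tendsto f g" and g: "AE x in lborel. g x = 0"
  shows "(\<lambda>k. \<integral>\<^sup>+x. ennreal ((norm (f k x))\<^sup>2) \<partial>lborel) \<longlonglongrightarrow> 0"
proof -
  have s: "square_integrable (f k)" "square_integrable g" for k using f by (auto simp: L2_tendsto_def)
  have "(\<integral>\<^sup>+x. ennreal ((norm (f k x))\<^sup>2) \<partial>lborel) = ennreal (\<integral>x. (norm (f k x - g x))\<^sup>2 \<partial>lborel)" for k
  proof -
    have "(\<integral>\<^sup>+x. ennreal ((norm (f k x))\<^sup>2) \<partial>lborel) = (\<integral>\<^sup>+x. ennreal ((norm (f k x - g x))\<^sup>2) \<partial>lborel)"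
      using g by (intro nn_integral_cong_AE) auto
    also have "\<dots> = ennreal (\<integral>x. (norm (f k x - g x))\<^sup>2 \<partial>lborel)"
      using square_integrableD[OF square_integrable_diff[OF s]] by (intro nn_integral_eq_integral) auto
    finally show ?thesis .
  qed
  moreover have "(\<lambda>k. ennreal (\<integral>x. (norm (f k x - g x))\<^sup>2 \<partial>lborel)) \<longlonglongrightarrow> 0"
    using f by (subst ennreal_tendsto_0_iff) (auto simp: L2_tendsto_def)
  ultimately show ?thesis by simp
qed

text \<open>Along the approximating test fields the symmetric expression tends to zero in L2, so
  their weighted versions have defect tending to zero, and the defect of \<open>w\<close> is
  controlled by theirs plus an L2 error. The argument is confined to balls because the weight is
  unbounded on the whole space.\<close>

lemma weighted_field_pair_AE:
  fixes u :: "real^'n \<Rightarrow> real^'n"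
  assumes D: "D_field u G" and \<mu>: "\<mu> \<ge> 0"
    and S: "AE x in lborel. G x + transpose (G x) + \<mu> *\<^sub>R (outer x (u x) + outer (u x) x) = 0"
  defines "w \<equiv> \<lambda>x. exp (\<mu> / 2 * (norm x)\<^sup>2) *\<^sub>R u x"
  shows "AE x in lborel. AE y in lborel. (w x - w y) \<bullet> (x - y) = 0"
proof -
  obtain \<phi> where \<phi>: "\<And>k. Cc_inf_field (\<phi> k)"
    and L: "L2_tendsto \<phi> u" "L2_tendsto (\<lambda>k. jac (\<phi> k)) G"
    "L2_tendsto (\<lambda>k x. outer (\<phi> k x) x) (\<lambda>x. outer (u x) x)"
    "L2_tendsto (\<lambda>k x. outer x (\<phi> k x)) (\<lambda>x. outer x (u x))"
    using D_field_L2_tendsto[OF D] by blast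
  have "u \<in> borel_measurable lborel" using D by (simp add: D_field_def)
  then have um [measurable]: "u \<in> borel_measurable borel" by simp
  have cm: "\<phi> k \<in> borel_measurable borel" for k
    using Cc_inf_field_continuous[OF \<phi>[of k]] borel_measurable_continuous_onI by metis
  note [measurable] = cm
  have wm [measurable]: "w \<in> borel_measurable borel" unfolding w_def by measurable
  define \<psi> where "\<psi> = (\<lambda>k x. exp (\<mu> / 2 * (norm x)\<^sup>2) *\<^sub>R \<phi> k x)"
  have \<psi>m [measurable]: "\<psi> k \<in> borel_measurable borel" for k unfolding \<psi>_def by measurable
  define W where "W = (\<lambda>k x. jac (\<phi> k) x + transpose (jac (\<phi> k) x) + \<mu> *\<^sub>R (outer x (\<phi> k x) + outer (\<phi> k x) x))"
  have "L2_tendsto W (\<lambda>x. G x + transpose (G x) + \<mu> *\<^sub>R (outer x (u x) + outer (u x) x))"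
    unfolding W_def
    by (intro L2_tendsto_add L2_tendsto_bounded_linear[OF _ bounded_linear_scaleR_right]
        L2_tendsto_bounded_linear[OF _ bounded_linear_transpose] L)
  from L2_tendsto_nn_integral[OF this S] have W0: "(\<lambda>k. \<integral>\<^sup>+x. ennreal ((norm (W k x))\<^sup>2) \<partial>lborel) \<longlonglongrightarrow> 0" .
  have "L2_tendsto (\<lambda>k x. \<phi> k x - u x) (\<lambda>x. 0)"
    using L(1) by (auto simp: L2_tendsto_def square_integrable_diff) (simp add: square_integrable_def)
  then have u0: "(\<lambda>k. \<integral>\<^sup>+x. ennreal ((norm (\<phi> k x - u x))\<^sup>2) \<partial>lborel) \<longlonglongrightarrow> 0"
    by (rule L2_tendsto_nn_integral) simp
  have "pair_defect (cball 0 R) w = 0" if R: "R \<ge> 0" for R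
  proof -
    let ?B = "cball (0 :: real^'n) R"
    define c1 where "c1 = 2 * (ennreal (2 ^ DIM(real^'n)) * emeasure lborel ?B * ennreal (4 * R ^ 4 * exp (\<mu> * R\<^sup>2)))"
    define c2 where "c2 = ennreal (32 * R\<^sup>2) * emeasure lborel ?B * ennreal (exp (\<mu> * R\<^sup>2))"
    \<comment> \<open>Finiteness is essential: in \<open>ennreal\<close> an infinite factor would
      destroy convergence of the products to zero.\<close>
    have c: "c1 < top" "c2 < top"
      unfolding c1_def c2_def using emeasure_lborel_cball_finite[of "0 :: real^'n" R]
      by (auto simp: ennreal_mult_less_top)
    have "pair_defect ?B w \<le> c1 * (\<integral>\<^sup>+x. ennreal ((norm (W k x))\<^sup>2) \<partial>lborel) + c2 * (\<integral>\<^sup>+x. ennreal ((norm (\<phi> k x - u x))\<^sup>2) \<partial>lborel)" for k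
    proof -
      have "(\<integral>\<^sup>+x. indicator ?B x * ennreal ((norm (w x - \<psi> k x))\<^sup>2) \<partial>lborel)
         \<le> (\<integral>\<^sup>+x. ennreal (exp (\<mu> * R\<^sup>2)) * ennreal ((norm (\<phi> k x - u x))\<^sup>2) \<partial>lborel)"
      proof (rule nn_integral_mono)
        fix x
        show "indicator ?B x * ennreal ((norm (w x - \<psi> k x))\<^sup>2) \<le> ennreal (exp (\<mu> * R\<^sup>2)) * ennreal ((norm (\<phi> k x - u x))\<^sup>2)"
        proof (cases "x \<in> ?B")
          case True
          then have "(norm x)\<^sup>2 \<le> R\<^sup>2" by (intro power_mono) auto
          then have "\<mu> * (norm x)\<^sup>2 \<le> \<mu> * R\<^sup>2" using \<mu> by (rule mult_left_mono)
          then have "exp (\<mu> * (norm x)\<^sup>2) * (norm (\<phi> k x - u x))\<^sup>2 \<le> exp (\<mu> * R\<^sup>2) * (norm (\<phi> k x - u x))\<^sup>2"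
            by (intro mult_right_mono) auto
          moreover have "(norm (w x - \<psi> k x))\<^sup>2 = exp (\<mu> * (norm x)\<^sup>2) * (norm (\<phi> k x - u x))\<^sup>2"
          proof -
            have "w x - \<psi> k x = exp (\<mu> / 2 * (norm x)\<^sup>2) *\<^sub>R (u x - \<phi> k x)"
              by (simp add: w_def \<psi>_def scaleR_diff_right)
            then show ?thesis
              by (simp add: power_mult_distrib exp_double[symmetric] norm_minus_commute)
          qed
          ultimately show ?thesis
            using True by (simp add: ennreal_mult[symmetric])
        qed simp
      qed
      then have e: "(\<integral>\<^sup>+x. indicator ?B x * ennreal ((norm (w x - \<psi> k x))\<^sup>2) \<partial>lborel)
         \<le> ennreal (exp (\<mu> * R\<^sup>2)) * (\<integral>\<^sup>+x. ennreal ((norm (\<phi> k x - u x))\<^sup>2) \<partial>lborel)"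
        by (simp add: nn_integral_cmult)
      have "pair_defect ?B w \<le> 2 * pair_defect ?B (\<psi> k)
          + ennreal (32 * R\<^sup>2) * emeasure lborel ?B * (\<integral>\<^sup>+x. indicator ?B x * ennreal ((norm (w x - \<psi> k x))\<^sup>2) \<partial>lborel)"
        by (rule pair_defect_cball_le) (use R wm \<psi>m in auto)
      also have "\<dots> \<le> 2 * (ennreal (2 ^ DIM(real^'n)) * emeasure lborel ?B * (ennreal (4 * R ^ 4 * exp (\<mu> * R\<^sup>2)) *
            (\<integral>\<^sup>+x. ennreal ((norm (W k x))\<^sup>2) \<partial>lborel)))
          + ennreal (32 * R\<^sup>2) * emeasure lborel ?B * (ennreal (exp (\<mu> * R\<^sup>2)) * (\<integral>\<^sup>+x. ennreal ((norm (\<phi> k x - u x))\<^sup>2) \<partial>lborel))"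
        unfolding W_def \<psi>_def
        by (intro add_mono mult_left_mono e[unfolded \<psi>_def] pair_defect_weighted_le[OF \<phi> R \<mu>] order_refl zero_le)
      finally show ?thesis unfolding c1_def c2_def by (simp only: mult.assoc)
    qed
    moreover have "(\<lambda>k. c1 * (\<integral>\<^sup>+x. ennreal ((norm (W k x))\<^sup>2) \<partial>lborel) + c2 * (\<integral>\<^sup>+x. ennreal ((norm (\<phi> k x - u x))\<^sup>2) \<partial>lborel)) \<longlonglongrightarrow> c1 * 0 + c2 * 0"
      by (intro tendsto_add ennreal_tendsto_cmult c W0 u0)
    ultimately have "pair_defect ?B w \<le> c1 * 0 + c2 * 0"
      by (intro LIMSEQ_le_const) auto
    then show ?thesis by simp
  qed
  \<comment> \<open>Integer radii exhaust the space and are countable, so the exceptional null sets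
    can be united, once for the outer and once for the inner variable.\<close>
  then have "AE x in lborel. AE y in lborel. x \<in> cball 0 (real n) \<longrightarrow> y \<in> cball 0 (real n) \<longrightarrow> (w x - w y) \<bullet> (x - y) = 0" for n
    by (intro pair_defect_eq_0D) auto
  then have "AE x in lborel. \<forall>n. AE y in lborel. x \<in> cball 0 (real n) \<longrightarrow> y \<in> cball 0 (real n) \<longrightarrow> (w x - w y) \<bullet> (x - y) = 0"
    by (simp add: AE_all_countable)
  then show ?thesis
  proof eventually_elim
    case (elim x)
    then have "AE y in lborel. \<forall>n. x \<in> cball 0 (real n) \<longrightarrow> y \<in> cball 0 (real n) \<longrightarrow> (w x - w y) \<bullet> (x - y) = 0"
      by (simp add: AE_all_countable)
    then show ?case
    proof eventually_elim
      case (elim y)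
      obtain n where "real n \<ge> max (norm x) (norm y)" using real_arch_simple by blast
      with elim show ?case by auto
    qed
  qed
qed

text \<open>Expanding the product and using tangency at both points leaves
  \<open>w x \<bullet> y = - (w y \<bullet> x)\<close>. For fixed \<open>y\<close> the right-hand
  side is linear in \<open>x\<close>; letting \<open>y\<close> run through a basis of good points
  determines \<open>w x\<close> completely as a linear function of \<open>x\<close>.\<close>

lemma pair_AE_imp_linear:
  fixes w :: "real^'n \<Rightarrow> real^'n"
  assumes tang: "AE x in lborel. x \<bullet> w x = 0"
    and pair: "AE x in lborel. AE y in lborel. (w x - w y) \<bullet> (x - y) = 0"
  obtains C where "transpose C = - C" "AE x in lborel. w x = C *v x"
proof -
  define Y where "Y = {y. AE x in lborel. w x \<bullet> y = - (w y \<bullet> x)}"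
  have "AE y in lborel. y \<in> Y"
    using pair tang
  proof eventually_elim
    case (elim y)
    from elim(1) tang have "AE x in lborel. w x \<bullet> y = - (w y \<bullet> x)"
    proof eventually_elim
      case (elim x)
      then show ?case using \<open>y \<bullet> w y = 0\<close>
        by (simp add: inner_diff_left inner_diff_right inner_commute)
    qed
    then show ?case by (simp add: Y_def)
  qed
  then have "span Y = UNIV" by (rule AE_imp_span_UNIV)
  moreover obtain B where B: "B \<subseteq> Y" "independent B" "Y \<subseteq> span B"
    using maximal_independent_subset by blast
  ultimately have sB: "span B = UNIV"
    by (metis span_mono span_span top.extremum_uniqueI)
  have fB: "finite B" using B(2) by (rule independent_imp_finite)
  have "\<exists>a. axis k (1 :: real) = (\<Sum>b\<in>B. a b *\<^sub>R b)" for k :: 'n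
  proof -
    have "axis k (1 :: real) \<in> span B" using sB by simp
    then show ?thesis unfolding span_finite[OF fB] by auto
  qed
  then obtain a where a: "\<And>k :: 'n. axis k (1 :: real) = (\<Sum>b\<in>B. a k b *\<^sub>R b)" by metis
  \<comment> \<open>Row \<open>k\<close> is read off by expanding the unit vector
    \<open>axis k 1\<close> in the basis \<open>B\<close> and replacing each
    \<open>w x \<bullet> b\<close> by \<open>- (w b \<bullet> x)\<close>.\<close>
  define C :: "real^'n^'n" where "C = (\<chi> k. - (\<Sum>b\<in>B. a k b *\<^sub>R w b))"
  have "AE x in lborel. \<forall>b\<in>B. w x \<bullet> b = - (w b \<bullet> x)"
    using B(1) fB by (subst AE_finite_all) (auto simp: Y_def)
  then have wC: "AE x in lborel. w x = C *v x"
  proof eventually_elim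
    case (elim x)
    have "w x $ k = (C *v x) $ k" for k
    proof -
      have "w x $ k = w x \<bullet> axis k 1" by (simp add: inner_axis)
      also have "\<dots> = (\<Sum>b\<in>B. a k b * (w x \<bullet> b))" by (simp add: a inner_sum_right)
      also have "\<dots> = (\<Sum>b\<in>B. - (a k b * (w b \<bullet> x)))" using elim by (intro sum.cong) auto
      also have "\<dots> = (C *v x) $ k"
        by (simp add: matrix_vector_mul_component C_def inner_sum_left sum_negf)
      finally show ?thesis .
    qed
    then show ?case by (simp add: vec_eq_iff)
  qed
  have "AE x in lborel. x \<bullet> (C *v x) = 0"
    using tang wC by eventually_elim simp
  then have q: "x \<bullet> (C *v x) = 0" for x
    by (rule continuous_AE_zero[rotated])
       (intro continuous_intros linear_continuous_on matrix_vector_mul_bounded_linear)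
  \<comment> \<open>Polarization of the quadratic form, which vanishes everywhere by
    continuity.\<close>
  have "C $ i $ j + C $ j $ i = 0" for i j
    using q[of "axis i 1 + axis j 1"] q[of "axis i 1"] q[of "axis j 1"]
    by (simp add: matrix_vector_right_distrib inner_add_left inner_add_right inner_axis' matrix_vector_mul_component inner_axis)
  then have "transpose C = - C"
    by (simp add: vec_eq_iff eq_neg_iff_add_eq_0)
  then show ?thesis using wC by (rule that)
qed

lemma toroidal_rigidity:
  fixes u :: "real^'n \<Rightarrow> real^'n"
  assumes D: "D_field u G" and tor: "toroidal u G" and L: "L2_sq u \<noteq> 0"
    and eq: "grad_sq G * weighted_sq u = (real CARD('n) + 2)\<^sup>2 / 4 * (L2_sq u)\<^sup>2"
  shows "\<exists>C c. c > 0 \<and> transpose C = - C \<and> C \<noteq> 0 \<and> (AE x in lborel. u x = extremal_field C c x)"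
proof -
  obtain \<mu> where \<mu>: "\<mu> > 0"
    and S: "AE x in lborel. G x + transpose (G x) + \<mu> *\<^sub>R (outer x (u x) + outer (u x) x) = 0"
    using toroidal_equality_AE[OF D tor L eq] by blast
  define w where "w = (\<lambda>x. exp (\<mu> / 2 * (norm x)\<^sup>2) *\<^sub>R u x)"
  have "AE x in lborel. x \<bullet> w x = 0"
    using conjunct1[OF tor[unfolded toroidal_def]] by eventually_elim (auto simp: w_def)
  moreover have "AE x in lborel. AE y in lborel. (w x - w y) \<bullet> (x - y) = 0"
    unfolding w_def using \<mu> by (intro weighted_field_pair_AE[OF D _ S]) simp
  ultimately obtain C where C: "transpose C = - C" "AE x in lborel. w x = C *v x"
    using pair_AE_imp_linear by blast
  have u: "AE x in lborel. u x = extremal_field C (\<mu> / 2) x"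
    using C(2)
  proof eventually_elim
    case (elim x)
    have "u x = exp (- (\<mu> / 2) * (norm x)\<^sup>2) *\<^sub>R w x"
      by (simp add: w_def exp_minus)
    with elim show ?case by (simp add: extremal_field_def)
  qed
  have "C \<noteq> 0"
  proof
    assume "C = 0"
    with u have "AE x in lborel. (norm (u x))\<^sup>2 = 0"
      by (auto simp: extremal_field_def)
    then have "L2_sq u = 0" unfolding L2_sq_def by (rule integral_eq_zero_AE)
    with L show False by simp
  qed
  with C(1) u \<mu> show ?thesis by (intro exI[of _ C] exI[of _ "\<mu> / 2"]) simp
qed

section \<open>Gaussian extremals belong to the space\<close>

definition flat :: "nat \<Rightarrow> real \<Rightarrow> real" where
  "flat n t = (if t > 0 then exp (- inverse t) * inverse t ^ n else 0)"

lemma flat_tendsto_0: "(flat n \<longlongrightarrow> 0) (at 0)"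
proof (rule filterlim_split_at)
  have "eventually (\<lambda>t::real. flat n t = 0) (at_left 0)"
    by (auto simp: flat_def eventually_at_filter)
  then show "(flat n \<longlongrightarrow> 0) (at_left 0)" by (rule tendsto_eventually)
  have "((\<lambda>t::real. inverse t ^ n / exp (inverse t)) \<longlongrightarrow> 0) (at_right 0)"
    by (rule filterlim_compose[OF tendsto_power_div_exp_0 filterlim_inverse_at_top_right])
  moreover have "eventually (\<lambda>t. inverse t ^ n / exp (inverse t) = flat n t) (at_right 0)"
    by (auto simp: flat_def eventually_at_filter exp_minus field_simps)
  ultimately show "(flat n \<longlongrightarrow> 0) (at_right 0)" by (rule Lim_transform_eventually)
qed

text \<open>The powers of 1/t are included in the family so that it is closed under differentiation
  up to linear combinations; \<open>flat 0\<close> is the classical function that vanishes to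
  infinite order at 0.\<close>

lemma flat_has_derivative:
  "(flat n has_real_derivative (flat (n + 2) t - real n * flat (n + 1) t)) (at t)"
proof -
  consider "t > 0" | "t < 0" | "t = 0" by linarith
  then show ?thesis
  proof cases
    case 1
    have "((\<lambda>t. exp (- inverse t) * inverse t ^ n) has_real_derivative
        exp (- inverse t) * inverse t ^ (n + 2) - real n * (exp (- inverse t) * inverse t ^ (n + 1))) (at t)"
      using 1 by (auto intro!: derivative_eq_intros simp: field_simps power2_eq_square split: nat.splits)
        (cases n; simp add: field_simps)
    then have "(flat n has_real_derivative
        exp (- inverse t) * inverse t ^ (n + 2) - real n * (exp (- inverse t) * inverse t ^ (n + 1))) (at t)"
      by (rule has_field_derivative_transform_within_open[where S="{0<..}"]) (use 1 in \<open>auto simp: flat_def\<close>)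
    then show ?thesis using 1 by (simp add: flat_def)
  next
    case 2
    have "(flat n has_real_derivative 0) (at t)"
      by (rule has_field_derivative_transform_within_open[where S="{..<0}" and f="\<lambda>_. 0"]) (use 2 in \<open>auto simp: flat_def\<close>)
    then show ?thesis using 2 by (simp add: flat_def)
  next
    case 3
    \<comment> \<open>At the origin the difference quotient of one member is exactly the next
      member, so differentiability reduces to its limit being 0.\<close>
    have "eventually (\<lambda>h. flat (n + 1) h = (flat n (0 + h) - flat n 0) / h) (at 0)"
      by (auto simp: flat_def eventually_at_filter field_simps)
    then have "((\<lambda>h. (flat n (0 + h) - flat n 0) / h) \<longlongrightarrow> 0) (at 0)"
      by (rule Lim_transform_eventually[OF flat_tendsto_0])
    then show ?thesis using 3 by (simp add: DERIV_def flat_def)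
  qed
qed

text \<open>The class is closed under partial derivatives, hence consists of smooth functions.\<close>

inductive smooth_scalar :: "(real^'n \<Rightarrow> real) \<Rightarrow> bool" where
  const: "smooth_scalar (\<lambda>x. c)"
| coord: "smooth_scalar (\<lambda>x. x $ j)"
| gauss: "smooth_scalar (\<lambda>x. exp (- c * (norm x)\<^sup>2))"
| flat: "smooth_scalar (\<lambda>x. flat n (1 - b * (norm x)\<^sup>2))"
| add: "smooth_scalar f \<Longrightarrow> smooth_scalar g \<Longrightarrow> smooth_scalar (\<lambda>x. f x + g x)"
| mult: "smooth_scalar f \<Longrightarrow> smooth_scalar g \<Longrightarrow> smooth_scalar (\<lambda>x. f x * g x)"

lemma smooth_scalar_sum:
  "finite I \<Longrightarrow> (\<And>i. i \<in> I \<Longrightarrow> smooth_scalar (f i)) \<Longrightarrow> smooth_scalar (\<lambda>x. \<Sum>i\<in>I. f i x)"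
  by (induction I rule: finite_induct) (auto intro: smooth_scalar.intros)

lemma norm_squared_has_derivative:
  "((\<lambda>x :: 'a::real_inner. (norm x)\<^sup>2) has_derivative (\<lambda>h. 2 * (x \<bullet> h))) (at x)"
  unfolding power2_norm_eq_inner by (auto intro!: derivative_eq_intros simp: inner_commute)

lemma norm_squared_compose_has_derivative:
  fixes p :: "real \<Rightarrow> real"
  assumes p: "\<And>t. (p has_real_derivative p' t) (at t)"
  shows "((\<lambda>x :: 'a::real_inner. p (a + b * (norm x)\<^sup>2)) has_derivative
    (\<lambda>h. p' (a + b * (norm x)\<^sup>2) * (b * (2 * (x \<bullet> h))))) (at x)"
proof -
  have "((\<lambda>x :: 'a. a + b * (norm x)\<^sup>2) has_derivative (\<lambda>h. b * (2 * (x \<bullet> h)))) (at x)"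
    by (auto intro!: derivative_eq_intros norm_squared_has_derivative)
  from has_derivative_compose[OF this p[unfolded has_field_derivative_def]] show ?thesis .
qed

lemma smooth_scalar_derivative:
  assumes "smooth_scalar f"
  shows "\<exists>F. (\<forall>x. (f has_derivative F x) (at x)) \<and> (\<forall>b. smooth_scalar (\<lambda>x. F x b))"
  using assms
proof induction
  case (const c)
  show ?case by (intro exI[of _ "\<lambda>x h. 0"]) (auto intro: smooth_scalar.const)
next
  case (coord j)
  have "((\<lambda>x. x $ j) has_derivative (\<lambda>h. h $ j)) (at x)" for x :: "real^'a"
    by (rule bounded_linear_imp_has_derivative[OF bounded_linear_vec_nth])
  then show ?case by (intro exI[of _ "\<lambda>x h. h $ j"]) (auto intro: smooth_scalar.const)
next
  case (gauss c)
  let ?F = "\<lambda>x h :: real^'a. exp (- c * (norm x)\<^sup>2) * (- c * (2 * (x \<bullet> h)))"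
  have "((\<lambda>x :: real^'a. exp (- c * (norm x)\<^sup>2)) has_derivative ?F x) (at x)" for x
    using norm_squared_compose_has_derivative[of exp exp 0 "- c" x] by (simp add: DERIV_exp)
  moreover have "smooth_scalar (\<lambda>x. ?F x h)" for h
    unfolding inner_vec_def inner_real_def
    by (intro smooth_scalar.intros(3-6) smooth_scalar_sum smooth_scalar.const smooth_scalar.coord finite)
  ultimately show ?case by (intro exI[of _ ?F]) simp
next
  case (flat n b)
  let ?F = "\<lambda>x h :: real^'a. (flat (n + 2) (1 - b * (norm x)\<^sup>2) + (- real n) * flat (n + 1) (1 - b * (norm x)\<^sup>2)) * (- b * (2 * (x \<bullet> h)))"
  have "((\<lambda>x :: real^'a. flat n (1 - b * (norm x)\<^sup>2)) has_derivative ?F x) (at x)" for x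
    using norm_squared_compose_has_derivative[OF flat_has_derivative, of n 1 "- b" x] by simp
  moreover have "smooth_scalar (\<lambda>x. ?F x h)" for h
    unfolding inner_vec_def inner_real_def
    by (intro smooth_scalar.intros(4-6) smooth_scalar_sum smooth_scalar.const smooth_scalar.coord finite)
  ultimately show ?case by (intro exI[of _ ?F] conjI allI)
next
  case (add f g)
  then obtain F G where "\<And>x. (f has_derivative F x) (at x)" "\<And>b. smooth_scalar (\<lambda>x. F x b)"
    "\<And>x. (g has_derivative G x) (at x)" "\<And>b. smooth_scalar (\<lambda>x. G x b)" by blast
  then show ?case
    by (intro exI[of _ "\<lambda>x h. F x h + G x h"] conjI allI has_derivative_add smooth_scalar.add)
next
  case (mult f g)
  then obtain F G where "\<And>x. (f has_derivative F x) (at x)" "\<And>b. smooth_scalar (\<lambda>x. F x b)"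
    "\<And>x. (g has_derivative G x) (at x)" "\<And>b. smooth_scalar (\<lambda>x. G x b)" by blast
  with mult.hyps show ?case
    by (intro exI[of _ "\<lambda>x h. f x * G x h + F x h * g x"] conjI allI has_derivative_mult
        smooth_scalar.add smooth_scalar.mult)
qed

text \<open>The induction generalizes over \<open>f\<close>, since the hypothesis is applied to the
  directional derivatives of \<open>f\<close>, whose components again lie in the class.\<close>

lemma Ck_field_smooth_scalar:
  fixes f :: "real^'n \<Rightarrow> real^'m"
  assumes "\<And>j. smooth_scalar (\<lambda>x. f x $ j)"
  shows "Ck_field k f"
  using assms
proof (induction k arbitrary: f)
  case (0 f)
  have "continuous_on UNIV (\<lambda>x. f x $ j)" for j
    using smooth_scalar_derivative[OF 0[of j]] has_derivative_continuous continuous_at_imp_continuous_on by metis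
  then have "continuous_on UNIV (\<lambda>x. \<chi> j. f x $ j)" by (rule continuous_on_vec_lambda)
  then show ?case by (simp add: eta_contract_eq)
next
  case (Suc k f)
  have "\<forall>j. \<exists>F. (\<forall>x. ((\<lambda>x. f x $ j) has_derivative F x) (at x)) \<and> (\<forall>b. smooth_scalar (\<lambda>x. F x b))"
    using smooth_scalar_derivative Suc.prems by blast
  then obtain F where F: "\<And>j x. ((\<lambda>x. f x $ j) has_derivative F j x) (at x)" "\<And>j b. smooth_scalar (\<lambda>x. F j x b)"
    by metis
  have D: "(f has_derivative (\<lambda>h. \<chi> j. F j x h)) (at x)" for x
    by (subst has_derivative_componentwise_within) (auto simp: Basis_vec_def inner_axis F)
  then have fd: "frechet_derivative f (at x) = (\<lambda>h. \<chi> j. F j x h)" for x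
    by (metis frechet_derivative_at)
  have "f differentiable_on UNIV"
    using D by (auto simp: differentiable_on_def differentiable_def)
  moreover have "Ck_field k (\<lambda>x. frechet_derivative f (at x) i)" for i
    unfolding fd by (rule Suc.IH) (simp add: F(2))
  ultimately show ?case by simp
qed

section \<open>Bounds for the cutoff profile and Gaussian majorants\<close>

lemma flat_0_le: "t \<le> 1 \<Longrightarrow> flat 0 t \<le> exp (- 1)"
  by (auto simp: flat_def one_le_inverse)

lemma flat_nonneg: "0 \<le> flat n t"
  by (auto simp: flat_def)

text \<open>With y = 1/t this is y^2 / 2 \<le> exp y. Because \<open>flat 2\<close> is the
  derivative of \<open>flat 0\<close>, it bounds the gradient of the cutoff functions
  uniformly.\<close>

lemma flat_2_le: "flat 2 t \<le> 2"
proof (cases "t > 0")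
  case True
  define y where "y = inverse t"
  have "y > 0" using True by (simp add: y_def)
  then have "y\<^sup>2 / 2 \<le> exp y" using exp_lower_Taylor_quadratic[of y] by simp
  then have "exp (- y) * y\<^sup>2 \<le> 2"
    by (simp add: exp_minus field_simps)
  then show ?thesis using True by (simp add: flat_def y_def)
qed (simp add: flat_def)

lemma flat_support: "t \<le> 0 \<Longrightarrow> flat n t = 0"
  by (simp add: flat_def)

text \<open>The Gaussian is a product of one-dimensional ones over the coordinates, and each of
  these is a multiple of a normal density.\<close>

lemma integrable_gaussian:
  assumes c: "c > 0"
  shows "integrable lborel (\<lambda>x :: 'a::euclidean_space. exp (- c * (norm x)\<^sup>2))"
proof (rule integrableI_bounded)
  show "(\<lambda>x :: 'a. exp (- c * (norm x)\<^sup>2)) \<in> borel_measurable lborel" by measurable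
  \<comment> \<open>The standard deviation for which the density has exponent
    \<open>- c * x\<^sup>2\<close>; integrability is taken from its moment of order 0.\<close>
  define \<sigma> where "\<sigma> = 1 / sqrt (2 * c)"
  have \<sigma>: "\<sigma> > 0" "2 * \<sigma>\<^sup>2 = 1 / c" using c by (auto simp: \<sigma>_def power_divide)
  have "integrable lborel (\<lambda>x. sqrt (2 * pi * \<sigma>\<^sup>2) * (normal_density 0 \<sigma> x * (x - 0) ^ 0))"
    by (intro integrable_mult_right integrable_normal_moment \<sigma>)
  moreover have e: "sqrt (2 * pi * \<sigma>\<^sup>2) * (normal_density 0 \<sigma> x * (x - 0) ^ 0) = exp (- c * x\<^sup>2)" for x
    unfolding normal_density_def \<sigma>(2) using \<sigma> by (simp add: mult.commute)
  ultimately have "integrable lborel (\<lambda>x. exp (- c * x\<^sup>2))" unfolding e by simp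
  then have 1: "(\<integral>\<^sup>+x. ennreal (exp (- c * x\<^sup>2)) \<partial>lborel) < \<infinity>"
    by (simp add: integrable_iff_bounded)
  have "(\<integral>\<^sup>+(x :: 'a). ennreal (norm (exp (- c * (norm x)\<^sup>2))) \<partial>lborel)
     = (\<integral>\<^sup>+(x :: 'a). (\<Prod>b\<in>Basis. ennreal (exp (- c * (x \<bullet> b)\<^sup>2))) \<partial>lborel)"
  proof (rule nn_integral_cong)
    fix x :: 'a
    have "(norm x)\<^sup>2 = (\<Sum>b\<in>Basis. (x \<bullet> b)\<^sup>2)"
      unfolding power2_norm_eq_inner by (subst euclidean_inner) (simp add: power2_eq_square)
    then have "exp (- c * (norm x)\<^sup>2) = (\<Prod>b\<in>Basis. exp (- c * (x \<bullet> b)\<^sup>2))"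
      by (simp add: exp_sum[symmetric] sum_distrib_left sum_negf)
    then show "ennreal (norm (exp (- c * (norm x)\<^sup>2))) = (\<Prod>b\<in>Basis. ennreal (exp (- c * (x \<bullet> b)\<^sup>2)))"
      by (simp add: prod_ennreal abs_prod)
  qed
  also have "\<dots> = (\<Prod>b\<in>(Basis :: 'a set). (\<integral>\<^sup>+x. ennreal (exp (- c * x\<^sup>2)) \<partial>lborel))"
    by (rule nn_integral_lborel_prod) auto
  also have "\<dots> < \<infinity>" using 1 by (simp add: power_less_top_ennreal)
  finally show "(\<integral>\<^sup>+(x :: 'a). ennreal (norm (exp (- c * (norm x)\<^sup>2))) \<partial>lborel) < \<infinity>" .
qed

text \<open>Half of the exponential decay absorbs the fourth power, by s^2 \<le> (2/c^2) exp(cs)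
  with s = |x|^2. Up to a constant this function dominates the three densities of an extremal field:
  the field, its weighted version and its Jacobian.\<close>

lemma integrable_quartic_gaussian:
  assumes c: "c > 0"
  shows "integrable lborel (\<lambda>x :: 'a::euclidean_space. (1 + (norm x) ^ 4) * exp (- 2 * c * (norm x)\<^sup>2))"
proof (rule Bochner_Integration.integrable_bound)
  show "integrable lborel (\<lambda>x :: 'a. (1 + 2 / c\<^sup>2) * exp (- c * (norm x)\<^sup>2))"
    by (intro integrable_mult_right integrable_gaussian c)
  show "AE x in lborel. norm ((1 + (norm (x :: 'a)) ^ 4) * exp (- 2 * c * (norm x)\<^sup>2)) \<le> norm ((1 + 2 / c\<^sup>2) * exp (- c * (norm x)\<^sup>2))"
  proof (rule AE_I2)
    fix x :: 'a
    define s where "s = (norm x)\<^sup>2"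
    have s: "s \<ge> 0" "norm x ^ 4 = s\<^sup>2" by (auto simp: s_def)
    have "1 + (c * s)\<^sup>2 / 2 \<le> exp (c * s)"
      using exp_lower_Taylor_quadratic[of "c * s"] c s by (auto intro: order_trans[rotated])
    then have "1 \<le> exp (c * s)" "(c * s)\<^sup>2 / 2 \<le> exp (c * s)"
      using c s by (auto intro: order_trans[rotated])
    then have "1 + s\<^sup>2 \<le> exp (c * s) + 2 / c\<^sup>2 * exp (c * s)"
      using c by (intro add_mono) (auto simp: field_simps power2_eq_square)
    then have "(1 + s\<^sup>2) * exp (- 2 * (c * s)) \<le> ((1 + 2 / c\<^sup>2) * exp (c * s)) * exp (- 2 * (c * s))"
      by (intro mult_right_mono) (auto simp: algebra_simps)
    also have "\<dots> = (1 + 2 / c\<^sup>2) * exp (- c * s)"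
      by (simp add: mult.assoc exp_add[symmetric])
    finally show "norm ((1 + (norm x) ^ 4) * exp (- 2 * c * (norm x)\<^sup>2)) \<le> norm ((1 + 2 / c\<^sup>2) * exp (- c * (norm x)\<^sup>2))"
      by (simp add: s_def abs_mult mult.assoc)
  qed
qed measurable

lemma nn_integral_dominated_tendsto_0:
  fixes f :: "nat \<Rightarrow> 'a \<Rightarrow> real"
  assumes m: "\<And>k. f k \<in> borel_measurable M" and w: "integrable M w"
    and b: "\<And>k x. 0 \<le> f k x" "\<And>k x. f k x \<le> w x" and l: "\<And>x. (\<lambda>k. f k x) \<longlonglongrightarrow> 0"
  shows "(\<lambda>k. \<integral>\<^sup>+x. ennreal (f k x) \<partial>M) \<longlonglongrightarrow> 0"
proof -
  have d: "AE x in M. norm (f k x) \<le> w x" for k using b by auto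
  have lm: "AE x in M. (\<lambda>k. f k x) \<longlonglongrightarrow> 0" using l by simp
  have "integrable M (f k)" for k
  proof (rule Bochner_Integration.integrable_bound[OF w m], rule AE_I2)
    show "norm (f k x) \<le> norm (w x)" for x using b[of k x] by simp
  qed
  then have "(\<integral>\<^sup>+x. ennreal (f k x) \<partial>M) = ennreal (\<integral>x. f k x \<partial>M)" for k
    using b by (intro nn_integral_eq_integral) auto
  moreover have "(\<lambda>k. \<integral>x. f k x \<partial>M) \<longlonglongrightarrow> (\<integral>x. 0 \<partial>M)"
    by (rule integral_dominated_convergence[OF _ m w lm d]) simp
  ultimately show ?thesis
    using b by (simp add: ennreal_tendsto_0_iff)
qed

section \<open>Approximation of Gaussian fields by compactly supported ones\<close>

definition extremal_jac :: "real^'n^'n \<Rightarrow> real \<Rightarrow> real^'n \<Rightarrow> real^'n^'n" where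
  "extremal_jac C c x = exp (- c * (norm x)\<^sup>2) *\<^sub>R (C - (2 * c) *\<^sub>R outer (C *v x) x)"

lemma outer_mult_vec: "outer p q *v h = (q \<bullet> h) *\<^sub>R p"
  by (simp add: vec_eq_iff matrix_vector_mult_def inner_vec_def sum_distrib_left sum_distrib_right ac_simps)

lemma scaleR_matrix_vector: "(a *\<^sub>R M) *v h = a *\<^sub>R (M *v (h :: real^'n))"
  by (simp add: vec_eq_iff matrix_vector_mult_def sum_distrib_left ac_simps)

lemma jac_eqI:
  assumes "(\<phi> has_derivative (\<lambda>h. M *v h)) (at x)"
  shows "jac \<phi> x = M"
  unfolding jac_def frechet_derivative_at[OF assms, symmetric] by simp

lemma extremal_field_has_derivative:
  "(extremal_field C c has_derivative (\<lambda>h. extremal_jac C c x *v h)) (at x)"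
proof -
  have 1: "((\<lambda>x. exp (- c * (norm x)\<^sup>2)) has_derivative (\<lambda>h. exp (- c * (norm x)\<^sup>2) * (- c * (2 * (x \<bullet> h))))) (at x)"
    using norm_squared_compose_has_derivative[of exp exp 0 "- c" x] by (simp add: DERIV_exp)
  have 2: "((\<lambda>x. C *v x) has_derivative (\<lambda>h. C *v h)) (at x)"
    by (intro bounded_linear_imp_has_derivative matrix_vector_mul_bounded_linear)
  have "(\<lambda>h. exp (- c * (norm x)\<^sup>2) *\<^sub>R (C *v h) + (exp (- c * (norm x)\<^sup>2) * (- c * (2 * (x \<bullet> h)))) *\<^sub>R (C *v x)) = (\<lambda>h. extremal_jac C c x *v h)"
    by (auto simp: fun_eq_iff extremal_jac_def scaleR_matrix_vector matrix_vector_mult_diff_rdistrib outer_mult_vec algebra_simps)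
  with has_derivative_scaleR[OF 1 2] show ?thesis
    unfolding extremal_field_def[abs_def] by simp
qed

text \<open>The factor \<open>exp 1\<close> normalises the value at the origin to 1; the cutoff tends to 1
  pointwise but is not constant near the origin.\<close>

definition cutoff :: "nat \<Rightarrow> real^'n \<Rightarrow> real" where
  "cutoff k x = exp 1 * flat 0 (1 - 1 / (real (Suc k))\<^sup>2 * (norm x)\<^sup>2)"

definition cutoff_grad :: "nat \<Rightarrow> real^'n \<Rightarrow> real^'n" where
  "cutoff_grad k x = (- 2 * exp 1 * flat 2 (1 - 1 / (real (Suc k))\<^sup>2 * (norm x)\<^sup>2) / (real (Suc k))\<^sup>2) *\<^sub>R x"

lemma cutoff_has_derivative:
  fixes x :: "real^'n"
  shows "(cutoff k has_derivative (\<lambda>h. cutoff_grad k x \<bullet> h)) (at x)"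
proof -
  have "(flat 0 has_real_derivative flat 2 t) (at t)" for t
    using flat_has_derivative[of 0 t] by (simp add: numeral_2_eq_2)
  from norm_squared_compose_has_derivative[OF this, of 1 "- (1 / (real (Suc k))\<^sup>2)" x]
  have "((\<lambda>x :: real^'n. flat 0 (1 - 1 / (real (Suc k))\<^sup>2 * (norm x)\<^sup>2)) has_derivative
     (\<lambda>h. flat 2 (1 - 1 / (real (Suc k))\<^sup>2 * (norm x)\<^sup>2) * (- (1 / (real (Suc k))\<^sup>2) * (2 * (x \<bullet> h))))) (at x)"
    by simp
  from has_derivative_mult_right[OF this, of "exp 1"]
  show ?thesis
    unfolding cutoff_def[abs_def] cutoff_grad_def by (simp add: algebra_simps)
qed

lemma cutoff_bounds: "0 \<le> cutoff k x" "cutoff k x \<le> 1"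
proof -
  show "0 \<le> cutoff k x" by (simp add: cutoff_def flat_nonneg)
  have "cutoff k x \<le> exp 1 * exp (- 1)"
    unfolding cutoff_def by (intro mult_left_mono flat_0_le) auto
  then show "cutoff k x \<le> 1" by (simp add: exp_add[symmetric])
qed

lemma inverse_square_Suc_tendsto: "(\<lambda>k. a / (real (Suc k))\<^sup>2) \<longlonglongrightarrow> 0"
proof -
  have "(\<lambda>k. a * (inverse (real (Suc k)))\<^sup>2) \<longlonglongrightarrow> a * 0\<^sup>2"
    by (intro tendsto_intros LIMSEQ_inverse_real_of_nat)
  then show ?thesis by (simp add: power_inverse divide_inverse)
qed

lemma cutoff_tendsto: "(\<lambda>k. cutoff k x) \<longlonglongrightarrow> 1"
proof -
  have "(\<lambda>k. 1 - 1 / (real (Suc k))\<^sup>2 * (norm x)\<^sup>2) \<longlonglongrightarrow> 1 - 0 * (norm x)\<^sup>2"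
    by (intro tendsto_intros inverse_square_Suc_tendsto)
  moreover have "isCont (flat 0) 1" using flat_has_derivative by (rule DERIV_isCont)
  ultimately have "(\<lambda>k. flat 0 (1 - 1 / (real (Suc k))\<^sup>2 * (norm x)\<^sup>2)) \<longlonglongrightarrow> flat 0 1"
    by (intro isCont_tendsto_compose[of 1 "flat 0"]) auto
  then have "(\<lambda>k. cutoff k x) \<longlonglongrightarrow> exp 1 * flat 0 1"
    unfolding cutoff_def by (intro tendsto_intros)
  then show ?thesis by (simp add: flat_def exp_add[symmetric])
qed

lemma cutoff_grad_le: "norm (cutoff_grad k x) \<le> 12 / (real (Suc k))\<^sup>2 * norm x"
proof -
  \<comment> \<open>The constant 12 is 2 * 3 * 2, from \<open>exp 1 \<le> 3\<close> and
    \<open>flat 2 t \<le> 2\<close>.\<close>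
  have "2 * exp 1 * flat 2 t \<le> 12" "0 \<le> 2 * exp 1 * flat 2 t" for t
    using mult_mono[OF exp_le flat_2_le[of t]] by (auto simp: flat_nonneg)
  then show ?thesis
    unfolding cutoff_grad_def norm_scaleR
    by (intro mult_right_mono) (auto simp: abs_mult abs_divide flat_nonneg intro!: divide_right_mono)
qed

text \<open>The form independent of \<open>k\<close> provides domination; the sharper bound with the
  decaying factor provides pointwise convergence to zero.\<close>

lemma cutoff_grad_le_uniform: "norm (cutoff_grad k x) \<le> 12 * norm x"
proof -
  have "1 \<le> (real (Suc k))\<^sup>2" by (intro one_le_power) simp
  then have "12 / (real (Suc k))\<^sup>2 \<le> 12" by (simp add: field_simps)
  then show ?thesis by (intro order_trans[OF cutoff_grad_le] mult_right_mono) auto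
qed

lemma cutoff_grad_tendsto: "(\<lambda>k. cutoff_grad k x) \<longlonglongrightarrow> 0"
proof (rule Lim_null_comparison)
  show "eventually (\<lambda>k. norm (cutoff_grad k x) \<le> 12 / (real (Suc k))\<^sup>2 * norm x) sequentially"
    using cutoff_grad_le by (intro always_eventually) blast
  have "(\<lambda>k. 12 / (real (Suc k))\<^sup>2 * norm x) \<longlonglongrightarrow> 0 * norm x"
    by (intro tendsto_intros inverse_square_Suc_tendsto)
  then show "(\<lambda>k. 12 / (real (Suc k))\<^sup>2 * norm x) \<longlonglongrightarrow> 0" by simp
qed

lemma cutoff_support: "norm x > real (Suc k) \<Longrightarrow> cutoff k x = 0"
proof -
  assume "norm x > real (Suc k)"
  then have "(real (Suc k))\<^sup>2 \<le> (norm x)\<^sup>2" by (intro power_mono) auto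
  then have "1 - 1 / (real (Suc k))\<^sup>2 * (norm x)\<^sup>2 \<le> 0" by (simp add: field_simps)
  then show ?thesis by (simp add: cutoff_def flat_support)
qed

definition cutoff_extremal :: "real^'n^'n \<Rightarrow> real \<Rightarrow> nat \<Rightarrow> real^'n \<Rightarrow> real^'n" where
  "cutoff_extremal C c k x = cutoff k x *\<^sub>R extremal_field C c x"

lemma Cc_inf_field_cutoff_extremal: "Cc_inf_field (cutoff_extremal C c k)"
proof -
  have "smooth_scalar (\<lambda>x. cutoff_extremal C c k x $ j)" for j
    unfolding cutoff_extremal_def cutoff_def extremal_field_def vector_scaleR_component matrix_vector_mult_def vec_lambda_beta
    by (simp only: real_scaleR_def, intro smooth_scalar.mult smooth_scalar_sum smooth_scalar.const smooth_scalar.coord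
        smooth_scalar.flat smooth_scalar.gauss finite)
  then have "smooth_field (cutoff_extremal C c k)"
    unfolding smooth_field_def by (auto intro: Ck_field_smooth_scalar)
  moreover have "norm x > real (Suc k) \<Longrightarrow> cutoff_extremal C c k x = 0" for x
    by (simp add: cutoff_extremal_def cutoff_support)
  ultimately show ?thesis unfolding Cc_inf_field_def by blast
qed

lemma jac_cutoff_extremal:
  fixes C :: "real^'n^'n"
  shows "jac (cutoff_extremal C c k) x = cutoff k x *\<^sub>R extremal_jac C c x + outer (extremal_field C c x) (cutoff_grad k x)"
proof (rule jac_eqI)
  have "(\<lambda>h :: real^'n. cutoff k x *\<^sub>R (extremal_jac C c x *v h) + (cutoff_grad k x \<bullet> h) *\<^sub>R extremal_field C c x)
    = (\<lambda>h. (cutoff k x *\<^sub>R extremal_jac C c x + outer (extremal_field C c x) (cutoff_grad k x)) *v h)"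
    by (simp add: fun_eq_iff matrix_vector_mult_add_rdistrib scaleR_matrix_vector outer_mult_vec)
  moreover have "((\<lambda>x. cutoff k x *\<^sub>R extremal_field C c x) has_derivative
      (\<lambda>h. cutoff k x *\<^sub>R (extremal_jac C c x *v h) + (cutoff_grad k x \<bullet> h) *\<^sub>R extremal_field C c x)) (at x)"
    by (rule has_derivative_scaleR[OF cutoff_has_derivative extremal_field_has_derivative])
  ultimately show "(cutoff_extremal C c k has_derivative
    (\<lambda>h. (cutoff k x *\<^sub>R extremal_jac C c x + outer (extremal_field C c x) (cutoff_grad k x)) *v h)) (at x)"
    unfolding cutoff_extremal_def[abs_def] by simp
qed

text \<open>All three densities are polynomials of degree at most 4 in |x| times the squared
  Gaussian, so \<open>norm x ^ 4\<close> and the estimate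
  \<open>(norm x)\<^sup>2 \<le> 1 + norm x ^ 4\<close> suffice for one common majorant.\<close>

lemma extremal_bounds:
  fixes C :: "real^'n^'n"
  assumes c: "c > 0"
  obtains K where "\<And>x. (norm (extremal_field C c x))\<^sup>2 \<le> K * ((1 + norm x ^ 4) * exp (- 2 * c * (norm x)\<^sup>2))"
    "\<And>x. (norm (extremal_field C c x))\<^sup>2 * (norm x)\<^sup>2 \<le> K * ((1 + norm x ^ 4) * exp (- 2 * c * (norm x)\<^sup>2))"
    "\<And>x. (norm (extremal_jac C c x))\<^sup>2 \<le> K * ((1 + norm x ^ 4) * exp (- 2 * c * (norm x)\<^sup>2))"
proof -
  obtain M where M: "\<And>x. norm (C *v x) \<le> norm x * M" "M \<ge> 0"
    using bounded_linear.nonneg_bounded[OF matrix_vector_mul_bounded_linear[of C]] by metis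
  \<comment> \<open>The last two summands come from squaring the Jacobian, C minus 2c times a dyad:
    the coefficient 8 is 2 from the square of a sum times 4 from
    \<open>(2 * c)\<^sup>2\<close>.\<close>
  define K where "K = M\<^sup>2 + 2 * (norm C)\<^sup>2 + 8 * c\<^sup>2 * M\<^sup>2"
  have K: "M\<^sup>2 \<le> K" "2 * (norm C)\<^sup>2 + 8 * c\<^sup>2 * M\<^sup>2 \<le> K" "K \<ge> 0" by (auto simp: K_def)
  have e: "(exp (- c * (norm x)\<^sup>2))\<^sup>2 = exp (- 2 * c * (norm x)\<^sup>2)" for x :: "real^'n"
    by (simp add: exp_double[symmetric])
  have s: "(norm x)\<^sup>2 \<le> 1 + norm x ^ 4" for x :: "real^'n"
  proof -
    have "0 \<le> ((norm x)\<^sup>2 - 1)\<^sup>2" by simp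
    then have "2 * (norm x)\<^sup>2 \<le> 1 + ((norm x)\<^sup>2)\<^sup>2" by (simp add: power2_diff)
    moreover have "((norm x)\<^sup>2)\<^sup>2 = norm x ^ 4" by simp
    moreover have "0 \<le> (norm x)\<^sup>2" by simp
    ultimately show ?thesis by linarith
  qed
  have Cx: "(norm (C *v x))\<^sup>2 \<le> (norm x)\<^sup>2 * M\<^sup>2" for x
    using power_mono[OF M(1) norm_ge_zero, of x 2] by (simp add: power_mult_distrib)
  have u: "(norm (extremal_field C c x))\<^sup>2 = exp (- 2 * c * (norm x)\<^sup>2) * (norm (C *v x))\<^sup>2" for x
    unfolding extremal_field_def norm_scaleR power_mult_distrib power2_abs e ..
  have g: "(norm (extremal_jac C c x))\<^sup>2 = exp (- 2 * c * (norm x)\<^sup>2) * (norm (C - (2 * c) *\<^sub>R outer (C *v x) x))\<^sup>2" for x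
    unfolding extremal_jac_def norm_scaleR power_mult_distrib power2_abs e ..
  have mono: "exp (- 2 * c * (norm x)\<^sup>2) * a \<le> K * ((1 + norm x ^ 4) * exp (- 2 * c * (norm x)\<^sup>2))"
    if "a \<le> K * (1 + norm x ^ 4)" for a and x :: "real^'n"
    using mult_left_mono[OF that, of "exp (- 2 * c * (norm x)\<^sup>2)"] by (simp add: mult_ac)
  show ?thesis
  proof (rule that[of K])
    fix x :: "real^'n"
    have "(norm (C *v x))\<^sup>2 \<le> M\<^sup>2 * (norm x)\<^sup>2" using Cx[of x] by (simp add: mult.commute)
    also have "\<dots> \<le> K * (1 + norm x ^ 4)" using K s[of x] by (intro mult_mono) auto
    finally show "(norm (extremal_field C c x))\<^sup>2 \<le> K * ((1 + norm x ^ 4) * exp (- 2 * c * (norm x)\<^sup>2))"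
      unfolding u by (rule mono)
    have q: "(norm (C *v x))\<^sup>2 * (norm x)\<^sup>2 \<le> M\<^sup>2 * norm x ^ 4"
      using mult_right_mono[OF Cx[of x], of "(norm x)\<^sup>2"] by (simp add: mult_ac power4_eq_xxxx power2_eq_square)
    also have "\<dots> \<le> K * (1 + norm x ^ 4)" using K by (intro mult_mono) auto
    finally show "(norm (extremal_field C c x))\<^sup>2 * (norm x)\<^sup>2 \<le> K * ((1 + norm x ^ 4) * exp (- 2 * c * (norm x)\<^sup>2))"
      unfolding u mult.assoc[of _ "(norm (C *v x))\<^sup>2"] by (rule mono)
    have "(norm (C - (2 * c) *\<^sub>R outer (C *v x) x))\<^sup>2 \<le> 2 * (norm C)\<^sup>2 + 2 * (norm (- ((2 * c) *\<^sub>R outer (C *v x) x)))\<^sup>2"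
      using norm_add_squared_le[of C "- ((2 * c) *\<^sub>R outer (C *v x) x)"] by simp
    also have "\<dots> = 2 * (norm C)\<^sup>2 + 8 * c\<^sup>2 * ((norm (C *v x))\<^sup>2 * (norm x)\<^sup>2)"
      by (simp add: norm_outer power_mult_distrib)
    also have "\<dots> \<le> 2 * (norm C)\<^sup>2 * (1 + norm x ^ 4) + 8 * c\<^sup>2 * (M\<^sup>2 * (1 + norm x ^ 4))"
    proof (rule add_mono)
      show "2 * (norm C)\<^sup>2 \<le> 2 * (norm C)\<^sup>2 * (1 + norm x ^ 4)"
        using mult_left_mono[of 1 "1 + norm x ^ 4" "2 * (norm C)\<^sup>2"] by simp
      have "M\<^sup>2 * norm x ^ 4 \<le> M\<^sup>2 * (1 + norm x ^ 4)" by (intro mult_left_mono) auto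
      with q have "(norm (C *v x))\<^sup>2 * (norm x)\<^sup>2 \<le> M\<^sup>2 * (1 + norm x ^ 4)" by (rule order_trans)
      then show "8 * c\<^sup>2 * ((norm (C *v x))\<^sup>2 * (norm x)\<^sup>2) \<le> 8 * c\<^sup>2 * (M\<^sup>2 * (1 + norm x ^ 4))"
        by (intro mult_left_mono) auto
    qed
    also have "\<dots> = (2 * (norm C)\<^sup>2 + 8 * c\<^sup>2 * M\<^sup>2) * (1 + norm x ^ 4)" by (simp add: algebra_simps)
    also have "\<dots> \<le> K * (1 + norm x ^ 4)" using K by (intro mult_right_mono) auto
    finally show "(norm (extremal_jac C c x))\<^sup>2 \<le> K * ((1 + norm x ^ 4) * exp (- 2 * c * (norm x)\<^sup>2))"
      unfolding g by (rule mono)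
  qed
qed

lemma extremal_jac_continuous: "continuous_on UNIV (extremal_jac C c)"
  unfolding extremal_jac_def
  by (intro continuous_intros continuous_on_outer linear_continuous_on matrix_vector_mul_bounded_linear)

text \<open>Dominated convergence for the cut-off fields. The Jacobian error has one part from the
  cutoff differing from 1 and one from its gradient; the latter grows like |x| at most, which is
  compensated by the weighted bound on the field.\<close>

lemma D_field_extremal:
  fixes C :: "real^'n^'n"
  assumes c: "c > 0"
  shows "D_field (extremal_field C c) (extremal_jac C c)"
proof -
  let ?u = "extremal_field C c" and ?G = "extremal_jac C c" and ?\<phi> = "cutoff_extremal C c"
  have "continuous_on UNIV ?u"
    by (intro continuous_at_imp_continuous_on ballI has_derivative_continuous[OF extremal_field_has_derivative])
  then have um [measurable]: "?u \<in> borel_measurable borel" by (rule borel_measurable_continuous_onI)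
  have Gm [measurable]: "?G \<in> borel_measurable borel"
    using extremal_jac_continuous by (rule borel_measurable_continuous_onI)
  have \<phi>: "Cc_inf_field (?\<phi> k)" for k by (rule Cc_inf_field_cutoff_extremal)
  have [measurable]: "?\<phi> k \<in> borel_measurable borel" "jac (?\<phi> k) \<in> borel_measurable borel" for k
    by (rule Cc_inf_field_continuous[OF \<phi>[of k]], rule borel_measurable_continuous_onI, assumption)+
  obtain K where K: "\<And>x. (norm (?u x))\<^sup>2 \<le> K * ((1 + norm x ^ 4) * exp (- 2 * c * (norm x)\<^sup>2))"
    "\<And>x. (norm (?u x))\<^sup>2 * (norm x)\<^sup>2 \<le> K * ((1 + norm x ^ 4) * exp (- 2 * c * (norm x)\<^sup>2))"
    "\<And>x. (norm (?G x))\<^sup>2 \<le> K * ((1 + norm x ^ 4) * exp (- 2 * c * (norm x)\<^sup>2))"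
    using extremal_bounds[OF c, of C] by blast
  define w where "w = (\<lambda>x :: real^'n. K * ((1 + norm x ^ 4) * exp (- 2 * c * (norm x)\<^sup>2)))"
  \<comment> \<open>The factor is 290 = 2 + 2 * 144: both error terms are doubled by the square of a
    sum, and 144 is the square of the gradient constant 12.\<close>
  have w: "integrable lborel w" "integrable lborel (\<lambda>x. 290 * w x)"
    unfolding w_def using integrable_quartic_gaussian[OF c] by auto
  have Kw: "(norm (?u x))\<^sup>2 \<le> w x" "(norm (?u x))\<^sup>2 * (norm x)\<^sup>2 \<le> w x" "(norm (?G x))\<^sup>2 \<le> w x" for x
    using K by (auto simp: w_def)
  have du: "(norm (?\<phi> k x - ?u x))\<^sup>2 = (cutoff k x - 1)\<^sup>2 * (norm (?u x))\<^sup>2" for k x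
  proof -
    have "?\<phi> k x - ?u x = (cutoff k x - 1) *\<^sub>R ?u x" by (simp add: cutoff_extremal_def algebra_simps)
    then show ?thesis by (simp add: power_mult_distrib)
  qed
  have q: "(cutoff k x - 1)\<^sup>2 \<le> 1" for k and x :: "real^'n"
    using cutoff_bounds[of k x] by (subst abs_square_le_1) auto
  have ql: "(\<lambda>k. (cutoff k x - 1)\<^sup>2) \<longlonglongrightarrow> 0" for x :: "real^'n"
  proof -
    have "(\<lambda>k. (cutoff k x - 1)\<^sup>2) \<longlonglongrightarrow> (1 - 1)\<^sup>2" by (intro tendsto_intros cutoff_tendsto)
    then show ?thesis by simp
  qed
  have qm: "(cutoff k x - 1)\<^sup>2 * a \<le> a" if "a \<ge> 0" for k a and x :: "real^'n"
    using mult_right_mono[OF q that] by simp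
  have "(\<lambda>k. \<integral>\<^sup>+ x. ennreal ((norm (?\<phi> k x - ?u x))\<^sup>2) \<partial>lborel) \<longlonglongrightarrow> 0"
  proof (rule nn_integral_dominated_tendsto_0[OF _ w(1)])
    show "(norm (?\<phi> k x - ?u x))\<^sup>2 \<le> w x" for k x
      unfolding du using qm[of "(norm (?u x))\<^sup>2" k x] Kw(1)[of x] by simp
    show "(\<lambda>k. (norm (?\<phi> k x - ?u x))\<^sup>2) \<longlonglongrightarrow> 0" for x
      unfolding du by (intro tendsto_mult_left_zero ql)
  qed auto
  moreover have "(\<lambda>k. \<integral>\<^sup>+ x. ennreal ((norm (?\<phi> k x - ?u x))\<^sup>2 * (norm x)\<^sup>2) \<partial>lborel) \<longlonglongrightarrow> 0"
  proof (rule nn_integral_dominated_tendsto_0[OF _ w(1)])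
    show "(norm (?\<phi> k x - ?u x))\<^sup>2 * (norm x)\<^sup>2 \<le> w x" for k x
      unfolding du mult.assoc using qm[of "(norm (?u x))\<^sup>2 * (norm x)\<^sup>2" k x] Kw(2)[of x] by simp
    show "(\<lambda>k. (norm (?\<phi> k x - ?u x))\<^sup>2 * (norm x)\<^sup>2) \<longlonglongrightarrow> 0" for x
      unfolding du by (intro tendsto_mult_left_zero ql)
  qed auto
  moreover have "(\<lambda>k. \<integral>\<^sup>+ x. ennreal ((norm (jac (?\<phi> k) x - ?G x))\<^sup>2) \<partial>lborel) \<longlonglongrightarrow> 0"
  proof (rule nn_integral_dominated_tendsto_0[OF _ w(2)])
    have e: "jac (?\<phi> k) x - ?G x = (cutoff k x - 1) *\<^sub>R ?G x + outer (?u x) (cutoff_grad k x)" for k x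
      unfolding jac_cutoff_extremal by (simp add: algebra_simps)
    have le: "(norm (jac (?\<phi> k) x - ?G x))\<^sup>2
      \<le> 2 * ((cutoff k x - 1)\<^sup>2 * (norm (?G x))\<^sup>2) + 2 * ((norm (?u x))\<^sup>2 * (norm (cutoff_grad k x))\<^sup>2)" for k x
      unfolding e using norm_add_squared_le[of "(cutoff k x - 1) *\<^sub>R ?G x" "outer (?u x) (cutoff_grad k x)"]
      by (simp add: norm_outer power_mult_distrib)
    show "(norm (jac (?\<phi> k) x - ?G x))\<^sup>2 \<le> 290 * w x" for k x
    proof -
      have "(norm (cutoff_grad k x))\<^sup>2 \<le> (12 * norm x)\<^sup>2"
        by (intro power_mono cutoff_grad_le_uniform) simp
      then have "(norm (?u x))\<^sup>2 * (norm (cutoff_grad k x))\<^sup>2 \<le> (norm (?u x))\<^sup>2 * (144 * (norm x)\<^sup>2)"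
        by (intro mult_left_mono) (auto simp: power_mult_distrib)
      also have "\<dots> \<le> 144 * w x" using Kw(2)[of x] by simp
      finally have "(norm (?u x))\<^sup>2 * (norm (cutoff_grad k x))\<^sup>2 \<le> 144 * w x" .
      moreover have "(cutoff k x - 1)\<^sup>2 * (norm (?G x))\<^sup>2 \<le> w x"
        using qm[of "(norm (?G x))\<^sup>2" k x] Kw(3)[of x] by simp
      ultimately show ?thesis using le[of k x] by linarith
    qed
    show "(\<lambda>k. (norm (jac (?\<phi> k) x - ?G x))\<^sup>2) \<longlonglongrightarrow> 0" for x
    proof (rule tendsto_sandwich)
      show "eventually (\<lambda>k. 0 \<le> (norm (jac (?\<phi> k) x - ?G x))\<^sup>2) sequentially" by simp
      show "eventually (\<lambda>k. (norm (jac (?\<phi> k) x - ?G x))\<^sup>2 \<le> 2 * ((cutoff k x - 1)\<^sup>2 * (norm (?G x))\<^sup>2) + 2 * ((norm (?u x))\<^sup>2 * (norm (cutoff_grad k x))\<^sup>2)) sequentially"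
        using le by (intro always_eventually) blast
      have "(\<lambda>k. 2 * ((cutoff k x - 1)\<^sup>2 * (norm (?G x))\<^sup>2) + 2 * ((norm (?u x))\<^sup>2 * (norm (cutoff_grad k x))\<^sup>2))
        \<longlonglongrightarrow> 2 * (0 * (norm (?G x))\<^sup>2) + 2 * ((norm (?u x))\<^sup>2 * (norm (0 :: real^'n))\<^sup>2)"
        by (intro tendsto_intros ql cutoff_grad_tendsto)
      then show "(\<lambda>k. 2 * ((cutoff k x - 1)\<^sup>2 * (norm (?G x))\<^sup>2) + 2 * ((norm (?u x))\<^sup>2 * (norm (cutoff_grad k x))\<^sup>2)) \<longlonglongrightarrow> 0"
        by simp
    qed simp
  qed auto
  moreover have "?u \<in> borel_measurable lborel" "?G \<in> borel_measurable lborel" using um Gm by auto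
  ultimately show ?thesis
    unfolding D_field_def using \<phi> by (intro conjI exI[of _ ?\<phi>] allI)
qed

section \<open>Gaussian fields are toroidal and attain equality\<close>

lemma skew_inner_zero:
  fixes C :: "real^'n^'n"
  assumes "transpose C = - C"
  shows "x \<bullet> (C *v x) = 0"
proof -
  have "x \<bullet> (C *v x) = C \<bullet> outer x x" by (simp add: inner_outer)
  also have "\<dots> = transpose C \<bullet> outer x x"
    using inner_transpose_transpose[of C "outer x x"] by (simp add: transpose_outer)
  also have "\<dots> = - (x \<bullet> (C *v x))" by (simp add: assms inner_outer[symmetric])
  finally show ?thesis by simp
qed

text \<open>Antisymmetry is used twice for the divergence: the diagonal of \<open>C\<close>
  vanishes, and so does the trace of the dyad, which is \<open>x \<bullet> (C *v x)\<close>. The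
  latter is also the radial component up to the Gaussian factor.\<close>

lemma toroidal_extremal:
  fixes C :: "real^'n^'n"
  assumes C: "transpose C = - C"
  shows "toroidal (extremal_field C c) (extremal_jac C c)"
proof -
  have "C $ j $ j = 0" for j
  proof -
    have "transpose C $ j $ j = (- C) $ j $ j" by (simp add: C)
    then show ?thesis by simp
  qed
  moreover have "(\<Sum>j\<in>UNIV. (C *v x) $ j * x $ j) = 0" for x
    using skew_inner_zero[OF C, of x] by (simp add: inner_vec_def mult.commute)
  ultimately have "(\<Sum>j\<in>UNIV. extremal_jac C c x $ j $ j) = 0" for x
    by (simp add: extremal_jac_def sum_negf sum_distrib_left[symmetric])
  then show ?thesis
    by (simp add: toroidal_def extremal_field_def skew_inner_zero[OF C])
qed

text \<open>The constant part \<open>C\<close> cancels against its transpose, and what remains is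
  the derivative of the Gaussian factor. This is the equality condition with parameter
  \<open>2 * c\<close>.\<close>

lemma extremal_symmetric_gradient:
  assumes C: "transpose C = - C"
  shows "extremal_jac C c x + transpose (extremal_jac C c x)
    = - (2 * c) *\<^sub>R (outer x (extremal_field C c x) + outer (extremal_field C c x) x)"
proof -
  have "C $ i $ j + C $ j $ i = 0" for i j
  proof -
    have "transpose C $ i $ j = (- C) $ i $ j" by (simp add: C)
    then show ?thesis by simp
  qed
  then have "(extremal_jac C c x + transpose (extremal_jac C c x)) $ i $ j
    = (- (2 * c) *\<^sub>R (outer x (extremal_field C c x) + outer (extremal_field C c x) x)) $ i $ j" for i j
  proof -
    have "C $ j $ i = - C $ i $ j" using \<open>\<And>i j. C $ i $ j + C $ j $ i = 0\<close>[of i j] by simp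
    then show ?thesis
      by (simp add: extremal_jac_def extremal_field_def algebra_simps)
  qed
  then show ?thesis unfolding vec_eq_iff by blast
qed

lemma L2_sq_extremal_nonzero:
  fixes C :: "real^'n^'n"
  assumes c: "c > 0" and C: "C \<noteq> 0"
  shows "L2_sq (extremal_field C c) \<noteq> 0"
proof
  assume 0: "L2_sq (extremal_field C c) = 0"
  obtain \<phi> where "L2_tendsto \<phi> (extremal_field C c)"
    using D_field_L2_tendsto[OF D_field_extremal[OF c, of C]] by blast
  then have "integrable lborel (\<lambda>x. (norm (extremal_field C c x))\<^sup>2)"
    by (simp add: L2_tendsto_def square_integrable_def)
  from integral_nonneg_eq_0_iff_AE[OF this] 0
  have "AE x in lborel. (norm (extremal_field C c x))\<^sup>2 = 0" by (simp add: L2_sq_def)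
  then have "AE x in lborel. norm (C *v x) = 0"
    by eventually_elim (simp add: extremal_field_def)
  then have "norm (C *v x) = 0" for x
    by (rule continuous_AE_zero[rotated])
       (intro continuous_intros linear_continuous_on matrix_vector_mul_bounded_linear)
  then have "C = 0" by (simp add: matrix_eq)
  with C show False by simp
qed

text \<open>The square integral is computed in two ways as a polynomial in \<open>t\<close>: from
  the general identity, and from the symmetric gradient of the extremal, where it is a multiple of
  (t - 2c)^2. Comparing the two yields the relations between the three integrals without evaluating
  any of them.\<close>

lemma extremal_equality:
  fixes C :: "real^'n^'n"
  assumes c: "c > 0" and C: "transpose C = - C"
  shows "grad_sq (extremal_jac C c) * weighted_sq (extremal_field C c)
    = (real CARD('n) + 2)\<^sup>2 / 4 * (L2_sq (extremal_field C c))\<^sup>2"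
proof -
  define A where "A = grad_sq (extremal_jac C c)"
  define W where "W = weighted_sq (extremal_field C c)"
  define L where "L = L2_sq (extremal_field C c)"
  \<comment> \<open>Here \<open>N\<close> is the dimension plus 2, not the dimension.\<close>
  define N where "N = real CARD('n) + 2"
  note D = D_field_extremal[OF c, of C] and T = toroidal_extremal[OF C, of c]
  have "(\<integral>x. (norm (extremal_jac C c x + transpose (extremal_jac C c x)
      + t *\<^sub>R (outer x (extremal_field C c x) + outer (extremal_field C c x) x)))\<^sup>2 \<partial>lborel) = (t - 2 * c)\<^sup>2 * (2 * W)" for t
    unfolding extremal_symmetric_gradient[OF C] scaleR_add_left[symmetric] norm_scaleR power_mult_distrib power2_abs W_def
    by (simp add: toroidal_identities(6)[OF D T])
  then have e: "2 * (A - t * N * L + t\<^sup>2 * W) = (t - 2 * c)\<^sup>2 * (2 * W)" for t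
    using toroidal_square_identity(2)[OF D T, of t] by (simp add: A_def W_def L_def N_def)
  \<comment> \<open>Two values of \<open>t\<close> suffice: 0 isolates \<open>A\<close>, and the
    double root \<open>2 * c\<close> then determines \<open>N * L\<close>.\<close>
  have A: "A = 4 * c\<^sup>2 * W" using e[of 0] by (simp add: power_mult_distrib)
  have "A - 2 * c * N * L + (2 * c)\<^sup>2 * W = 0" using e[of "2 * c"] by (simp only: diff_self power_zero_numeral mult_zero_left mult_eq_0_iff) simp
  then have "2 * c * (N * L) = A + (2 * c)\<^sup>2 * W" unfolding mult.assoc[of "2 * c"] by linarith
  also have "\<dots> = 2 * c * (4 * c * W)" by (simp add: A power2_eq_square)
  finally have "2 * c * (N * L) = 2 * c * (4 * c * W)" .
  then have NL: "N * L = 4 * c * W"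
    by (rule iffD1[OF mult_left_cancel, rotated]) (use c in simp)
  have "A * W = (4 * c * W)\<^sup>2 / 4" unfolding A by (simp add: power2_eq_square)
  moreover have "(4 * c * W)\<^sup>2 / 4 = N\<^sup>2 / 4 * L\<^sup>2" unfolding NL[symmetric] by (simp add: power_mult_distrib)
  ultimately have "A * W = N\<^sup>2 / 4 * L\<^sup>2" by (rule trans)
  then show ?thesis unfolding A_def W_def L_def N_def .
qed

text \<open>The witness is the generator of rotations in a coordinate plane; it shows that the class
  of extremals is nonempty.\<close>

lemma exists_nonzero_skew_matrix:
  assumes "CARD('n) \<ge> 2"
  shows "\<exists>C :: real^'n^'n. transpose C = - C \<and> C \<noteq> 0"
proof -
  obtain a b :: 'n where ab: "a \<noteq> b"
    using assms card_2_iff' ex_card[of 2 "UNIV :: 'n set"] by (metis UNIV_I)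
  define C where "C = outer (axis a 1 :: real^'n) (axis b 1) - outer (axis b 1) (axis a 1)"
  have "transpose C = - C" by (simp add: C_def vec_eq_iff)
  moreover have "C $ a $ b = 1" using ab by (simp add: C_def axis_def)
  then have "C \<noteq> 0" by auto
  ultimately show ?thesis by blast
qed

theorem theorem2:
  assumes "CARD('n) \<ge> 3"
  shows
    "(\<forall>(u :: real^'n \<Rightarrow> real^'n) G. D_field u G \<and> toroidal u G \<longrightarrow>
        grad_sq G * weighted_sq u \<ge> (real CARD('n) + 2)\<^sup>2 / 4 * (L2_sq u)\<^sup>2)
   \<and> Inf {grad_sq G * weighted_sq u / (L2_sq u)\<^sup>2 | (u :: real^'n \<Rightarrow> real^'n) G.
           D_field u G \<and> toroidal u G \<and> L2_sq u \<noteq> 0} = (real CARD('n) + 2)\<^sup>2 / 4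
   \<and> (\<forall>(C :: real^'n^'n) c. c > 0 \<and> transpose C = - C \<and> C \<noteq> 0 \<longrightarrow>
        (\<exists>G. D_field (extremal_field C c) G \<and> toroidal (extremal_field C c) G \<and>
             L2_sq (extremal_field C c) \<noteq> 0 \<and>
             grad_sq G * weighted_sq (extremal_field C c)
               = (real CARD('n) + 2)\<^sup>2 / 4 * (L2_sq (extremal_field C c))\<^sup>2))
   \<and> (\<forall>(u :: real^'n \<Rightarrow> real^'n) G. D_field u G \<and> toroidal u G \<and> L2_sq u \<noteq> 0 \<and>
        grad_sq G * weighted_sq u = (real CARD('n) + 2)\<^sup>2 / 4 * (L2_sq u)\<^sup>2 \<and>
        ((\<lambda>R. R ^ CARD('n) * sphere_integral (\<lambda>\<sigma>. (norm (u (R *\<^sub>R \<sigma>)))\<^sup>2)) \<longlongrightarrow> 0) at_top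
        \<longrightarrow> (\<exists>(C :: real^'n^'n) c. c > 0 \<and> transpose C = - C \<and> C \<noteq> 0 \<and>
               (AE x in lborel. u x = extremal_field C c x)))"
proof (intro conjI allI impI)
  fix u :: "real^'n \<Rightarrow> real^'n" and G
  assume "D_field u G \<and> toroidal u G"
  then show "grad_sq G * weighted_sq u \<ge> (real CARD('n) + 2)\<^sup>2 / 4 * (L2_sq u)\<^sup>2"
    by (intro toroidal_inequality) auto
next
  let ?S = "{grad_sq G * weighted_sq u / (L2_sq u)\<^sup>2 | (u :: real^'n \<Rightarrow> real^'n) G.
           D_field u G \<and> toroidal u G \<and> L2_sq u \<noteq> 0}"
  obtain C :: "real^'n^'n" where C: "transpose C = - C" "C \<noteq> 0"
    using exists_nonzero_skew_matrix[where 'n='n] assms by auto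
  \<comment> \<open>Any positive exponent gives the same quotient; 1 is an arbitrary choice.\<close>
  have L: "L2_sq (extremal_field C 1) \<noteq> 0" by (rule L2_sq_extremal_nonzero) (use C in auto)
  have "grad_sq (extremal_jac C 1) * weighted_sq (extremal_field C 1) / (L2_sq (extremal_field C 1))\<^sup>2
      = (real CARD('n) + 2)\<^sup>2 / 4"
    unfolding extremal_equality[OF zero_less_one C(1)] using L by simp
  moreover have "grad_sq (extremal_jac C 1) * weighted_sq (extremal_field C 1) / (L2_sq (extremal_field C 1))\<^sup>2 \<in> ?S"
    using D_field_extremal[OF zero_less_one, of C] toroidal_extremal[OF C(1), of 1] L by blast
  ultimately have "(real CARD('n) + 2)\<^sup>2 / 4 \<in> ?S" by (simp only:)
  moreover have "(real CARD('n) + 2)\<^sup>2 / 4 \<le> r" if "r \<in> ?S" for r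
  proof -
    from that obtain u :: "real^'n \<Rightarrow> real^'n" and G
      where r: "r = grad_sq G * weighted_sq u / (L2_sq u)\<^sup>2" and u: "D_field u G" "toroidal u G" "L2_sq u \<noteq> 0" by blast
    have "(L2_sq u)\<^sup>2 > 0" using u(3) by simp
    then show ?thesis
      unfolding r pos_le_divide_eq[OF \<open>(L2_sq u)\<^sup>2 > 0\<close>] by (intro toroidal_inequality u)
  qed
  \<comment> \<open>The constant is a lower bound that belongs to the set, so the infimum is a
    minimum.\<close>
  ultimately show "Inf ?S = (real CARD('n) + 2)\<^sup>2 / 4" by (rule cInf_eq_minimum)
next
  fix C :: "real^'n^'n" and c :: real
  assume "c > 0 \<and> transpose C = - C \<and> C \<noteq> 0"
  then show "\<exists>G. D_field (extremal_field C c) G \<and> toroidal (extremal_field C c) G \<and>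
             L2_sq (extremal_field C c) \<noteq> 0 \<and>
             grad_sq G * weighted_sq (extremal_field C c)
               = (real CARD('n) + 2)\<^sup>2 / 4 * (L2_sq (extremal_field C c))\<^sup>2"
    by (intro exI[of _ "extremal_jac C c"] conjI D_field_extremal toroidal_extremal L2_sq_extremal_nonzero extremal_equality)
       auto
next
  fix u :: "real^'n \<Rightarrow> real^'n" and G
  assume "D_field u G \<and> toroidal u G \<and> L2_sq u \<noteq> 0 \<and>
        grad_sq G * weighted_sq u = (real CARD('n) + 2)\<^sup>2 / 4 * (L2_sq u)\<^sup>2 \<and>
        ((\<lambda>R. R ^ CARD('n) * sphere_integral (\<lambda>\<sigma>. (norm (u (R *\<^sub>R \<sigma>)))\<^sup>2)) \<longlongrightarrow> 0) at_top"
  then show "\<exists>(C :: real^'n^'n) c. c > 0 \<and> transpose C = - C \<and> C \<noteq> 0 \<and>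
               (AE x in lborel. u x = extremal_field C c x)"
    by (intro toroidal_rigidity[of u G]) auto
qed

end
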